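(* Let $\alpha\in\mathbb{R}$, let $\rho$ be a finite positive Borel measure on $\mathbb{R}$, and let $\Phi:\mathbb{C}^{+}\to\mathbb{C}^{+}$ be the analytic function $$\Phi(z)=\alpha+z+\int_{-\infty}^{\infty}\frac{1+tz}{t-z}\,d\rho(t),\qquad z\in\mathbb{C}^{+}.$$ Define $$\mathbf{A}=\inf_{u\in H^2_{\mathbb{C}^+}\setminus\{0\}}\frac{\|C_\Phi u\|_2^2}{\|u\|_2^2},\qquad \mathbf{B}=\inf_{-\infty<a<b<\infty}\frac{|\{x\in\mathbb{R}:\Phi(x)\in(a,b)\}|}{b-a},$$ $$\mathbf{C}=\inf_{-\infty<a<b<\infty}\frac{|\{x\in\mathbb{R}:\Phi(x)\in D_{a,b}\}|}{b-a},\qquad \mathbf{D}=\inf_{\tau\in\mathbb{R}}\mu_{\tau,\mathrm{s}}(\mathbb{R}).$$ Then $\mathbf{A}=\mathbf{B}=\mathbf{C}=\mathbf{D}$.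
   Context: $\mathbb{C}^{+}=\{x+iy:y>0\}$ is the open upper half-plane. $H^2_{\mathbb{C}^+}$ is the Hardy space of analytic functions $u:\mathbb{C}^+\to\mathbb{C}$ with $\|u\|_2^2=\sup_{y>0}\int_{-\infty}^{\infty}|u(x+iy)|^2\,dx<\infty$. The composition operator is $C_\Phi u=u\circ\Phi$; for $\Phi$ of the form $\Phi(z)=\alpha+z+\int_{-\infty}^{\infty}\frac{1+tz}{t-z}\,d\rho(t)$, $z\in\mathbb{C}^{+}$, with $\alpha\in\mathbb{R}$ and $\rho$ a finite positive Borel measure on $\mathbb{R}$, it is known to be a contraction on $H^2_{\mathbb{C}^+}$. For $x\in\mathbb{R}$, $\Phi(x)=\lim_{y\downarrow0}\Phi(x+iy)$ denotes the boundary limit, which exists for Lebesgue-almost every $x\in\mathbb{R}$ and in general takes values in the closed upper half-plane; thus $\Phi(x)\in(a,b)$ means that $\Phi(x)$ is real and lies in $(a,b)$. $|\sigma|$ is the Lebesgue measure of a Borel set $\sigma\subset\mathbb{R}$ (sets defined by boundary values are understood up to null sets). For a finite interval $(a,b)\subset\mathbb{R}$, $D_{a,b}\subset\mathbb{C}$ is the open disk with diameter $(a,b)$. For each $\tau\in\mathbb{R}$, $\mu_\tau$ is the (unique) Borel probability measure on $\mathbb{R}$ such that $$\frac{1}{\tau-\Phi(z)}=\int_{-\infty}^{\infty}\frac{d\mu_\tau(t)}{t-z},\qquad z\in\mathbb{C}^+$$ (such a measure is known to exist), and $\mu_{\tau,\mathrm{s}}$ is the singular part of $\mu_\tau$ in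 its Lebesgue decomposition relative to Lebesgue measure. *)

theory Defs
  imports "HOL-Probability.Probability" "HOL-Complex_Analysis.Complex_Analysis"
begin

definition upper_half_plane :: "complex set" where
  "upper_half_plane = {z. Im z > 0}"

definition hardy_norm_sq :: "(complex \<Rightarrow> complex) \<Rightarrow> ennreal" where
  "hardy_norm_sq u =
     (SUP y\<in>{0<..}. \<integral>\<^sup>+ x. ennreal ((cmod (u (Complex x y)))\<^sup>2) \<partial>lborel)"

text \<open>Elements of the Hardy space are represented by total functions of which only the
  restriction to the upper half-plane matters; hence the zero element is any function that
  vanishes there.\<close>

definition hardy_space :: "(complex \<Rightarrow> complex) set" where
  "hardy_space = {u. u holomorphic_on upper_half_plane \<and> hardy_norm_sq u < \<infinity>}"

definition hardy_nonzero :: "(complex \<Rightarrow> complex) set" where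
  "hardy_nonzero = {u \<in> hardy_space. \<exists>z\<in>upper_half_plane. u z \<noteq> 0}"

text \<open>The boundary limit need not exist at every point, so it is rendered as a relation;
  points without a finite limit belong to no preimage.\<close>

definition has_boundary_value :: "(complex \<Rightarrow> complex) \<Rightarrow> real \<Rightarrow> complex \<Rightarrow> bool" where
  "has_boundary_value \<Phi> x w \<longleftrightarrow> ((\<lambda>y. \<Phi> (Complex x y)) \<longlongrightarrow> w) (at_right 0)"

definition boundary_preimage :: "(complex \<Rightarrow> complex) \<Rightarrow> complex set \<Rightarrow> real set" where
  "boundary_preimage \<Phi> S = {x. \<exists>w\<in>S. has_boundary_value \<Phi> x w}"

definition diameter_disk :: "real \<Rightarrow> real \<Rightarrow> complex set" where
  "diameter_disk a b = ball (complex_of_real ((a + b) / 2)) ((b - a) / 2)"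

definition is_clark_measure :: "(complex \<Rightarrow> complex) \<Rightarrow> real \<Rightarrow> real measure \<Rightarrow> bool" where
  "is_clark_measure \<Phi> \<tau> \<mu> \<longleftrightarrow> prob_space \<mu> \<and> sets \<mu> = sets borel \<and>
     (\<forall>z\<in>upper_half_plane.
        1 / (complex_of_real \<tau> - \<Phi> z) = (LINT t|\<mu>. 1 / (complex_of_real t - z)))"

definition clark_measure :: "(complex \<Rightarrow> complex) \<Rightarrow> real \<Rightarrow> real measure" where
  "clark_measure \<Phi> \<tau> = (THE \<mu>. is_clark_measure \<Phi> \<tau> \<mu>)"

definition lebesgue_decomposition ::
    "real measure \<Rightarrow> real measure \<Rightarrow> real measure \<Rightarrow> bool" where
  "lebesgue_decomposition \<mu> \<mu>ac \<mu>s \<longleftrightarrow>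
     sets \<mu>ac = sets borel \<and> sets \<mu>s = sets borel \<and>
     (\<forall>E\<in>sets borel. emeasure \<mu> E = emeasure \<mu>ac E + emeasure \<mu>s E) \<and>
     absolutely_continuous lborel \<mu>ac \<and>
     (\<exists>N\<in>null_sets lborel. emeasure \<mu>s (- N) = 0)"

definition singular_part :: "real measure \<Rightarrow> real measure" where
  "singular_part \<mu> = (THE \<mu>s. \<exists>\<mu>ac. lebesgue_decomposition \<mu> \<mu>ac \<mu>s)"

text \<open>The four constants are taken in the extended nonnegative reals.  In the first one the
  quotient is never degenerate, since the squared norm of a nonzero element is positive and
  finite.\<close>

definition const_A :: "(complex \<Rightarrow> complex) \<Rightarrow> ennreal" where
  "const_A \<Phi> = (INF u\<in>hardy_nonzero. hardy_norm_sq (u \<circ> \<Phi>) / hardy_norm_sq u)"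

definition const_B :: "(complex \<Rightarrow> complex) \<Rightarrow> ennreal" where
  "const_B \<Phi> = (INF (a, b)\<in>{(a, b). a < b}.
     emeasure lborel (boundary_preimage \<Phi> (complex_of_real ` {a<..<b})) / ennreal (b - a))"

definition const_C :: "(complex \<Rightarrow> complex) \<Rightarrow> ennreal" where
  "const_C \<Phi> = (INF (a, b)\<in>{(a, b). a < b}.
     emeasure lborel (boundary_preimage \<Phi> (diameter_disk a b)) / ennreal (b - a))"

definition const_D :: "(complex \<Rightarrow> complex) \<Rightarrow> ennreal" where
  "const_D \<Phi> = (INF \<tau>. emeasure (singular_part (clark_measure \<Phi> \<tau>)) UNIV)"

end

theory Submission
  imports Defs
begin

text \<open>Write \<open>\<phi>\<close> for the boundary values of \<open>\<Phi>\<close> and \<open>P\<^sub>w\<close> for the Poisson kernel at \<open>w\<close>. The Poisson formula for the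
  bounded function \<open>1/(s - i\<eta> - \<Phi>)\<close> and its behaviour at \<open>i\<infinity>\<close> give \<open>\<integral> P\<^bsub>\<phi>(x)+i\<eta>\<^esub>(s) dx = 1\<close>. The part
  \<open>\<integral> \<eta>/(\<pi>|\<phi>(x) - s + i\<eta>|\<^sup>2) dx\<close> of this integral bounds the quotient in \<open>\<A>\<close> for the reproducing kernel at
  \<open>s + i\<eta>\<close>, and as \<open>\<eta>\<close> decreases to 0 it decreases to \<open>m(s) = 1 - \<integral> P\<^bsub>\<phi>(x)\<^esub>(s) dx\<close>. All four constants
  equal the infimum of \<open>m\<close>. Indeed \<open>m\<close> is the density of the pushforward of Lebesgue measure under the
  real values of \<open>\<phi>\<close>, which gives \<open>\<B>\<close> because \<open>m\<close> is upper semicontinuous, and gives the lower bound for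
  \<open>\<A>\<close> because \<open>\<parallel>C\<^sub>\<Phi> u\<parallel>\<^sup>2\<close> dominates the integral of \<open>|u \<circ> \<phi>|\<^sup>2\<close> over the points where \<open>\<phi>\<close> is real. Covering an
  interval by small disks identifies \<open>\<C>\<close> with \<open>\<B>\<close>. Finally \<open>P\<^bsub>\<phi>(x)\<^esub>(\<tau>)\<close> is the density of the absolutely continuous
  part of the probability measure \<open>\<mu>\<^sub>\<tau>\<close>, so \<open>m(\<tau>)\<close> is the mass of its singular part.\<close>

section \<open>The Poisson kernel of the upper half-plane\<close>

text \<open>The obstacle is that \<open>\<Phi>\<close> is unbounded and that its boundary values
  must first be shown to exist. They come from the single function \<open>1/(-i - \<Phi>)\<close>,
  which lies in the Hardy space because its squared modulus is at most its imaginary part; a maximal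
  inequality gives it vertical limits, and a Moebius map carries them back to \<open>\<Phi>\<close>.
  The parameter \<open>\<eta> > 0\<close> is there because \<open>1/(s - \<Phi>)\<close> need not be
  bounded: with the pole moved down to \<open>s - i \<eta>\<close> the Poisson formula applies, and
  the singular mass is what fails to survive pointwise as \<open>\<eta>\<close> tends to 0. Two
  properties of \<open>\<Phi>\<close> fix the normalisation: \<open>Im \<Phi>(z) \<ge> Im z\<close>
  bounds resolvents on horizontal lines, and \<open>\<Phi>(iy)/(iy)\<close> tending to 1 makes every
  pushforward mass exactly 1. The lower bound for A is first proved for upward translates of
  \<open>u\<close>, since \<open>u\<close> need not extend continuously to the real boundary values
  of \<open>\<Phi>\<close>. The translation is then removed by its norm continuity together with the
  contractivity of the composition operator.\<close>

text \<open>The factor \<open>1/pi\<close> gives mass 1 over the line. At a real \<open>z\<close>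
  the value is 0, also for \<open>t = z\<close>, where division by zero returns 0; integrals of
  \<open>poisson (\<phi> x) s\<close> therefore see only the non-real boundary values.\<close>

definition poisson :: "complex \<Rightarrow> real \<Rightarrow> real" where
  "poisson z t = Im z / (pi * (cmod (complex_of_real t - z))\<^sup>2)"

lemma poisson_Complex: "poisson (Complex x y) t = y / (pi * ((t - x)\<^sup>2 + y\<^sup>2))"
  by (simp add: poisson_def cmod_power2)

lemma poisson_nonneg: "Im z \<ge> 0 \<Longrightarrow> poisson z t \<ge> 0"
  by (simp add: poisson_def)

lemma poisson_commute: "poisson (Complex x y) t = poisson (Complex t y) x"
  by (simp add: poisson_Complex power2_commute)

lemma poisson_measurable [measurable (raw)]:
  assumes [measurable]: "f \<in> borel_measurable M" "g \<in> borel_measurable M"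
  shows "(\<lambda>x. poisson (f x) (g x)) \<in> borel_measurable M"
  unfolding poisson_def by measurable

lemma borel_measurable_Complex [measurable (raw)]:
  assumes [measurable]: "f \<in> borel_measurable M" "g \<in> borel_measurable M"
  shows "(\<lambda>x. Complex (f x) (g x)) \<in> borel_measurable M"
  unfolding Complex_eq by measurable

lemma has_bochner_integral_cauchy: "has_bochner_integral lborel (\<lambda>x::real. 1 / (pi * (1 + x\<^sup>2))) 1"
proof -
  have "integrable lborel (\<lambda>x::real. inverse (1 + x\<^sup>2))" "(LINT x|lborel. inverse (1 + x\<^sup>2 :: real)) = pi"
    using integrable_inverse_1_plus_square LBINT_inverse_1_plus_square
    by (auto simp: set_integrable_def interval_lebesgue_integral_def set_lebesgue_integral_def)
  then have "has_bochner_integral lborel (\<lambda>x::real. inverse (1 + x\<^sup>2)) pi"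
    by (simp add: has_bochner_integral_iff)
  from has_bochner_integral_mult_right[OF this, of "1/pi"] show ?thesis
    by (simp add: field_simps)
qed

lemma poisson_affine:
  assumes "y > 0"
  shows "y * poisson (Complex x y) (x + y * t) = 1 / (pi * (1 + t\<^sup>2))"
proof -
  have "y * poisson (Complex x y) (x + y * t) = y\<^sup>2 / (y\<^sup>2 * (pi * (1 + t\<^sup>2)))"
    by (simp add: poisson_Complex power2_eq_square algebra_simps)
  then show ?thesis using assms by simp
qed

lemma poisson_has_integral:
  assumes "Im z > 0"
  shows "has_bochner_integral lborel (poisson z) 1"
proof -
  define x y where "x = Re z" "y = Im z"
  have y: "y > 0" "z = Complex x y" using assms by (auto simp: x_y_def)
  have "has_bochner_integral lborel (\<lambda>t. poisson z (x + y * t)) (1 / \<bar>y\<bar>)"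
  proof -
    have "poisson (Complex x y) (x + y * t) = 1 / y * (1 / (pi * (1 + t\<^sup>2)))" for t
      using poisson_affine[OF y(1), of x t] y(1)
      by (metis mult.commute nonzero_mult_div_cancel_right less_numeral_extra(3) times_divide_eq_left mult_1)
    then show ?thesis
      using has_bochner_integral_mult_right[OF has_bochner_integral_cauchy, of "1/y"] y by simp
  qed
  then show ?thesis
    using lborel_has_bochner_integral_real_affine_iff[of y "poisson z" 1 x] y by (simp add: inverse_eq_divide)
qed

lemma poisson_integrable: "Im z > 0 \<Longrightarrow> integrable lborel (poisson z)"
  and poisson_integral: "Im z > 0 \<Longrightarrow> (LINT t|lborel. poisson z t) = 1"
  using poisson_has_integral has_bochner_integral_iff by blast+

lemma poisson_nn_integral: "Im z > 0 \<Longrightarrow> (\<integral>\<^sup>+t. ennreal (poisson z t) \<partial>lborel) = 1"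
  by (subst nn_integral_eq_integral[OF poisson_integrable]) (auto simp: poisson_integral poisson_nonneg)

lemma poisson_nn_integral': "y > 0 \<Longrightarrow> (\<integral>\<^sup>+x. ennreal (poisson (Complex x y) t) \<partial>lborel) = 1"
  by (subst poisson_commute) (simp add: poisson_nn_integral)

lemma poisson_integrable_mult:
  fixes g :: "real \<Rightarrow> 'a::{banach, second_countable_topology}"
  assumes "Im z > 0" and [measurable]: "g \<in> borel_measurable borel" and "AE t in lborel. norm (g t) \<le> M"
  shows "integrable lborel (\<lambda>t. poisson z t *\<^sub>R g t)"
proof (rule Bochner_Integration.integrable_bound[where f = "\<lambda>t. M * poisson z t"])
  show "AE t in lborel. norm (poisson z t *\<^sub>R g t) \<le> norm (M * poisson z t)"
    using assms(3)
  proof eventually_elim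
    case (elim t)
    have "0 \<le> M" using elim norm_ge_zero order_trans by blast
    then show ?case using elim assms(1) by (simp add: poisson_nonneg abs_mult mult.commute[of M] mult_left_mono)
  qed
qed (use assms poisson_integrable in auto)

text \<open>The substitution \<open>s = w + e n * t\<close> turns the kernel into the fixed Cauchy
  density, so dominated convergence applies. Continuity is asked only at \<open>w\<close>, which
  admits functions with jumps elsewhere, such as indicators of intervals.\<close>

lemma poisson_approx_identity:
  fixes F :: "real \<Rightarrow> real"
  assumes [measurable]: "F \<in> borel_measurable borel" and bd: "\<And>t. \<bar>F t\<bar> \<le> M" and cont: "isCont F w"
    and e: "e \<longlonglongrightarrow> 0" "\<And>n. e n > 0"
  shows "(\<lambda>n. LINT s|lborel. poisson (Complex w (e n)) s * F s) \<longlonglongrightarrow> F w"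
proof -
  have eq: "(LINT s|lborel. poisson (Complex w (e n)) s * F s) =
      (LINT t|lborel. (1 / (pi * (1 + t\<^sup>2))) * F (w + e n * t))" for n
  proof -
    have "(LINT s|lborel. poisson (Complex w (e n)) s * F s) =
        e n * (LINT t|lborel. poisson (Complex w (e n)) (w + e n * t) * F (w + e n * t))"
      using lborel_integral_real_affine[of "e n" "\<lambda>s. poisson (Complex w (e n)) s * F s" w] e(2)[of n] by simp
    also have "\<dots> = (LINT t|lborel. (e n * poisson (Complex w (e n)) (w + e n * t)) * F (w + e n * t))"
      by (simp add: mult.assoc flip: Bochner_Integration.integral_mult_right_zero)
    finally show ?thesis by (simp only: poisson_affine[OF e(2)])
  qed
  have "(\<lambda>n. LINT t|lborel. (1 / (pi * (1 + t\<^sup>2))) * F (w + e n * t))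
      \<longlonglongrightarrow> (LINT t|lborel. (1 / (pi * (1 + t\<^sup>2))) * F w)"
  proof (rule integral_dominated_convergence[where w = "\<lambda>t. M * (1 / (pi * (1 + t\<^sup>2)))"])
    show "integrable lborel (\<lambda>t::real. M * (1 / (pi * (1 + t\<^sup>2))))"
      using has_bochner_integral_mult_right[OF has_bochner_integral_cauchy, of M]
      unfolding has_bochner_integral_iff by blast
    have "(\<lambda>n. F (w + e n * t)) \<longlonglongrightarrow> F w" for t
      by (rule isCont_tendsto_compose[OF cont]) (use e in \<open>auto intro!: tendsto_eq_intros\<close>)
    then show "AE t in lborel. (\<lambda>n. 1 / (pi * (1 + t\<^sup>2)) * F (w + e n * t)) \<longlonglongrightarrow> 1 / (pi * (1 + t\<^sup>2)) * F w"
      by (intro AE_I2 tendsto_mult tendsto_const)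
    show "AE t in lborel. norm (1 / (pi * (1 + t\<^sup>2)) * F (w + e n * t)) \<le> M * (1 / (pi * (1 + t\<^sup>2)))" for n
      using bd by (auto intro!: AE_I2 divide_right_mono simp: abs_mult)
  qed measurable
  also have "(LINT t|lborel. (1 / (pi * (1 + t\<^sup>2))) * F w) = F w"
    using has_bochner_integral_cauchy by (subst Bochner_Integration.integral_mult_left_zero) (auto simp: has_bochner_integral_iff)
  finally show ?thesis unfolding eq .
qed

lemma open_upper_half_plane: "open upper_half_plane"
  unfolding upper_half_plane_def by (rule open_halfspace_Im_gt)

lemma mem_upper_half_plane [simp]: "z \<in> upper_half_plane \<longleftrightarrow> Im z > 0"
  by (simp add: upper_half_plane_def)

text \<open>The integral of \<open>(f(t) - f(z\<^sub>0))\<close> against the Poisson kernel is the integral of a holomorphic function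
  over the real line; a primitive of that function changes by \<open>O(1/R)\<close> along the rectangle over \<open>[-R, R]\<close>.\<close>

lemma poisson_formula_closed_half_plane:
  assumes e: "\<epsilon> > 0" and hol: "f holomorphic_on {z. - \<epsilon> < Im z}"
    and bd: "\<And>z. Im z \<ge> 0 \<Longrightarrow> cmod (f z) \<le> M" and z0: "Im z0 > 0"
  shows "(LINT t|lborel. poisson z0 t *\<^sub>R f (complex_of_real t)) = f z0"
proof -
  \<comment> \<open>The minimum with \<open>Im z0\<close> keeps \<open>cnj z0\<close> out of
    \<open>S\<close>, so that division by \<open>z - cnj z0\<close> stays holomorphic there.\<close>
  define \<delta> where "\<delta> = min \<epsilon> (Im z0)"
  define S where "S = {z. - \<delta> < Im z}"
  have \<delta>: "\<delta> > 0" using e z0 by (simp add: \<delta>_def)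
  have S: "open S" "convex S"
    by (auto simp: S_def open_halfspace_Im_gt convex_halfspace_Im_gt)
  have holS: "f holomorphic_on S"
    by (rule holomorphic_on_subset[OF hol]) (auto simp: S_def \<delta>_def)
  have z0S: "z0 \<in> S" "\<And>z. z \<in> S \<Longrightarrow> z \<noteq> cnj z0"
    using z0 \<delta> by (auto simp: S_def \<delta>_def)
  define q where "q z = (if z = z0 then deriv f z0 else (f z - f z0) / (z - z0))" for z
  have holq: "q holomorphic_on S"
    unfolding q_def using pole_lemma_open[OF holS S(1), of z0] by simp
  \<comment> \<open>On the real line \<open>|t - z0|^2\<close> factors as
    \<open>(t - z0) * (t - cnj z0)\<close>. The first factor is absorbed by the removable
    singularity of \<open>q\<close>, hence \<open>g\<close> extends the Poisson-weighted difference
    holomorphically.\<close>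
  define g where "g z = complex_of_real (Im z0 / pi) * q z / (z - cnj z0)" for z
  have holg: "g holomorphic_on S"
    unfolding g_def using z0S by (intro holomorphic_intros holq) auto
  obtain G where G: "\<And>x. x \<in> S \<Longrightarrow> (G has_field_derivative g x) (at x within S)"
    using holomorphic_convex_primitive'[OF S(2) S(1) holg] by blast
  have G': "(G has_field_derivative g x) (at x)" if "x \<in> S" for x
    using G[OF that] S(1) that at_within_open by metis
  have realS: "complex_of_real t \<in> S" for t using \<delta> by (simp add: S_def)
  have g_real: "g (complex_of_real t) = poisson z0 t *\<^sub>R (f (complex_of_real t) - f z0)" for t
  proof -
    have ne: "complex_of_real t \<noteq> z0" "complex_of_real t \<noteq> cnj z0" using z0 by (auto simp: complex_eq_iff)
    have "complex_of_real ((cmod (complex_of_real t - z0))\<^sup>2) = (complex_of_real t - z0) * (complex_of_real t - cnj z0)"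
      by (subst complex_norm_square) simp
    then show ?thesis
      using ne by (simp add: g_def q_def poisson_def scaleR_conv_of_real)
  qed
  have cont_f: "continuous_on UNIV (\<lambda>t. f (complex_of_real t))"
    by (rule continuous_on_compose2[OF holomorphic_on_imp_continuous_on[OF holS]])
       (use realS in \<open>auto intro!: continuous_intros\<close>)
  then have [measurable]: "(\<lambda>t. f (complex_of_real t)) \<in> borel_measurable borel"
    by (rule borel_measurable_continuous_onI)
  have int_f: "integrable lborel (\<lambda>t. poisson z0 t *\<^sub>R f (complex_of_real t))"
    by (rule poisson_integrable_mult[OF z0, where M = M]) (use bd in auto)
  have int_c: "integrable lborel (\<lambda>t. poisson z0 t *\<^sub>R f z0)"
    by (rule poisson_integrable_mult[OF z0, where M = "cmod (f z0)"]) auto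
  have int_g: "integrable lborel (\<lambda>t. g (complex_of_real t))"
    unfolding g_real scaleR_diff_right using int_f int_c by (rule Bochner_Integration.integrable_diff)
  have "cmod (f z0) \<le> M" using bd z0 by simp
  then have M: "M \<ge> 0" using norm_ge_zero order_trans by blast
  \<comment> \<open>\<open>2 * M\<close> bounds \<open>f z - f z0\<close>; the 4 comes from the two
    distances \<open>|z - z0|\<close> and \<open>|z - cnj z0|\<close>, each at least
    \<open>R / 2\<close>.\<close>
  define K where "K = (Im z0 / pi) * (2 * M) * 4"
  have K: "K \<ge> 0" using z0 M by (simp add: K_def)
  have g_bd: "cmod (g z) \<le> K / R\<^sup>2" if z: "Im z \<ge> 0" "cmod z \<ge> R" and R: "R > 2 * cmod z0" for z R
  proof -
    have Rp: "R > 0" using R norm_ge_zero[of z0] by linarith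
    have d1: "cmod (z - z0) \<ge> R / 2"
      using norm_triangle_ineq2[of z z0] z R by linarith
    have d2: "cmod (z - cnj z0) \<ge> R / 2"
      using norm_triangle_ineq2[of z "cnj z0"] z R complex_mod_cnj[of z0] by linarith
    have ne: "z \<noteq> z0" using d1 Rp by auto
    have "cmod (f z - f z0) \<le> 2 * M"
      using norm_triangle_ineq4[of "f z" "f z0"] bd[OF z(1)] \<open>cmod (f z0) \<le> M\<close> by linarith
    then have "cmod (f z - f z0) / (cmod (z - z0) * cmod (z - cnj z0)) \<le> 2 * M / (R / 2 * (R / 2))"
      using d1 d2 Rp M by (intro frac_le mult_mono) auto
    then have "(Im z0 / pi) * (cmod (f z - f z0) / (cmod (z - z0) * cmod (z - cnj z0)))
        \<le> (Im z0 / pi) * (2 * M / (R / 2 * (R / 2)))"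
      using z0 by (intro mult_left_mono) auto
    also have "\<dots> = K / R\<^sup>2" by (simp add: K_def power2_eq_square)
    also have "(Im z0 / pi) * (cmod (f z - f z0) / (cmod (z - z0) * cmod (z - cnj z0))) = cmod (g z)"
      using ne z0 by (simp add: g_def q_def norm_mult norm_divide)
    finally show ?thesis .
  qed
  have G_diff: "cmod (G b - G a) \<le> K / R\<^sup>2 * cmod (b - a)"
    if "convex C" "\<And>z. z \<in> C \<Longrightarrow> Im z \<ge> 0 \<and> cmod z \<ge> R" "a \<in> C" "b \<in> C" "R > 2 * cmod z0" for C a b R
  proof (rule field_differentiable_bound[OF that(1)])
    fix z assume z: "z \<in> C"
    have "z \<in> S" using that(2)[OF z] \<delta> by (simp add: S_def)
    then show "(G has_field_derivative g z) (at z within C)"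
      using G' has_field_derivative_at_within by blast
    show "cmod (g z) \<le> K / R\<^sup>2" using g_bd that(2)[OF z] that(5) by blast
  qed (use that in auto)
  \<comment> \<open>Each of the three remaining sides of the rectangle lies in a convex set outside
    the open disk of radius \<open>R\<close>. Their total length is \<open>4 * R\<close> and
    \<open>g\<close> is at most \<open>K / R^2\<close> there.\<close>
  have G_real: "cmod (G (complex_of_real R) - G (complex_of_real (- R))) \<le> 4 * K / R" if R: "R > 2 * cmod z0" for R
  proof -
    have Rp: "R > 0" using R norm_ge_zero[of z0] by linarith
    have 1: "cmod (G (Complex R R) - G (complex_of_real R)) \<le> K / R\<^sup>2 * cmod (Complex R R - complex_of_real R)"
    proof (rule G_diff[where C = "{z. Re z \<ge> R} \<inter> {z. Im z \<ge> 0}"])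
      show "convex ({z. Re z \<ge> R} \<inter> {z. Im z \<ge> 0})"
        by (intro convex_Int convex_halfspace_Re_ge convex_halfspace_Im_ge)
      show "z \<in> {z. Re z \<ge> R} \<inter> {z. Im z \<ge> 0} \<Longrightarrow> Im z \<ge> 0 \<and> cmod z \<ge> R" for z
        using complex_Re_le_cmod[of z] by auto
    qed (use R Rp in auto)
    have 2: "cmod (G (Complex (-R) R) - G (Complex R R)) \<le> K / R\<^sup>2 * cmod (Complex (-R) R - Complex R R)"
    proof (rule G_diff[where C = "{z. Im z \<ge> R}"])
      show "convex {z. Im z \<ge> R}" by (rule convex_halfspace_Im_ge)
      show "z \<in> {z. Im z \<ge> R} \<Longrightarrow> Im z \<ge> 0 \<and> cmod z \<ge> R" for z
        using abs_Im_le_cmod[of z] Rp by auto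
    qed (use R Rp in auto)
    have 3: "cmod (G (complex_of_real (-R)) - G (Complex (-R) R)) \<le> K / R\<^sup>2 * cmod (complex_of_real (-R) - Complex (-R) R)"
    proof (rule G_diff[where C = "{z. Re z \<le> - R} \<inter> {z. Im z \<ge> 0}"])
      show "convex ({z. Re z \<le> - R} \<inter> {z. Im z \<ge> 0})"
        by (intro convex_Int convex_halfspace_Re_le convex_halfspace_Im_ge)
      show "z \<in> {z. Re z \<le> - R} \<inter> {z. Im z \<ge> 0} \<Longrightarrow> Im z \<ge> 0 \<and> cmod z \<ge> R" for z
        using abs_Re_le_cmod[of z] by auto
    qed (use R Rp in auto)
    have n: "cmod (Complex R R - complex_of_real R) = R" "cmod (Complex (-R) R - Complex R R) = 2 * R"
        "cmod (complex_of_real (-R) - Complex (-R) R) = R"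
      using Rp by (simp_all add: cmod_def real_sqrt_mult)
    have "cmod (G (complex_of_real R) - G (complex_of_real (- R)))
        \<le> cmod (G (Complex R R) - G (complex_of_real R)) + cmod (G (Complex (-R) R) - G (Complex R R))
          + cmod (G (complex_of_real (-R)) - G (Complex (-R) R))"
      using norm_triangle_ineq[of "G (Complex R R) - G (complex_of_real R)" "G (Complex (-R) R) - G (Complex R R)"]
        norm_triangle_ineq[of "G (Complex R R) - G (complex_of_real R) + (G (Complex (-R) R) - G (Complex R R))"
          "G (complex_of_real (-R)) - G (Complex (-R) R)"]
      by (simp add: norm_minus_commute)
    also have "\<dots> \<le> K / R\<^sup>2 * R + K / R\<^sup>2 * (2 * R) + K / R\<^sup>2 * R"
      using 1 2 3 unfolding n by linarith
    also have "\<dots> = 4 * K / R" using Rp by (simp add: power2_eq_square field_simps)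
    finally show ?thesis .
  qed
  have FTC: "(LINT t|lborel. indicator {- real n..real n} t *\<^sub>R g (complex_of_real t))
      = G (complex_of_real (real n)) - G (complex_of_real (- real n))" for n
  proof (rule integral_FTC_atLeastAtMost)
    show "((\<lambda>t. G (complex_of_real t)) has_vector_derivative g (complex_of_real t)) (at t within {- real n..real n})" for t
      by (rule has_vector_derivative_at_within, rule has_vector_derivative_real_field) (rule G'[OF realS])
    show "continuous_on {- real n..real n} (\<lambda>t. g (complex_of_real t))"
      by (rule continuous_on_compose2[OF holomorphic_on_imp_continuous_on[OF holg]])
         (use realS in \<open>auto intro!: continuous_intros\<close>)
  qed auto
  have "(\<lambda>n. LINT t|lborel. indicator {- real n..real n} t *\<^sub>R g (complex_of_real t))
      \<longlonglongrightarrow> (LINT t|lborel. g (complex_of_real t))"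
  proof (rule integral_dominated_convergence[where w = "\<lambda>t. cmod (g (complex_of_real t))"])
    show "AE t in lborel. (\<lambda>n. indicator {- real n..real n} t *\<^sub>R g (complex_of_real t)) \<longlonglongrightarrow> g (complex_of_real t)"
    proof (intro AE_I2 tendsto_eventually)
      fix t :: real
      obtain N :: nat where N: "\<bar>t\<bar> \<le> real N" using real_arch_simple by blast
      show "\<forall>\<^sub>F n in sequentially. indicator {- real n..real n} t *\<^sub>R g (complex_of_real t) = g (complex_of_real t)"
        using eventually_ge_at_top[of N]
      proof eventually_elim
        case (elim n)
        then have "real N \<le> real n" by simp
        then have "- real n \<le> t" "t \<le> real n" using N by linarith+
        then show ?case by simp
      qed
    qed
  qed (use int_g in \<open>auto split: split_indicator\<close>)
  moreover have "(\<lambda>n. LINT t|lborel. indicator {- real n..real n} t *\<^sub>R g (complex_of_real t)) \<longlonglongrightarrow> 0"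
    unfolding FTC
  proof (rule Lim_null_comparison)
    show "(\<lambda>n. 4 * K / real n) \<longlonglongrightarrow> 0" by (rule lim_const_over_n)
    obtain N :: nat where N: "2 * cmod z0 < real N" using reals_Archimedean2 by blast
    show "\<forall>\<^sub>F n in sequentially. cmod (G (complex_of_real (real n)) - G (complex_of_real (- real n))) \<le> 4 * K / real n"
      using eventually_ge_at_top[of N]
    proof eventually_elim
      case (elim n)
      then have "real N \<le> real n" by simp
      then have "2 * cmod z0 < real n" using N by linarith
      from G_real[OF this] show ?case by simp
    qed
  qed
  ultimately have "(LINT t|lborel. g (complex_of_real t)) = 0"
    using LIMSEQ_unique by blast
  then have "(LINT t|lborel. poisson z0 t *\<^sub>R f (complex_of_real t)) - (LINT t|lborel. poisson z0 t *\<^sub>R f z0) = 0"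
    unfolding g_real scaleR_diff_right using int_f int_c by (simp add: Bochner_Integration.integral_diff)
  moreover have "(LINT t|lborel. poisson z0 t *\<^sub>R f z0) = f z0"
    using poisson_integrable[OF z0] poisson_integral[OF z0] by simp
  ultimately show ?thesis by simp
qed

section \<open>Poisson formula for bounded functions with boundary values\<close>

text \<open>One fixed sequence decreasing to 0 serves as heights, as values of \<open>\<eta>\<close>
  and as tolerances: monotone and dominated convergence need sequences, and countably many
  exceptional null sets can be collected.\<close>

definition shift_seq :: "nat \<Rightarrow> real" where
  "shift_seq n = 1 / real (Suc n)"

lemma shift_seq_pos [simp]: "shift_seq n > 0"
  by (simp add: shift_seq_def)

lemma shift_seq_nonneg [simp]: "shift_seq n \<ge> 0"
  by (simp add: shift_seq_def)

lemma shift_seq_le_1: "shift_seq n \<le> 1"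
  by (simp add: shift_seq_def)

lemma shift_seq_tendsto: "shift_seq \<longlonglongrightarrow> 0"
  unfolding shift_seq_def using LIMSEQ_inverse_real_of_nat by (simp add: inverse_eq_divide)

lemma decseq_shift_seq: "decseq shift_seq"
  by (auto simp: decseq_def shift_seq_def intro!: divide_left_mono)

lemma shift_seq_less: "\<epsilon> > 0 \<Longrightarrow> \<exists>n. shift_seq n < \<epsilon>"
  using reals_Archimedean[of \<epsilon>] by (simp add: shift_seq_def inverse_eq_divide)

lemma shift_seq_at_right: "filterlim shift_seq (at_right 0) sequentially"
  using shift_seq_tendsto by (auto simp: filterlim_at shift_seq_def)

lemma has_boundary_value_imp_LIMSEQ:
  "has_boundary_value f x w \<Longrightarrow> (\<lambda>n. f (Complex x (shift_seq n))) \<longlonglongrightarrow> w"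
  unfolding has_boundary_value_def by (rule filterlim_compose[OF _ shift_seq_at_right])

text \<open>There are two kinds of instances: upward translates, whose boundary function is the
  restriction to a horizontal line, and resolvents of \<open>\<Phi>\<close> with pole strictly below
  the real line. \<open>fb\<close> is a Borel function on all of the line and describes the limits
  only almost everywhere.\<close>

locale bounded_boundary =
  fixes f :: "complex \<Rightarrow> complex" and fb :: "real \<Rightarrow> complex" and M :: real
  assumes hol: "f holomorphic_on upper_half_plane"
    and bdd: "\<And>z. Im z > 0 \<Longrightarrow> cmod (f z) \<le> M"
    and fb_measurable [measurable]: "fb \<in> borel_measurable borel"
    and boundary: "AE x in lborel. has_boundary_value f x (fb x)"
begin

lemma fb_bdd: "AE x in lborel. cmod (fb x) \<le> M"
  using boundary
proof eventually_elim
  case (elim x)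
  have "(\<lambda>n. cmod (f (Complex x (shift_seq n)))) \<longlonglongrightarrow> cmod (fb x)"
    by (intro tendsto_norm has_boundary_value_imp_LIMSEQ elim)
  then show ?case
    by (rule LIMSEQ_le_const2) (auto intro!: bdd)
qed

lemma isCont_f: "Im z > 0 \<Longrightarrow> isCont f z"
  using holomorphic_on_imp_continuous_on[OF hol] open_upper_half_plane
  by (simp add: continuous_on_eq_continuous_at)

text \<open>The translates \<open>f(z + i * shift_seq n)\<close> are holomorphic across the real
  line, so the previous formula applies to them; the bound \<open>M\<close> allows the passage to
  the limit under the integral.\<close>

lemma poisson_formula:
  assumes z: "Im z > 0"
  shows "(LINT t|lborel. poisson z t *\<^sub>R fb t) = f z"
proof -
  define F where "F n = (\<lambda>w. f (w + \<i> * shift_seq n))" for n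
  have F: "(LINT t|lborel. poisson z t *\<^sub>R F n (complex_of_real t)) = F n z" for n
  proof (rule poisson_formula_closed_half_plane[where \<epsilon> = "shift_seq n" and M = M])
    show "F n holomorphic_on {z. - shift_seq n < Im z}"
      unfolding F_def by (intro holomorphic_on_compose_gen[unfolded o_def, OF _ hol] holomorphic_intros) auto
    show "Im z \<ge> 0 \<Longrightarrow> cmod (F n z) \<le> M" for z
      unfolding F_def by (rule bdd) (auto intro: add_nonneg_pos)
  qed (use z in auto)
  have cont: "continuous_on UNIV (\<lambda>t. F n (complex_of_real t))" for n
    unfolding F_def by (rule continuous_on_compose2[OF holomorphic_on_imp_continuous_on[OF hol]])
      (auto intro!: continuous_intros)
  have [measurable]: "(\<lambda>t. F n (complex_of_real t)) \<in> borel_measurable borel" for n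
    by (rule borel_measurable_continuous_onI[OF cont])
  have "(\<lambda>n. LINT t|lborel. poisson z t *\<^sub>R F n (complex_of_real t)) \<longlonglongrightarrow> (LINT t|lborel. poisson z t *\<^sub>R fb t)"
  proof (rule integral_dominated_convergence[where w = "\<lambda>t. M * poisson z t"])
    show "integrable lborel (\<lambda>t. M * poisson z t)" using poisson_integrable[OF z] by simp
    show "AE t in lborel. (\<lambda>n. poisson z t *\<^sub>R F n (complex_of_real t)) \<longlonglongrightarrow> poisson z t *\<^sub>R fb t"
      using boundary
    proof eventually_elim
      case (elim t)
      have "F n (complex_of_real t) = f (Complex t (shift_seq n))" for n
        by (simp add: F_def Complex_eq)
      then show ?case using has_boundary_value_imp_LIMSEQ[OF elim] by (intro tendsto_scaleR) auto
    qed
    show "AE t in lborel. norm (poisson z t *\<^sub>R F n (complex_of_real t)) \<le> M * poisson z t" for n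
    proof (rule AE_I2)
      fix t
      have "cmod (F n (complex_of_real t)) \<le> M" unfolding F_def by (rule bdd) simp
      then show "norm (poisson z t *\<^sub>R F n (complex_of_real t)) \<le> M * poisson z t"
        using z by (simp add: poisson_nonneg mult.commute[of M] mult_left_mono)
    qed
  qed measurable
  moreover have "(\<lambda>n. F n z) \<longlonglongrightarrow> f z"
    unfolding F_def
    by (rule isCont_tendsto_compose[OF isCont_f[OF z]])
       (auto intro!: tendsto_eq_intros shift_seq_tendsto)
  ultimately show ?thesis unfolding F using LIMSEQ_unique by blast
qed

lemma poisson_fb_integrable:
  "Im z > 0 \<Longrightarrow> integrable lborel (\<lambda>t. poisson z t *\<^sub>R fb t)"
  by (rule poisson_integrable_mult[OF _ _ fb_bdd]) auto

lemma poisson_formula_Im: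
  assumes z: "Im z > 0"
  shows "integrable lborel (\<lambda>t. poisson z t * Im (fb t))"
    "(LINT t|lborel. poisson z t * Im (fb t)) = Im (f z)"
proof -
  show "integrable lborel (\<lambda>t. poisson z t * Im (fb t))"
    using integrable_Im[OF poisson_fb_integrable[OF z]] by simp
  show "(LINT t|lborel. poisson z t * Im (fb t)) = Im (f z)"
    using integral_Im[OF poisson_fb_integrable[OF z]] poisson_formula[OF z] by simp
qed

text \<open>Jensen's inequality for the square, in variance form: the Poisson mean of
  \<open>|fb - f z|^2\<close> is non-negative and, because \<open>f z\<close> is the mean of
  \<open>fb\<close>, equals the mean of \<open>|fb|^2\<close> minus \<open>|f z|^2\<close>.\<close>

lemma poisson_jensen:
  assumes z: "Im z > 0"
  shows "ennreal ((cmod (f z))\<^sup>2) \<le> (\<integral>\<^sup>+t. ennreal (poisson z t * (cmod (fb t))\<^sup>2) \<partial>lborel)"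
proof -
  let ?c = "f z"
  have int2: "integrable lborel (\<lambda>t. poisson z t * (cmod (fb t))\<^sup>2)"
  proof -
    have "integrable lborel (\<lambda>t. poisson z t *\<^sub>R (cmod (fb t))\<^sup>2)"
      by (rule poisson_integrable_mult[OF z, where M = "M\<^sup>2"]) (use fb_bdd in \<open>auto elim!: eventually_mono intro: power_mono\<close>)
    then show ?thesis by simp
  qed
  have int1: "integrable lborel (\<lambda>t. cnj ?c * (poisson z t *\<^sub>R fb t))"
    by (intro integrable_mult_right poisson_fb_integrable[OF z])
  then have int1': "integrable lborel (\<lambda>t. Re (cnj ?c * (poisson z t *\<^sub>R fb t)))"
    by (rule integrable_Re)
  have eq: "poisson z t * (cmod (fb t - ?c))\<^sup>2 = poisson z t * (cmod (fb t))\<^sup>2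
      - 2 * Re (cnj ?c * (poisson z t *\<^sub>R fb t)) + (cmod ?c)\<^sup>2 * poisson z t" for t
    unfolding cmod_power2 by (simp add: power2_eq_square algebra_simps)
  have "0 \<le> (LINT t|lborel. poisson z t * (cmod (fb t - ?c))\<^sup>2)"
    using z by (intro integral_nonneg_AE AE_I2) (auto simp: poisson_nonneg)
  also have "\<dots> = (LINT t|lborel. poisson z t * (cmod (fb t))\<^sup>2)
      - 2 * (LINT t|lborel. Re (cnj ?c * (poisson z t *\<^sub>R fb t))) + (cmod ?c)\<^sup>2 * (LINT t|lborel. poisson z t)"
    unfolding eq using int2 int1' poisson_integrable[OF z] by simp
  also have "(LINT t|lborel. Re (cnj ?c * (poisson z t *\<^sub>R fb t))) = Re (cnj ?c * ?c)"
    by (subst integral_Re[OF int1], subst Bochner_Integration.integral_mult_right_zero)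
       (simp only: poisson_formula[OF z])
  also have "Re (cnj ?c * ?c) = (cmod ?c)\<^sup>2"
    unfolding cmod_power2 by (simp add: power2_eq_square)
  finally have "(cmod ?c)\<^sup>2 \<le> (LINT t|lborel. poisson z t * (cmod (fb t))\<^sup>2)"
    using poisson_integral[OF z] by simp
  then show ?thesis
    using int2 z by (subst nn_integral_eq_integral) (auto simp: poisson_nonneg ennreal_leI)
qed

lemma measurable_line [measurable]: "y > 0 \<Longrightarrow> (\<lambda>x. f (Complex x y)) \<in> borel_measurable borel"
  by (rule borel_measurable_continuous_onI, rule continuous_on_compose2[OF holomorphic_on_imp_continuous_on[OF hol]])
     (auto intro!: continuous_intros simp: Complex_eq)

text \<open>Integrate \<open>poisson_jensen\<close> over \<open>x\<close> and exchange the
  integrals; the kernel is symmetric in \<open>x\<close> and \<open>t\<close>, so it has mass 1 in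
  \<open>x\<close> as well.\<close>

lemma line_integral_le:
  assumes y: "y > 0"
  shows "(\<integral>\<^sup>+x. ennreal ((cmod (f (Complex x y)))\<^sup>2) \<partial>lborel) \<le> (\<integral>\<^sup>+t. ennreal ((cmod (fb t))\<^sup>2) \<partial>lborel)"
proof -
  have "(\<integral>\<^sup>+x. ennreal ((cmod (f (Complex x y)))\<^sup>2) \<partial>lborel)
      \<le> (\<integral>\<^sup>+x. (\<integral>\<^sup>+t. ennreal (poisson (Complex x y) t * (cmod (fb t))\<^sup>2) \<partial>lborel) \<partial>lborel)"
    using y by (intro nn_integral_mono poisson_jensen) auto
  also have "\<dots> = (\<integral>\<^sup>+t. (\<integral>\<^sup>+x. ennreal (poisson (Complex x y) t * (cmod (fb t))\<^sup>2) \<partial>lborel) \<partial>lborel)"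
    by (rule lborel_pair.Fubini') measurable
  also have "\<dots> = (\<integral>\<^sup>+t. (\<integral>\<^sup>+x. ennreal (poisson (Complex x y) t) \<partial>lborel) * ennreal ((cmod (fb t))\<^sup>2) \<partial>lborel)"
    using y by (subst nn_integral_multc[symmetric])
      (auto simp: ennreal_mult poisson_nonneg intro!: nn_integral_cong)
  also have "\<dots> = (\<integral>\<^sup>+t. ennreal ((cmod (fb t))\<^sup>2) \<partial>lborel)"
    using y by (simp add: poisson_nn_integral')
  finally show ?thesis .
qed

text \<open>\<open>pi * y * poisson (iy) t = y^2 / (t^2 + y^2)\<close> increases to 1 with
  \<open>y\<close>. Monotone convergence in the Poisson formula at \<open>iy\<close> therefore reads
  the whole mass off the behaviour of \<open>f\<close> at infinity.\<close>

lemma total_mass: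
  assumes pos: "\<And>z. Im z > 0 \<Longrightarrow> Im (f z) \<ge> 0"
    and lim: "((\<lambda>y. y * Im (f (Complex 0 y))) \<longlongrightarrow> 1) at_top"
  shows "(\<integral>\<^sup>+t. ennreal (Im (fb t)) \<partial>lborel) = ennreal pi" "AE t in lborel. Im (fb t) \<ge> 0"
proof -
  show fbpos: "AE t in lborel. Im (fb t) \<ge> 0"
    using boundary
  proof eventually_elim
    case (elim x)
    have "(\<lambda>n. Im (f (Complex x (shift_seq n)))) \<longlonglongrightarrow> Im (fb x)"
      by (intro tendsto_Im has_boundary_value_imp_LIMSEQ elim)
    then show ?case
      by (rule LIMSEQ_le_const) (auto intro!: pos)
  qed
  define h where "h n t = ennreal ((real n)\<^sup>2 / (t\<^sup>2 + (real n)\<^sup>2) * Im (fb t))" for n t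
  have [measurable]: "h n \<in> borel_measurable lborel" for n unfolding h_def by measurable
  have h_int: "integral\<^sup>N lborel (h n) = ennreal (pi * (real n * Im (f (Complex 0 (real n)))))" if n: "n > 0" for n
  proof -
    have h_eq: "h n t = ennreal (pi * real n * (poisson (Complex 0 (real n)) t * Im (fb t)))" for t
      unfolding h_def poisson_Complex by (simp add: power2_eq_square mult_ac)
    have "integral\<^sup>N lborel (h n) = ennreal (LINT t|lborel. pi * real n * (poisson (Complex 0 (real n)) t * Im (fb t)))"
      unfolding h_eq
    proof (rule nn_integral_eq_integral)
      show "integrable lborel (\<lambda>t. pi * real n * (poisson (Complex 0 (real n)) t * Im (fb t)))"
        using poisson_formula_Im(1)[of "Complex 0 (real n)"] n by simp
      show "AE t in lborel. 0 \<le> pi * real n * (poisson (Complex 0 (real n)) t * Im (fb t))"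
        using fbpos by eventually_elim (auto simp: poisson_nonneg)
    qed
    then show ?thesis using poisson_formula_Im[of "Complex 0 (real n)"] n by (simp add: mult.assoc)
  qed
  have "(\<lambda>n. integral\<^sup>N lborel (h n)) \<longlonglongrightarrow> (\<integral>\<^sup>+t. ennreal (Im (fb t)) \<partial>lborel)"
  proof (rule nn_integral_LIMSEQ)
    show "incseq h"
    proof (intro incseq_SucI le_funI)
      fix n t
      show "h n t \<le> h (Suc n) t"
      proof (cases "Im (fb t) \<ge> 0")
        case True
        have "(real n)\<^sup>2 / (t\<^sup>2 + (real n)\<^sup>2) \<le> (real (Suc n))\<^sup>2 / (t\<^sup>2 + (real (Suc n))\<^sup>2)"
        proof (cases "n = 0")
          case False
          have mono: "a / (c + a) \<le> b / (c + b)" if "0 < a" "a \<le> b" "0 \<le> c" for a b c :: real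
            using that by (simp add: divide_simps) (auto simp: algebra_simps add_nonneg_pos mult_right_mono add_nonneg_eq_0_iff)
          show ?thesis by (rule mono) (use False in \<open>auto intro: power_mono\<close>)
        qed auto
        then show ?thesis unfolding h_def using True by (intro ennreal_leI mult_right_mono) auto
      next
        case False
        then have "(real n)\<^sup>2 / (t\<^sup>2 + (real n)\<^sup>2) * Im (fb t) \<le> 0"
          by (intro mult_nonneg_nonpos) auto
        then show ?thesis unfolding h_def by (simp add: ennreal_neg)
      qed
    qed
    fix t
    have "((\<lambda>n. (real n)\<^sup>2 / (t\<^sup>2 + (real n)\<^sup>2)) \<longlongrightarrow> 1) sequentially"
      by real_asymp
    then have "(\<lambda>n. (real n)\<^sup>2 / (t\<^sup>2 + (real n)\<^sup>2) * Im (fb t)) \<longlonglongrightarrow> 1 * Im (fb t)"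
      by (intro tendsto_mult tendsto_const)
    then show "(\<lambda>n. h n t) \<longlonglongrightarrow> ennreal (Im (fb t))"
      unfolding h_def by (intro tendsto_ennrealI) simp
  qed measurable
  moreover have "(\<lambda>n. integral\<^sup>N lborel (h n)) \<longlonglongrightarrow> ennreal (pi * 1)"
  proof (rule Lim_transform_eventually)
    have "(\<lambda>n. real n * Im (f (Complex 0 (real n)))) \<longlonglongrightarrow> 1"
      using filterlim_compose[OF lim filterlim_real_sequentially] .
    then show "(\<lambda>n. ennreal (pi * (real n * Im (f (Complex 0 (real n)))))) \<longlonglongrightarrow> ennreal (pi * 1)"
      by (intro tendsto_ennrealI tendsto_mult tendsto_const)
    show "\<forall>\<^sub>F n in sequentially. ennreal (pi * (real n * Im (f (Complex 0 (real n))))) = integral\<^sup>N lborel (h n)"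
      using eventually_gt_at_top[of 0] by eventually_elim (simp add: h_int)
  qed
  ultimately show "(\<integral>\<^sup>+t. ennreal (Im (fb t)) \<partial>lborel) = ennreal pi"
    using LIMSEQ_unique by fastforce
qed

end

section \<open>Hardy space functions and their boundary values\<close>

definition line_norm_sq :: "(complex \<Rightarrow> complex) \<Rightarrow> real \<Rightarrow> ennreal" where
  "line_norm_sq u y = (\<integral>\<^sup>+x. ennreal ((cmod (u (Complex x y)))\<^sup>2) \<partial>lborel)"

text \<open>For \<open>s > 0\<close> the translate of a Hardy space function is bounded and
  continuous up to the real line, so its boundary values are known at every point before any limit
  theorem for the Hardy space is available.\<close>

definition shift_up :: "real \<Rightarrow> (complex \<Rightarrow> complex) \<Rightarrow> complex \<Rightarrow> complex" where
  "shift_up s u z = u (z + \<i> * complex_of_real s)"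

lemma shift_up_Complex [simp]: "shift_up s u (Complex x y) = u (Complex x (y + s))"
  by (simp add: shift_up_def Complex_eq algebra_simps)

lemma line_norm_sq_shift_up [simp]: "line_norm_sq (shift_up s u) y = line_norm_sq u (y + s)"
  by (simp add: line_norm_sq_def)

lemma hardy_norm_sq_eq: "hardy_norm_sq u = (SUP y\<in>{0<..}. line_norm_sq u y)"
  by (simp add: hardy_norm_sq_def line_norm_sq_def)

lemma line_norm_sq_le_hardy: "y > 0 \<Longrightarrow> line_norm_sq u y \<le> hardy_norm_sq u"
  unfolding hardy_norm_sq_eq by (rule SUP_upper) auto

lemma hardy_norm_sq_le: "(\<And>y. y > 0 \<Longrightarrow> line_norm_sq u y \<le> c) \<Longrightarrow> hardy_norm_sq u \<le> c"
  unfolding hardy_norm_sq_eq by (rule SUP_least) auto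

lemma continuous_on_line:
  assumes "u holomorphic_on upper_half_plane" "y > 0"
  shows "continuous_on UNIV (\<lambda>x. u (Complex x y))"
  by (rule continuous_on_compose2[OF holomorphic_on_imp_continuous_on[OF assms(1)]])
     (use assms in \<open>auto intro!: continuous_intros simp: Complex_eq\<close>)

lemma borel_measurable_line:
  assumes "u holomorphic_on upper_half_plane" "y > 0"
  shows "(\<lambda>x. u (Complex x y)) \<in> borel_measurable borel"
  by (rule borel_measurable_continuous_onI[OF continuous_on_line[OF assms]])

lemma has_boundary_value_shift_up:
  assumes "u holomorphic_on upper_half_plane" "s > 0"
  shows "has_boundary_value (shift_up s u) x (u (Complex x s))"
proof -
  have "isCont u (Complex x s)"
    using holomorphic_on_imp_continuous_on[OF assms(1)] open_upper_half_plane assms(2)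
    by (simp add: continuous_on_eq_continuous_at)
  then have "((\<lambda>y. u (Complex x (y + s))) \<longlongrightarrow> u (Complex x s)) (at_right 0)"
    by (rule isCont_tendsto_compose) (auto intro!: tendsto_eq_intros simp: Complex_eq)
  then show ?thesis by (simp add: has_boundary_value_def)
qed

lemma holomorphic_shift_up:
  assumes "u holomorphic_on upper_half_plane" "s \<ge> 0"
  shows "shift_up s u holomorphic_on upper_half_plane"
  unfolding shift_up_def
  by (intro holomorphic_on_compose_gen[unfolded o_def, OF _ assms(1)] holomorphic_intros) (use assms(2) in auto)

lemma hardy_space_holomorphic: "u \<in> hardy_space \<Longrightarrow> u holomorphic_on upper_half_plane"
  by (simp add: hardy_space_def)

lemma line_norm_sq_finite:
  assumes "u \<in> hardy_space" "y > 0"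
  shows "line_norm_sq u y < \<infinity>"
proof -
  have "hardy_norm_sq u < \<infinity>" using assms(1) by (simp add: hardy_space_def)
  with line_norm_sq_le_hardy[OF assms(2)] show ?thesis by (rule le_less_trans)
qed

text \<open>For a primitive \<open>F\<close> of \<open>u\<^sup>2\<close> and real \<open>s\<close> the function \<open>F(z + s) - F(z)\<close> is bounded by \<open>N\<close>, so Cauchy's
  estimate controls the variation of \<open>u\<^sup>2\<close> along horizontal lines.\<close>

lemma hardy_space_pointwise_bound:
  assumes u: "u \<in> hardy_space" and z: "Im z > 0"
  defines "N \<equiv> enn2real (hardy_norm_sq u)"
  shows "(cmod (u z))\<^sup>2 \<le> N + 2 * N / Im z"
proof -
  have hol: "u holomorphic_on upper_half_plane" and fin: "hardy_norm_sq u < \<infinity>"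
    using u by (auto simp: hardy_space_def)
  have N: "hardy_norm_sq u = ennreal N" "N \<ge> 0"
    using fin by (auto simp: N_def)
  have cvx: "convex upper_half_plane" unfolding upper_half_plane_def by (rule convex_halfspace_Im_gt)
  have hol2: "(\<lambda>z. (u z)\<^sup>2) holomorphic_on upper_half_plane" by (intro holomorphic_intros hol)
  obtain F where F0: "\<And>x. x \<in> upper_half_plane \<Longrightarrow> (F has_field_derivative (u x)\<^sup>2) (at x within upper_half_plane)"
    using holomorphic_convex_primitive'[OF cvx open_upper_half_plane hol2] by blast
  have F: "(F has_field_derivative (u x)\<^sup>2) (at x)" if "Im x > 0" for x
    using F0[of x] that at_within_open[OF _ open_upper_half_plane, of x] by simp
  have holF: "F holomorphic_on upper_half_plane"
    unfolding holomorphic_on_def field_differentiable_def using F0 by blast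
  have sq_le: "(\<integral>\<^sup>+t. ennreal ((cmod (u (w + complex_of_real t)))\<^sup>2) \<partial>lborel) \<le> ennreal N" if w: "Im w > 0" for w
  proof -
    have eq: "w + complex_of_real t = Complex (Re w + 1 * t) (Im w)" for t by (simp add: complex_eq_iff)
    have "(\<integral>\<^sup>+t. ennreal ((cmod (u (w + complex_of_real t)))\<^sup>2) \<partial>lborel) = line_norm_sq u (Im w)"
      unfolding line_norm_sq_def eq
      by (subst nn_integral_real_affine[where c = 1 and t = "Re w"]) (use borel_measurable_line[OF hol w] in auto)
    then show ?thesis using line_norm_sq_le_hardy[OF w, of u] N(1) by simp
  qed
  have F_diff: "cmod (F (w + complex_of_real s) - F w) \<le> N" if w: "Im w > 0" and s: "s \<ge> 0" for w s
  proof -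
    define v where "v t = indicator {0..s} t *\<^sub>R (u (w + complex_of_real t))\<^sup>2" for t :: real
    have v: "(LINT t|lborel. v t) = F (w + complex_of_real s) - F (w + complex_of_real 0)"
      unfolding v_def
    proof (rule integral_FTC_atLeastAtMost[OF s])
      fix t
      have "((\<lambda>t. F (w + complex_of_real t)) has_vector_derivative (1 * (u (w + complex_of_real t))\<^sup>2)) (at t)"
        by (rule field_vector_diff_chain_at[unfolded o_def, where f = "\<lambda>t. w + complex_of_real t"])
           (use w in \<open>auto intro!: F derivative_eq_intros\<close>)
      then show "((\<lambda>t. F (w + complex_of_real t)) has_vector_derivative (u (w + complex_of_real t))\<^sup>2) (at t within {0..s})"
        by (simp add: has_vector_derivative_at_within)
    next
      show "continuous_on {0..s} (\<lambda>t. (u (w + complex_of_real t))\<^sup>2)"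
        by (rule continuous_on_compose2[OF holomorphic_on_imp_continuous_on[OF hol2]])
           (use w in \<open>auto intro!: continuous_intros\<close>)
    qed
    have int: "integrable lborel v"
      unfolding v_def
    proof (rule borel_integrable_compact[unfolded set_integrable_def])
      show "continuous_on {0..s} (\<lambda>t. (u (w + complex_of_real t))\<^sup>2)"
        by (rule continuous_on_compose2[OF holomorphic_on_imp_continuous_on[OF hol2]])
           (use w in \<open>auto intro!: continuous_intros\<close>)
    qed simp
    have "ennreal (norm (LINT t|lborel. v t)) \<le> (\<integral>\<^sup>+t. norm (v t) \<partial>lborel)"
      by (rule integral_norm_bound_ennreal[OF int])
    also have "\<dots> \<le> (\<integral>\<^sup>+t. ennreal ((cmod (u (w + complex_of_real t)))\<^sup>2) \<partial>lborel)"
      by (intro nn_integral_mono ennreal_leI) (auto simp: v_def norm_power split: split_indicator)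
    also have "\<dots> \<le> ennreal N" by (rule sq_le[OF w])
    finally show ?thesis using N(2) unfolding v by (simp add: ennreal_le_iff)
  qed
  have cauchy: "cmod ((u (z + complex_of_real s))\<^sup>2 - (u z)\<^sup>2) \<le> 2 * N / Im z" if s: "s \<ge> 0" for s
  proof -
    define D where "D w = F (w + complex_of_real s) - F w" for w
    have holD: "D holomorphic_on upper_half_plane"
      unfolding D_def
      by (intro holomorphic_intros holF holomorphic_on_compose_gen[unfolded o_def, OF _ holF]) auto
    have sub: "Im w > 0" if "w \<in> cball z (Im z / 2)" for w
    proof -
      have "\<bar>Im (w - z)\<bar> \<le> Im z / 2" using abs_Im_le_cmod[of "w - z"] that by (simp add: dist_norm norm_minus_commute)
      then show ?thesis using z unfolding minus_complex.sel by linarith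
    qed
    \<comment> \<open>A disk of half the height stays inside the half-plane; its radius produces the
      factor 2 in \<open>2 * N / Im z\<close>.\<close>
    have "cmod ((deriv ^^ 1) D z) \<le> fact 1 * N / (Im z / 2) ^ 1"
    proof (rule Cauchy_inequality)
      show "D holomorphic_on ball z (Im z / 2)"
        by (rule holomorphic_on_subset[OF holD]) (use sub in auto)
      show "continuous_on (cball z (Im z / 2)) D"
        by (rule continuous_on_subset[OF holomorphic_on_imp_continuous_on[OF holD]]) (use sub in auto)
      show "cmod (D x) \<le> N" if "cmod (z - x) = Im z / 2" for x
        unfolding D_def by (rule F_diff) (use sub[of x] that s in \<open>auto simp: dist_norm\<close>)
    qed (use z in auto)
    moreover have "deriv D z = (u (z + complex_of_real s))\<^sup>2 - (u z)\<^sup>2"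
    proof (rule DERIV_imp_deriv)
      have "((\<lambda>w. F (w + complex_of_real s)) has_field_derivative (u (z + complex_of_real s))\<^sup>2) (at z)"
        by (subst DERIV_shift[symmetric]) (use z in \<open>auto intro!: F\<close>)
      then show "(D has_field_derivative (u (z + complex_of_real s))\<^sup>2 - (u z)\<^sup>2) (at z)"
        unfolding D_def using F[OF z] by (rule DERIV_diff)
    qed
    ultimately show ?thesis by (simp add: mult.commute)
  qed
  have pt: "(cmod (u z))\<^sup>2 - 2 * N / Im z \<le> (cmod (u (z + complex_of_real s)))\<^sup>2" if "s \<ge> 0" for s
    using cauchy[OF that] norm_triangle_ineq2[of "(u z)\<^sup>2" "(u (z + complex_of_real s))\<^sup>2"]
    by (simp add: norm_power norm_minus_commute)
  \<comment> \<open>Averaging \<open>pt\<close> over a segment of length 1 compares the constant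
    with a line integral, which is at most \<open>N\<close>. If the difference is negative,
    \<open>ennreal\<close> makes it 0 and the claim is trivial.\<close>
  have "ennreal ((cmod (u z))\<^sup>2 - 2 * N / Im z) = (\<integral>\<^sup>+s. ennreal ((cmod (u z))\<^sup>2 - 2 * N / Im z) * indicator {0..1::real} s \<partial>lborel)"
    by (subst nn_integral_cmult_indicator) auto
  also have "\<dots> \<le> (\<integral>\<^sup>+s. ennreal ((cmod (u (z + complex_of_real s)))\<^sup>2) \<partial>lborel)"
    by (intro nn_integral_mono) (auto intro!: ennreal_leI pt split: split_indicator)
  also have "\<dots> \<le> ennreal N" by (rule sq_le[OF z])
  finally show ?thesis using N(2) by (simp add: ennreal_le_iff)
qed

text \<open>On \<open>Im z \<ge> s\<close> the pointwise bound is at most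
  \<open>N + 2 * N / s\<close>, hence uniform.\<close>

lemma bounded_boundary_shift_up:
  assumes u: "u \<in> hardy_space" and s: "s > 0"
  obtains M where "bounded_boundary (shift_up s u) (\<lambda>x. u (Complex x s)) M"
proof
  let ?N = "enn2real (hardy_norm_sq u)"
  note hol = hardy_space_holomorphic[OF u]
  show "bounded_boundary (shift_up s u) (\<lambda>x. u (Complex x s)) (sqrt (?N + 2 * ?N / s))"
  proof
    show "shift_up s u holomorphic_on upper_half_plane" using holomorphic_shift_up[OF hol] s by simp
    show "(\<lambda>x. u (Complex x s)) \<in> borel_measurable borel" by (rule borel_measurable_line[OF hol s])
    show "AE x in lborel. has_boundary_value (shift_up s u) x (u (Complex x s))"
      by (intro AE_I2 has_boundary_value_shift_up hol s)
    fix z assume z: "Im z > 0"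
    have "(cmod (shift_up s u z))\<^sup>2 \<le> ?N + 2 * ?N / Im (z + \<i> * complex_of_real s)"
      unfolding shift_up_def by (rule hardy_space_pointwise_bound[OF u]) (use z s in auto)
    also have "\<dots> \<le> ?N + 2 * ?N / s"
      using z s by (intro add_left_mono divide_left_mono) auto
    finally show "cmod (shift_up s u z) \<le> sqrt (?N + 2 * ?N / s)"
      by (rule real_le_rsqrt)
  qed
qed

text \<open>The line at height \<open>s\<close> serves as the boundary for the half-plane above it:
  this is \<open>line_integral_le\<close> for \<open>shift_up s u\<close> at height
  \<open>y - s\<close>. It turns the supremum in the norm into a limit at the real line.\<close>

lemma line_norm_sq_antimono:
  assumes u: "u \<in> hardy_space" and s: "0 < s" "s \<le> y"
  shows "line_norm_sq u y \<le> line_norm_sq u s"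
proof (cases "s = y")
  case False
  obtain M where "bounded_boundary (shift_up s u) (\<lambda>x. u (Complex x s)) M"
    using bounded_boundary_shift_up[OF u s(1)] .
  then interpret bounded_boundary "shift_up s u" "\<lambda>x. u (Complex x s)" M .
  show ?thesis
    using line_integral_le[of "y - s"] False s by (simp add: line_norm_sq_def)
qed auto

lemma hardy_norm_sq_SUP_seq:
  assumes u: "u \<in> hardy_space"
  shows "hardy_norm_sq u = (SUP n. line_norm_sq u (shift_seq n))"
proof (rule antisym)
  show "hardy_norm_sq u \<le> (SUP n. line_norm_sq u (shift_seq n))"
  proof (rule hardy_norm_sq_le)
    fix y :: real assume "y > 0"
    then obtain n where "shift_seq n < y"
      using shift_seq_less by blast
    then have "line_norm_sq u y \<le> line_norm_sq u (shift_seq n)"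
      by (intro line_norm_sq_antimono u) auto
    then show "line_norm_sq u y \<le> (SUP n. line_norm_sq u (shift_seq n))"
      by (rule SUP_upper2[rotated]) auto
  qed
  show "(SUP n. line_norm_sq u (shift_seq n)) \<le> hardy_norm_sq u"
    by (rule SUP_least) (auto intro: line_norm_sq_le_hardy)
qed

lemma hardy_norm_sq_LIMSEQ:
  assumes u: "u \<in> hardy_space"
  shows "(\<lambda>n. line_norm_sq u (shift_seq n)) \<longlonglongrightarrow> hardy_norm_sq u"
  unfolding hardy_norm_sq_SUP_seq[OF u]
proof (rule LIMSEQ_SUP)
  show "incseq (\<lambda>n. line_norm_sq u (shift_seq n))"
  proof (rule incseq_SucI)
    fix n
    show "line_norm_sq u (shift_seq n) \<le> line_norm_sq u (shift_seq (Suc n))"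
      using decseq_SucD[OF decseq_shift_seq, of n] by (rule line_norm_sq_antimono[OF u shift_seq_pos])
  qed
qed

lemma line_norm_sq_parallelogram:
  assumes "u holomorphic_on upper_half_plane" "v holomorphic_on upper_half_plane" and y: "y > 0"
  shows "line_norm_sq (\<lambda>z. u z - v z) y + line_norm_sq (\<lambda>z. u z + v z) y
    = 2 * line_norm_sq u y + 2 * line_norm_sq v y"
proof -
  have [measurable]: "(\<lambda>x. u (Complex x y)) \<in> borel_measurable borel" "(\<lambda>x. v (Complex x y)) \<in> borel_measurable borel"
    using borel_measurable_line[OF assms(1) y] borel_measurable_line[OF assms(2) y] by simp_all
  have *: "ennreal ((cmod (a - b))\<^sup>2) + ennreal ((cmod (a + b))\<^sup>2)
      = ennreal (2 * (cmod a)\<^sup>2) + ennreal (2 * (cmod b)\<^sup>2)" for a b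
  proof -
    have "(cmod (a - b))\<^sup>2 + (cmod (a + b))\<^sup>2 = 2 * (cmod a)\<^sup>2 + 2 * (cmod b)\<^sup>2"
      unfolding cmod_power2 by (simp add: power2_eq_square algebra_simps)
    then have "ennreal ((cmod (a - b))\<^sup>2 + (cmod (a + b))\<^sup>2) = ennreal (2 * (cmod a)\<^sup>2 + 2 * (cmod b)\<^sup>2)"
      by (rule arg_cong)
    then show ?thesis by (subst (asm) (1 2) ennreal_plus) (rule zero_le_power2 mult_nonneg_nonneg zero_le_numeral | assumption)+
  qed
  have "line_norm_sq (\<lambda>z. u z - v z) y + line_norm_sq (\<lambda>z. u z + v z) y
      = (\<integral>\<^sup>+x. ennreal ((cmod (u (Complex x y) - v (Complex x y)))\<^sup>2)
          + ennreal ((cmod (u (Complex x y) + v (Complex x y)))\<^sup>2) \<partial>lborel)"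
    unfolding line_norm_sq_def by (rule nn_integral_add[symmetric]) auto
  also have "\<dots> = (\<integral>\<^sup>+x. ennreal (2 * (cmod (u (Complex x y)))\<^sup>2) + ennreal (2 * (cmod (v (Complex x y)))\<^sup>2) \<partial>lborel)"
    by (simp only: *)
  also have "\<dots> = 2 * line_norm_sq u y + 2 * line_norm_sq v y"
    unfolding line_norm_sq_def
    by (subst nn_integral_add) (simp_all add: ennreal_mult nn_integral_cmult)
  finally show ?thesis .
qed

lemma hardy_space_diff_add:
  assumes "u \<in> hardy_space" "v \<in> hardy_space"
  shows "(\<lambda>z. u z - v z) \<in> hardy_space" "(\<lambda>z. u z + v z) \<in> hardy_space"
proof -
  note hol = assms[THEN hardy_space_holomorphic]
  have b: "line_norm_sq (\<lambda>z. u z - v z) y + line_norm_sq (\<lambda>z. u z + v z) y \<le> 2 * hardy_norm_sq u + 2 * hardy_norm_sq v"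
    if "y > 0" for y
    unfolding line_norm_sq_parallelogram[OF hol that]
    by (intro add_mono mult_left_mono line_norm_sq_le_hardy that) auto
  have fin: "2 * hardy_norm_sq u + 2 * hardy_norm_sq v < \<infinity>"
    using assms by (auto simp: hardy_space_def ennreal_mult_less_top)
  have "hardy_norm_sq (\<lambda>z. u z - v z) \<le> 2 * hardy_norm_sq u + 2 * hardy_norm_sq v"
    by (rule hardy_norm_sq_le, rule order_trans[OF _ b]) auto
  then have "hardy_norm_sq (\<lambda>z. u z - v z) < \<infinity>" using fin by (rule le_less_trans)
  moreover have "(\<lambda>z. u z - v z) holomorphic_on upper_half_plane" by (intro holomorphic_intros hol)
  ultimately show "(\<lambda>z. u z - v z) \<in> hardy_space" by (simp add: hardy_space_def)
  have "hardy_norm_sq (\<lambda>z. u z + v z) \<le> 2 * hardy_norm_sq u + 2 * hardy_norm_sq v"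
    by (rule hardy_norm_sq_le, rule order_trans[OF _ b]) auto
  then have "hardy_norm_sq (\<lambda>z. u z + v z) < \<infinity>" using fin by (rule le_less_trans)
  moreover have "(\<lambda>z. u z + v z) holomorphic_on upper_half_plane" by (intro holomorphic_intros hol)
  ultimately show "(\<lambda>z. u z + v z) \<in> hardy_space" by (simp add: hardy_space_def)
qed

lemma hardy_norm_sq_shift_up_le:
  assumes "s \<ge> 0"
  shows "hardy_norm_sq (shift_up s u) \<le> hardy_norm_sq u"
proof (rule hardy_norm_sq_le)
  fix y :: real assume "y > 0"
  then show "line_norm_sq (shift_up s u) y \<le> hardy_norm_sq u"
    unfolding line_norm_sq_shift_up using assms by (intro line_norm_sq_le_hardy) simp
qed

lemma hardy_space_shift_up:
  assumes u: "u \<in> hardy_space" and s: "s \<ge> 0"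
  shows "shift_up s u \<in> hardy_space"
proof -
  have "hardy_norm_sq u < \<infinity>" using u by (simp add: hardy_space_def)
  with hardy_norm_sq_shift_up_le[OF s] have "hardy_norm_sq (shift_up s u) < \<infinity>" by (rule le_less_trans)
  then show ?thesis using holomorphic_shift_up[OF hardy_space_holomorphic[OF u] s] by (simp add: hardy_space_def)
qed

text \<open>Parallelogram law against Fatou's lemma: the norms of \<open>u\<close> and of its translate are at most
  \<open>\<parallel>u\<parallel>\<close>, while their sum has norm almost \<open>2\<parallel>u\<parallel>\<close>.\<close>

lemma hardy_shift_continuous:
  assumes u: "u \<in> hardy_space"
  shows "(\<lambda>n. hardy_norm_sq (\<lambda>z. shift_up (shift_seq n) u z - u z)) \<longlonglongrightarrow> 0"
proof -
  note hol = hardy_space_holomorphic[OF u]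
  define N where "N = hardy_norm_sq u"
  have Nfin: "N < \<infinity>" using u by (simp add: N_def hardy_space_def)
  have small: "\<forall>\<^sub>F n in sequentially. hardy_norm_sq (\<lambda>z. shift_up (shift_seq n) u z - u z) \<le> ennreal (5 * \<kappa>)"
    if \<kappa>: "\<kappa> > 0" for \<kappa> :: real
  proof -
    have "(\<lambda>n. line_norm_sq u (shift_seq n) + ennreal \<kappa>) \<longlonglongrightarrow> N + ennreal \<kappa>"
      unfolding N_def by (intro tendsto_add hardy_norm_sq_LIMSEQ u tendsto_const)
    moreover have "N < N + ennreal \<kappa>"
      using Nfin \<kappa> by (cases N) (auto simp: ennreal_less_iff simp flip: ennreal_plus)
    ultimately have "\<forall>\<^sub>F n in sequentially. N < line_norm_sq u (shift_seq n) + ennreal \<kappa>"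
      by (rule order_tendstoD(1))
    \<comment> \<open>This fixes a height at which the line norm has already reached its supremum up
      to \<open>\<kappa>\<close>; Fatou's lemma can then be applied on that single line.\<close>
    then obtain m where m: "N < line_norm_sq u (shift_seq m) + ennreal \<kappa>"
      using eventually_happens by fastforce
    define \<delta> where "\<delta> = shift_seq m"
    have \<delta>: "\<delta> > 0" "N \<le> line_norm_sq u \<delta> + ennreal \<kappa>" using m by (auto simp: \<delta>_def)
    define A where "A n = line_norm_sq (\<lambda>z. shift_up (shift_seq n) u z + u z) \<delta>" for n
    have mem: "shift_up (shift_seq n) u \<in> hardy_space" for n by (rule hardy_space_shift_up[OF u]) simp
    note mem' = hardy_space_diff_add[OF mem u]
    have Afin: "A n < \<infinity>" for n
      unfolding A_def by (rule line_norm_sq_finite[OF mem'(2) \<delta>(1)])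
    have "4 * line_norm_sq u \<delta> = (\<integral>\<^sup>+x. ennreal ((cmod (2 * u (Complex x \<delta>)))\<^sup>2) \<partial>lborel)"
      unfolding line_norm_sq_def using borel_measurable_line[OF hol \<delta>(1)]
      by (subst nn_integral_cmult[symmetric]) (auto simp: norm_mult power_mult_distrib ennreal_mult intro!: nn_integral_cong)
    also have "\<dots> = (\<integral>\<^sup>+x. liminf (\<lambda>n. ennreal ((cmod (u (Complex x (\<delta> + shift_seq n)) + u (Complex x \<delta>)))\<^sup>2)) \<partial>lborel)"
    proof (rule nn_integral_cong)
      fix x
      have "isCont u (Complex x \<delta>)"
        using holomorphic_on_imp_continuous_on[OF hol] open_upper_half_plane \<delta>(1)
        by (simp add: continuous_on_eq_continuous_at)
      then have "(\<lambda>n. u (Complex x (\<delta> + shift_seq n))) \<longlonglongrightarrow> u (Complex x \<delta>)"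
        by (rule isCont_tendsto_compose) (auto intro!: tendsto_eq_intros shift_seq_tendsto simp: Complex_eq)
      then have "(\<lambda>n. ennreal ((cmod (u (Complex x (\<delta> + shift_seq n)) + u (Complex x \<delta>)))\<^sup>2)) \<longlonglongrightarrow> ennreal ((cmod (u (Complex x \<delta>) + u (Complex x \<delta>)))\<^sup>2)"
        by (intro tendsto_intros)
      from lim_imp_Liminf[OF trivial_limit_sequentially this] show "ennreal ((cmod (2 * u (Complex x \<delta>)))\<^sup>2) = liminf (\<lambda>n. ennreal ((cmod (u (Complex x (\<delta> + shift_seq n)) + u (Complex x \<delta>)))\<^sup>2))"
        unfolding mult_2 by (rule sym)
    qed
    also have "\<dots> \<le> liminf A"
    proof -
      have meas: "(\<lambda>x. ennreal ((cmod (u (Complex x (\<delta> + shift_seq n)) + u (Complex x \<delta>)))\<^sup>2)) \<in> borel_measurable lborel" for n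
      proof -
        have "\<delta> + shift_seq n > 0" using \<delta>(1) by (simp add: add_pos_pos)
        from borel_measurable_line[OF hol \<delta>(1)] borel_measurable_line[OF hol this] show ?thesis by simp
      qed
      have A_eq: "A = (\<lambda>n. \<integral>\<^sup>+x. ennreal ((cmod (u (Complex x (\<delta> + shift_seq n)) + u (Complex x \<delta>)))\<^sup>2) \<partial>lborel)"
        by (simp add: fun_eq_iff A_def line_norm_sq_def)
      show ?thesis unfolding A_eq by (rule nn_integral_liminf[OF meas])
    qed
    finally have lim: "4 * line_norm_sq u \<delta> \<le> liminf A" .
    have "line_norm_sq u \<delta> < \<infinity>" by (rule line_norm_sq_finite[OF u \<delta>(1)])
    then obtain l where l: "4 * line_norm_sq u \<delta> = ennreal l" "l \<ge> 0"
      by (cases "4 * line_norm_sq u \<delta>") (auto simp: ennreal_mult_eq_top_iff)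
    have "\<forall>\<^sub>F n in sequentially. 4 * line_norm_sq u \<delta> \<le> A n + ennreal \<kappa>"
    proof (cases "l \<le> \<kappa>")
      case True
      then have "4 * line_norm_sq u \<delta> \<le> ennreal \<kappa>" unfolding l by (rule ennreal_leI)
      then show ?thesis by (simp add: add_increasing)
    next
      case False
      then have "ennreal (l - \<kappa>) < 4 * line_norm_sq u \<delta>" unfolding l using \<kappa> by (intro ennreal_lessI) auto
      then have "\<forall>\<^sub>F n in sequentially. ennreal (l - \<kappa>) < A n"
        using lim unfolding le_Liminf_iff by auto
      then show ?thesis
      proof eventually_elim
        case (elim n)
        have "ennreal l = ennreal (l - \<kappa>) + ennreal \<kappa>" using False \<kappa> by (simp flip: ennreal_plus)
        also have "\<dots> \<le> A n + ennreal \<kappa>" using elim by (intro add_right_mono) auto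
        finally show ?case unfolding l .
      qed
    qed
    then show ?thesis
    proof eventually_elim
      case (elim n)
      define w where "w = (\<lambda>z. shift_up (shift_seq n) u z - u z)"
      have w: "w \<in> hardy_space" unfolding w_def by (rule mem'(1))
      \<comment> \<open>The error is \<open>4 * \<kappa>\<close> from replacing \<open>4 * N\<close>
        by its value at height \<open>\<delta>\<close>, plus \<open>\<kappa>\<close> from the lower
        limit of \<open>A\<close>. Monotonicity in the height carries the lower bound
        \<open>A n\<close> for the sum from \<open>\<delta>\<close> down to \<open>y\<close>;
        \<open>A n\<close>, being finite, cancels.\<close>
      have low: "line_norm_sq w y \<le> ennreal (5 * \<kappa>)" if y: "0 < y" "y \<le> \<delta>" for y
      proof -
        have "A n \<le> line_norm_sq (\<lambda>z. shift_up (shift_seq n) u z + u z) y"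
          unfolding A_def by (rule line_norm_sq_antimono[OF mem'(2) y])
        then have "A n + line_norm_sq w y \<le> line_norm_sq w y + line_norm_sq (\<lambda>z. shift_up (shift_seq n) u z + u z) y"
          by (subst add.commute) (intro add_left_mono)
        also have "\<dots> = 2 * line_norm_sq (shift_up (shift_seq n) u) y + 2 * line_norm_sq u y"
          unfolding w_def by (rule line_norm_sq_parallelogram[OF hardy_space_holomorphic[OF mem] hol y(1)])
        also have "\<dots> \<le> 2 * N + 2 * N"
          unfolding N_def line_norm_sq_shift_up using y(1)
          by (intro add_mono mult_left_mono line_norm_sq_le_hardy) (auto simp: add_pos_pos)
        also have "\<dots> = 4 * N" by (simp flip: distrib_right)
        also have "\<dots> \<le> 4 * (line_norm_sq u \<delta> + ennreal \<kappa>)" by (intro mult_left_mono \<delta>) auto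
        also have "\<dots> = 4 * line_norm_sq u \<delta> + ennreal (4 * \<kappa>)" using \<kappa> by (simp add: distrib_left ennreal_mult)
        also have "\<dots> \<le> A n + ennreal \<kappa> + ennreal (4 * \<kappa>)" by (intro add_right_mono elim)
        also have "\<dots> = A n + ennreal (5 * \<kappa>)" using \<kappa> by (simp add: add.assoc flip: ennreal_plus)
        finally show ?thesis using Afin[of n] by (auto simp: ennreal_add_left_cancel_le)
      qed
      have "hardy_norm_sq w \<le> ennreal (5 * \<kappa>)"
      proof (rule hardy_norm_sq_le)
        fix y :: real assume y: "y > 0"
        have "line_norm_sq w y \<le> line_norm_sq w (min y \<delta>)"
          by (rule line_norm_sq_antimono[OF w]) (use y \<delta> in auto)
        also have "\<dots> \<le> ennreal (5 * \<kappa>)" by (rule low) (use y \<delta> in auto)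
        finally show "line_norm_sq w y \<le> ennreal (5 * \<kappa>)" .
      qed
      then show ?case unfolding w_def .
    qed
  qed
  show ?thesis
  proof (rule order_tendstoI)
    fix a :: ennreal assume a: "0 < a"
    obtain b where b: "0 < b" "b < a" using dense[OF a] by blast
    obtain r where r: "b = ennreal r" "0 < r"
      using b by (cases b) (auto simp: top.not_eq_extremum[symmetric])
    have "\<forall>\<^sub>F n in sequentially. hardy_norm_sq (\<lambda>z. shift_up (shift_seq n) u z - u z) \<le> b"
      using small[of "r / 5"] r by simp
    then show "\<forall>\<^sub>F n in sequentially. hardy_norm_sq (\<lambda>z. shift_up (shift_seq n) u z - u z) < a"
      by (rule eventually_mono) (rule le_less_trans[OF _ b(2)])
  next
    fix a :: ennreal assume "a < 0"
    then show "\<forall>\<^sub>F n in sequentially. a < hardy_norm_sq (\<lambda>z. shift_up (shift_seq n) u z - u z)"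
      by simp
  qed
qed

section \<open>Maximal inequality and vertical boundary limits in the Hardy space\<close>

lemma emeasure_UN_countable_le:
  assumes "countable C" and [measurable]: "\<And>i. i \<in> C \<Longrightarrow> B i \<in> sets M"
  shows "emeasure M (\<Union>i\<in>C. B i) \<le> (\<integral>\<^sup>+i. emeasure M (B i) \<partial>count_space C)"
proof -
  have [measurable]: "(\<Union>i\<in>C. B i) \<in> sets M" using assms by (intro sets.countable_UN'') auto
  have "emeasure M (\<Union>i\<in>C. B i) = (\<integral>\<^sup>+x. indicator (\<Union>i\<in>C. B i) x \<partial>M)" by simp
  also have "\<dots> \<le> (\<integral>\<^sup>+x. (\<integral>\<^sup>+i. indicator (B i) x \<partial>count_space C) \<partial>M)"
  proof (intro nn_integral_mono)
    fix x
    show "indicator (\<Union>i\<in>C. B i) x \<le> (\<integral>\<^sup>+i. indicator (B i) x \<partial>count_space C)"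
    proof (cases "x \<in> (\<Union>i\<in>C. B i)")
      case True
      then obtain j where j: "j \<in> C" "x \<in> B j" by blast
      have "indicator (B j) x \<le> (\<integral>\<^sup>+i. indicator (B i) x \<partial>count_space C)"
        by (rule nn_integral_ge_point[OF j(1)])
      moreover have "indicator (\<Union>i\<in>C. B i) x = (1::ennreal)" using True by (rule indicator_simps(1))
      ultimately show ?thesis using j by simp
    qed simp
  qed
  also have "\<dots> = (\<integral>\<^sup>+i. (\<integral>\<^sup>+x. indicator (B i) x \<partial>M) \<partial>count_space C)"
    using assms by (intro nn_integral_count_space_nn_integral) auto
  also have "\<dots> = (\<integral>\<^sup>+i. emeasure M (B i) \<partial>count_space C)"
    using assms by (intro nn_integral_cong) auto
  finally show ?thesis .
qed

text \<open>Vitali covering: among the balls with large integral a disjoint countable family is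
  selected whose fivefold enlargements cover \<open>S\<close>. An enlarged ball has length
  \<open>10 * r\<close>, which explains the 10, and finiteness of the integral bounds the radii as
  the covering lemma requires. \<open>S\<close> need not be measurable, so a Borel superset is
  returned.\<close>

lemma maximal_weak_type:
  fixes g :: "real \<Rightarrow> ennreal"
  assumes [measurable]: "g \<in> borel_measurable borel" and fin: "(\<integral>\<^sup>+t. g t \<partial>lborel) < \<infinity>"
    and l: "l > 0"
    and S: "\<And>x. x \<in> S \<Longrightarrow> \<exists>r>0. ennreal (l * r) < (\<integral>\<^sup>+t\<in>cball x r. g t \<partial>lborel)"
  obtains A where "A \<in> sets borel" "S \<subseteq> A" "emeasure lborel A \<le> ennreal (10 / l) * (\<integral>\<^sup>+t. g t \<partial>lborel)"
proof -
  define I where "I = (\<integral>\<^sup>+t. g t \<partial>lborel)"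
  obtain R where R: "\<And>x. x \<in> S \<Longrightarrow> 0 < R x" "\<And>x. x \<in> S \<Longrightarrow> ennreal (l * R x) < (\<integral>\<^sup>+t\<in>cball x (R x). g t \<partial>lborel)"
    using S by metis
  have Rb: "0 < R x \<and> R x \<le> enn2real I / l" if x: "x \<in> S" for x
  proof -
    have "ennreal (l * R x) \<le> I"
      using R(2)[OF x] unfolding I_def
      by (rule order_trans[OF less_imp_le]) (auto intro!: nn_integral_mono split: split_indicator)
    then have "l * R x \<le> enn2real I"
      using fin R(1)[OF x] l by (subst ennreal_le_iff[symmetric]) (auto simp: I_def)
    then show ?thesis using R(1)[OF x] l by (simp add: field_simps)
  qed
  have "S \<subseteq> (\<Union>x\<in>S. cball x (R x))" using Rb by force
  then obtain C where C: "countable C" "C \<subseteq> S"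
    "pairwise (\<lambda>i j. disjnt (cball i (R i)) (cball j (R j))) C" "S \<subseteq> (\<Union>i\<in>C. cball i (5 * R i))"
    by (rule Vitali_covering_lemma_cballs[where a = "\<lambda>x. x" and r = R and K = S and S = S, OF _ Rb])
  define A where "A = (\<Union>i\<in>C. cball i (5 * R i))"
  have A: "A \<in> sets borel" unfolding A_def by (rule sets.countable_UN''[OF C(1)]) simp
  have "emeasure lborel A \<le> (\<integral>\<^sup>+i. emeasure lborel (cball i (5 * R i)) \<partial>count_space C)"
    unfolding A_def by (rule emeasure_UN_countable_le[OF C(1)]) simp
  also have "\<dots> \<le> (\<integral>\<^sup>+i. ennreal (10 / l) * emeasure (density lborel g) (cball i (R i)) \<partial>count_space C)"
  proof (rule nn_integral_mono)
    fix i assume "i \<in> space (count_space C)"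
    then have i: "i \<in> S" using C(2) by auto
    have "emeasure lborel (cball i (5 * R i)) = ennreal (10 * R i)"
      using R(1)[OF i] by (simp add: cball_eq_atLeastAtMost)
    also have "\<dots> = ennreal (10 / l) * ennreal (l * R i)"
      using l R(1)[OF i] by (simp flip: ennreal_mult)
    also have "\<dots> \<le> ennreal (10 / l) * emeasure (density lborel g) (cball i (R i))"
      using R(2)[OF i] by (intro mult_left_mono) (auto simp: emeasure_density less_imp_le)
    finally show "emeasure lborel (cball i (5 * R i)) \<le> ennreal (10 / l) * emeasure (density lborel g) (cball i (R i))" .
  qed
  also have "\<dots> = ennreal (10 / l) * (\<integral>\<^sup>+i. emeasure (density lborel g) (cball i (R i)) \<partial>count_space C)"
    by (rule nn_integral_cmult) simp
  also have "(\<integral>\<^sup>+i. emeasure (density lborel g) (cball i (R i)) \<partial>count_space C) = emeasure (density lborel g) (\<Union>i\<in>C. cball i (R i))"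
    using C(3) by (intro emeasure_UN_countable[symmetric] C(1)) (auto simp: disjoint_family_on_def pairwise_def disjnt_def)
  also have "\<dots> \<le> emeasure (density lborel g) UNIV"
    by (rule emeasure_mono) auto
  also have "\<dots> = I" by (simp add: emeasure_density I_def)
  finally have "emeasure lborel A \<le> ennreal (10 / l) * I" by (simp add: mult_left_mono)
  then show ?thesis using that[OF A] C(4) unfolding A_def I_def by blast
qed

text \<open>With \<open>k\<close> the least index such that \<open>|t - x| \<le> 2^k * y\<close>,
  either \<open>k = 0\<close> or \<open>|t - x|\<close> exceeds half that radius. In both cases
  \<open>(2^k * y)^2\<close> is at most four times \<open>(t - x)^2 + y^2\<close>, so the single
  term \<open>k\<close> of the series already dominates.\<close>

lemma poisson_le_dyadic:
  assumes y: "y > 0"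
  shows "ennreal (poisson (Complex x y) t) \<le> (\<Sum>k. ennreal (4 / (pi * y * 4 ^ k)) * indicator (cball x (2 ^ k * y)) t)"
proof -
  define P where "P k \<longleftrightarrow> \<bar>t - x\<bar> \<le> 2 ^ k * y" for k :: nat
  obtain m :: nat where "\<bar>t - x\<bar> / y < 2 ^ m" using real_arch_pow[of 2 "\<bar>t - x\<bar> / y"] by auto
  then have m: "P m" using y by (simp add: P_def divide_less_eq)
  define k where "k = (LEAST k. P k)"
  have k: "P k" unfolding k_def using m by (rule LeastI)
  have bound: "(2 ^ k * y)\<^sup>2 \<le> 4 * ((t - x)\<^sup>2 + y\<^sup>2)"
  proof (cases k)
    case (Suc j)
    then have "\<not> P j" using not_less_Least[of j P] unfolding k_def by simp
    then have "2 ^ j * y \<le> \<bar>t - x\<bar>" by (simp add: P_def)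
    then have "(2 ^ j * y)\<^sup>2 \<le> \<bar>t - x\<bar>\<^sup>2" using y by (intro power_mono) auto
    moreover have "(2 ^ k * y)\<^sup>2 = 4 * (2 ^ j * y)\<^sup>2" by (simp add: Suc power_mult_distrib)
    ultimately show ?thesis by (simp add: add_increasing2)
  qed (auto intro: add_increasing)
  have cancel: "y / (pi * Q) = 4 * y\<^sup>2 / (pi * y * (4 * Q))" for Q
    using y by (simp add: power2_eq_square)
  have "poisson (Complex x y) t = 4 * y\<^sup>2 / (pi * y * (4 * ((t - x)\<^sup>2 + y\<^sup>2)))"
    unfolding poisson_Complex by (rule cancel)
  also have "\<dots> \<le> 4 * y\<^sup>2 / (pi * y * (2 ^ k * y)\<^sup>2)"
    using bound y by (intro divide_left_mono mult_left_mono mult_pos_pos) (auto intro: add_nonneg_pos)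
  also have "\<dots> = 4 / (pi * y * 4 ^ k)"
    using y by (simp add: power_mult_distrib power_mult[symmetric] mult.commute[of k] power_mult)
  finally have "ennreal (poisson (Complex x y) t) \<le> ennreal (4 / (pi * y * 4 ^ k)) * indicator (cball x (2 ^ k * y)) t"
    using k by (simp add: P_def dist_real_def abs_minus_commute ennreal_leI)
  also have "\<dots> \<le> (\<Sum>k. ennreal (4 / (pi * y * 4 ^ k)) * indicator (cball x (2 ^ k * y)) t)"
  proof -
    define F where "F k = ennreal (4 / (pi * y * 4 ^ k)) * indicator (cball x (2 ^ k * y)) t" for k :: nat
    have "F k \<le> suminf F" using sum_le_suminf[of F "{k}"] by simp
    then show ?thesis by (simp add: F_def[abs_def])
  qed
  finally show ?thesis .
qed

text \<open>The dyadic terms sum to \<open>(4 * l / pi)\<close> times the geometric series with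
  ratio 1/2, that is \<open>8 * l / pi\<close>, which 3 rounds up.\<close>

lemma poisson_integral_le_maximal:
  fixes g :: "real \<Rightarrow> ennreal"
  assumes [measurable]: "g \<in> borel_measurable borel" and y: "y > 0" and l: "l \<ge> 0"
    and r: "\<And>r. r > 0 \<Longrightarrow> (\<integral>\<^sup>+t\<in>cball x r. g t \<partial>lborel) \<le> ennreal (l * r)"
  shows "(\<integral>\<^sup>+t. ennreal (poisson (Complex x y) t) * g t \<partial>lborel) \<le> ennreal (3 * l)"
proof -
  have [measurable]: "cball x r \<in> sets borel" for r by simp
  have "(\<integral>\<^sup>+t. ennreal (poisson (Complex x y) t) * g t \<partial>lborel)
      \<le> (\<integral>\<^sup>+t. (\<Sum>k. ennreal (4 / (pi * y * 4 ^ k)) * indicator (cball x (2 ^ k * y)) t) * g t \<partial>lborel)"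
    by (intro nn_integral_mono mult_right_mono poisson_le_dyadic y) auto
  also have "\<dots> = (\<integral>\<^sup>+t. (\<Sum>k. ennreal (4 / (pi * y * 4 ^ k)) * (g t * indicator (cball x (2 ^ k * y)) t)) \<partial>lborel)"
    by (intro nn_integral_cong) (simp add: ennreal_suminf_multc[symmetric] mult_ac)
  also have "\<dots> = (\<Sum>k. \<integral>\<^sup>+t. ennreal (4 / (pi * y * 4 ^ k)) * (g t * indicator (cball x (2 ^ k * y)) t) \<partial>lborel)"
    by (rule nn_integral_suminf) measurable
  also have "\<dots> = (\<Sum>k. ennreal (4 / (pi * y * 4 ^ k)) * (\<integral>\<^sup>+t\<in>cball x (2 ^ k * y). g t \<partial>lborel))"
    by (subst nn_integral_cmult) measurable
  also have "\<dots> \<le> (\<Sum>k. ennreal (4 / (pi * y * 4 ^ k)) * ennreal (l * (2 ^ k * y)))"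
    using y by (intro suminf_le mult_left_mono r summableI) auto
  also have "\<dots> = (\<Sum>k. ennreal (4 * l / pi * (1 / 2) ^ k))"
  proof -
    have "(2::real) ^ k / 4 ^ k = (1 / 2) ^ k" for k :: nat
      by (simp flip: power_divide)
    then have "4 / (pi * y * 4 ^ k) * (l * (2 ^ k * y)) = 4 * l / pi * (1 / 2) ^ k" for k :: nat
      using y by (simp add: field_simps)
    then show ?thesis using y l by (simp flip: ennreal_mult)
  qed
  also have "\<dots> = ennreal (4 * l / pi * 2)"
    using sums_mult[OF geometric_sums[of "1 / 2 :: real"], of "4 * l / pi"] l
    by (intro suminf_ennreal_eq) auto
  also have "\<dots> \<le> ennreal (3 * l)"
  proof (rule ennreal_leI)
    have "8 / pi \<le> 3" using pi_approx by (simp add: field_simps)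
    from mult_right_mono[OF this l] show "4 * l / pi * 2 \<le> 3 * l" by simp
  qed
  finally show ?thesis .
qed

text \<open>Above a line at height \<open>s > 0\<close> the Poisson integral of \<open>|h|^2\<close>
  dominates \<open>|h|^2\<close>, so a value over \<open>3 * l\<close> forces a ball with average
  too large for \<open>poisson_integral_le_maximal\<close>. The sets \<open>T s\<close> increase to
  \<open>S\<close> as \<open>s\<close> decreases, and each is a union of open sets, which settles
  measurability although uncountably many heights are involved.\<close>

lemma hardy_maximal_inequality:
  assumes h: "h \<in> hardy_space" and l: "l > 0"
  defines "S \<equiv> {x. \<exists>y>0. (cmod (h (Complex x y)))\<^sup>2 > 3 * l}"
  shows "S \<in> sets borel" "emeasure lborel S \<le> ennreal (10 / l) * hardy_norm_sq h"
proof -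
  note hol = hardy_space_holomorphic[OF h]
  define T where "T s = {x. \<exists>y>s. (cmod (h (Complex x y)))\<^sup>2 > 3 * l}" for s
  have open_T: "open (T s)" if "s \<ge> 0" for s
  proof -
    have "T s = (\<Union>y\<in>{s<..}. {x. 3 * l < (cmod (h (Complex x y)))\<^sup>2})" by (auto simp: T_def)
    also have "open \<dots>"
    proof (intro open_UN ballI)
      fix y assume "y \<in> {s<..}"
      then have "continuous_on UNIV (\<lambda>x. h (Complex x y))"
        using that by (intro continuous_on_line hol) auto
      then show "open {x. 3 * l < (cmod (h (Complex x y)))\<^sup>2}"
        by (intro open_Collect_less continuous_intros)
    qed
    finally show ?thesis .
  qed
  have S: "S = T 0" by (simp add: S_def T_def)
  show "S \<in> sets borel" unfolding S using open_T[of 0] by auto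
  have T_le: "emeasure lborel (T s) \<le> ennreal (10 / l) * hardy_norm_sq h" if s: "s > 0" for s
  proof -
    obtain M where "bounded_boundary (shift_up s h) (\<lambda>x. h (Complex x s)) M"
      using bounded_boundary_shift_up[OF h s] .
    then interpret bounded_boundary "shift_up s h" "\<lambda>x. h (Complex x s)" M .
    define g where "g t = ennreal ((cmod (h (Complex t s)))\<^sup>2)" for t
    have g: "g \<in> borel_measurable borel" unfolding g_def by measurable
    have gI: "(\<integral>\<^sup>+t. g t \<partial>lborel) = line_norm_sq h s" by (simp add: g_def line_norm_sq_def)
    have gfin: "(\<integral>\<^sup>+t. g t \<partial>lborel) < \<infinity>"
      unfolding gI by (rule line_norm_sq_finite[OF h s])
    have "\<exists>r>0. ennreal (l * r) < (\<integral>\<^sup>+t\<in>cball x r. g t \<partial>lborel)" if x: "x \<in> T s" for x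
    proof (rule ccontr)
      assume "\<not> ?thesis"
      then have le: "(\<integral>\<^sup>+t\<in>cball x r. g t \<partial>lborel) \<le> ennreal (l * r)" if "r > 0" for r
        using that by (meson leI)
      obtain y where y: "y > s" "(cmod (h (Complex x y)))\<^sup>2 > 3 * l" using x by (auto simp: T_def)
      have "ennreal ((cmod (h (Complex x y)))\<^sup>2) \<le> (\<integral>\<^sup>+t. ennreal (poisson (Complex x (y - s)) t * (cmod (h (Complex t s)))\<^sup>2) \<partial>lborel)"
        using poisson_jensen[of "Complex x (y - s)"] y by simp
      also have "\<dots> = (\<integral>\<^sup>+t. ennreal (poisson (Complex x (y - s)) t) * g t \<partial>lborel)"
        using y by (simp add: g_def ennreal_mult poisson_nonneg)
      also have "\<dots> \<le> ennreal (3 * l)"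
        using y l by (intro poisson_integral_le_maximal[OF g _ _ le]) auto
      finally show False using y(2) l by (simp add: ennreal_le_iff)
    qed
    from maximal_weak_type[OF g gfin l this] obtain A where A: "A \<in> sets borel" "T s \<subseteq> A"
      "emeasure lborel A \<le> ennreal (10 / l) * (\<integral>\<^sup>+t. g t \<partial>lborel)" by blast
    have "emeasure lborel (T s) \<le> emeasure lborel A" using A by (intro emeasure_mono) auto
    also have "\<dots> \<le> ennreal (10 / l) * line_norm_sq h s" using A(3) unfolding gI .
    also have "\<dots> \<le> ennreal (10 / l) * hardy_norm_sq h" by (intro mult_left_mono line_norm_sq_le_hardy s) auto
    finally show ?thesis .
  qed
  have "S = (\<Union>n. T (shift_seq n))"
  proof (intro set_eqI iffI)
    fix x assume "x \<in> S"
    then obtain y where y: "y > 0" "(cmod (h (Complex x y)))\<^sup>2 > 3 * l" by (auto simp: S_def)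
    obtain n where "shift_seq n < y"
      using shift_seq_less[OF y(1)] by blast
    then show "x \<in> (\<Union>n. T (shift_seq n))" using y(2) by (auto simp: T_def)
  next
    fix x assume "x \<in> (\<Union>n. T (shift_seq n))"
    then show "x \<in> S" unfolding S_def T_def using less_trans[OF shift_seq_pos] by blast
  qed
  also have "emeasure lborel \<dots> = (SUP n. emeasure lborel (T (shift_seq n)))"
  proof (rule SUP_emeasure_incseq[symmetric])
    show "range (\<lambda>n. T (shift_seq n)) \<subseteq> sets lborel" using open_T by auto
    show "incseq (\<lambda>n. T (shift_seq n))"
      using decseq_shift_seq by (auto simp: incseq_def decseq_def T_def) (meson le_less_trans)
  qed
  also have "\<dots> \<le> ennreal (10 / l) * hardy_norm_sq h"
    by (rule SUP_least) (rule T_le, simp)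
  finally show "emeasure lborel S \<le> ennreal (10 / l) * hardy_norm_sq h" .
qed

text \<open>The set where \<open>P\<close> fails need not be measurable; it is only enclosed in the
  intersection of the \<open>T n\<close>.\<close>

lemma AE_small_cover:
  assumes sets: "\<And>n. T n \<in> sets M" and sub: "\<And>n x. \<not> P x \<Longrightarrow> x \<in> space M \<Longrightarrow> x \<in> T n"
    and lim: "(\<lambda>n. emeasure M (T n)) \<longlonglongrightarrow> 0"
  shows "AE x in M. P x"
proof -
  have "emeasure M (\<Inter>n. T n) \<le> 0"
    by (rule LIMSEQ_le_const[OF lim]) (auto intro!: emeasure_mono sets)
  then have "(\<Inter>n. T n) \<in> null_sets M"
    using sets by (auto intro!: null_setsI)
  then show ?thesis by (rule AE_I') (use sub in blast)
qed

text \<open>Cauchy criterion for the vertical limit. The factor 4 matches the four differences in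
  the chain by which oscillations are estimated below.\<close>

lemma boundary_value_if_oscillation:
  assumes osc: "\<And>k. \<exists>\<eta>>0. \<forall>y y'. 0 < y \<longrightarrow> y < \<eta> \<longrightarrow> 0 < y' \<longrightarrow> y' < \<eta> \<longrightarrow>
      cmod (u (Complex x y) - u (Complex x y')) \<le> 4 * shift_seq k"
  shows "\<exists>w. has_boundary_value u x w"
proof -
  let ?v = "\<lambda>n. u (Complex x (shift_seq n))"
  have ev: "\<forall>\<^sub>F n in sequentially. shift_seq n < \<eta>" if "\<eta> > 0" for \<eta>
    using order_tendstoD(2)[OF shift_seq_tendsto that] .
  have small: "\<exists>k. 4 * shift_seq k < e" if "e > 0" for e
    using ev[of "e / 4"] that by (auto simp: eventually_sequentially field_simps)
  have "Cauchy ?v"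
  proof (rule metric_CauchyI)
    fix e :: real assume "e > 0"
    obtain k where k: "4 * shift_seq k < e" using small[OF \<open>e > 0\<close>] by blast
    obtain \<eta> where \<eta>: "\<eta> > 0" "\<And>y y'. 0 < y \<Longrightarrow> y < \<eta> \<Longrightarrow> 0 < y' \<Longrightarrow> y' < \<eta> \<Longrightarrow>
        cmod (u (Complex x y) - u (Complex x y')) \<le> 4 * shift_seq k" using osc[of k] by blast
    obtain N where "\<forall>n\<ge>N. shift_seq n < \<eta>" using ev[OF \<eta>(1)] by (auto simp: eventually_sequentially)
    then show "\<exists>N. \<forall>m\<ge>N. \<forall>n\<ge>N. dist (?v m) (?v n) < e"
      using \<eta>(2) le_less_trans[OF _ k] by (intro exI[of _ N]) (simp add: dist_norm)
  qed
  then obtain w where w: "?v \<longlonglongrightarrow> w" by (metis Cauchy_convergent convergent_def)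
  have "((\<lambda>y. u (Complex x y)) \<longlongrightarrow> w) (at_right 0)"
  proof (rule tendstoI)
    fix e :: real assume "e > 0"
    obtain k where k: "4 * shift_seq k < e" using small[OF \<open>e > 0\<close>] by blast
    obtain \<eta> where \<eta>: "\<eta> > 0" "\<And>y y'. 0 < y \<Longrightarrow> y < \<eta> \<Longrightarrow> 0 < y' \<Longrightarrow> y' < \<eta> \<Longrightarrow>
        cmod (u (Complex x y) - u (Complex x y')) \<le> 4 * shift_seq k" using osc[of k] by blast
    have "cmod (u (Complex x y) - w) \<le> 4 * shift_seq k" if y: "0 < y" "y < \<eta>" for y
    proof (rule LIMSEQ_le_const2)
      show "(\<lambda>n. cmod (u (Complex x y) - ?v n)) \<longlonglongrightarrow> cmod (u (Complex x y) - w)"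
        by (intro tendsto_intros w)
      show "\<exists>N. \<forall>n\<ge>N. cmod (u (Complex x y) - ?v n) \<le> 4 * shift_seq k"
      proof -
        obtain N where "\<forall>n\<ge>N. shift_seq n < \<eta>" using ev[OF \<eta>(1)] by (auto simp: eventually_sequentially)
        then show ?thesis using \<eta>(2) y by (intro exI[of _ N]) auto
      qed
    qed
    then show "\<forall>\<^sub>F y in at_right 0. dist (u (Complex x y)) w < e"
      using \<eta>(1) le_less_trans[OF _ k] unfolding eventually_at_right_field by (intro exI[of _ \<eta>]) (simp add: dist_norm)
  qed
  then show ?thesis by (auto simp: has_boundary_value_def)
qed

text \<open>The oscillation of \<open>u\<close> at the boundary is that of \<open>u\<close> minus its (continuous) translate, which the
  maximal inequality makes small off a set of small measure.\<close>

theorem hardy_space_boundary_value: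
  assumes u: "u \<in> hardy_space"
  shows "AE x in lborel. \<exists>w. has_boundary_value u x w"
proof -
  note hol = hardy_space_holomorphic[OF u]
  define osc where "osc k x \<longleftrightarrow> (\<exists>\<eta>>0. \<forall>y y'. 0 < y \<longrightarrow> y < \<eta> \<longrightarrow> 0 < y' \<longrightarrow> y' < \<eta> \<longrightarrow>
      cmod (u (Complex x y) - u (Complex x y')) \<le> 4 * shift_seq k)" for k x
  have "AE x in lborel. osc k x" for k
  proof (rule AE_small_cover)
    define h where "h n = (\<lambda>z. shift_up (shift_seq n) u z - u z)" for n
    \<comment> \<open>Chosen so that the threshold \<open>3 * l\<close> of the maximal inequality is
      the square of the tolerance \<open>shift_seq k\<close>.\<close>
    define l where "l = (shift_seq k)\<^sup>2 / 3"
    have l: "l > 0" by (simp add: l_def shift_seq_def)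
    have h: "h n \<in> hardy_space" for n
      unfolding h_def by (intro hardy_space_diff_add hardy_space_shift_up u) simp
    define T where "T n = {x. \<exists>y>0. (cmod (h n (Complex x y)))\<^sup>2 > 3 * l}" for n
    note max = hardy_maximal_inequality[OF h l, folded T_def]
    show "T n \<in> sets lborel" for n using max(1) by simp
    show "(\<lambda>n. emeasure lborel (T n)) \<longlonglongrightarrow> 0"
    proof (rule tendsto_sandwich[OF _ _ tendsto_const])
      have "(\<lambda>n. ennreal (10 / l) * hardy_norm_sq (h n)) \<longlonglongrightarrow> ennreal (10 / l) * 0"
        unfolding h_def by (intro ennreal_tendsto_cmult hardy_shift_continuous[OF u]) simp
      then show "(\<lambda>n. ennreal (10 / l) * hardy_norm_sq (h n)) \<longlonglongrightarrow> 0" by simp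
      show "\<forall>\<^sub>F n in sequentially. emeasure lborel (T n) \<le> ennreal (10 / l) * hardy_norm_sq (h n)"
        using max(2) by simp
    qed simp
    fix n x assume nosc: "\<not> osc k x"
    show "x \<in> T n"
    proof (rule ccontr)
      assume "x \<notin> T n"
      have le: "cmod (u (Complex x (y + shift_seq n)) - u (Complex x y)) \<le> shift_seq k" if "y > 0" for y
      proof (rule power2_le_imp_le)
        have "\<not> (cmod (h n (Complex x y)))\<^sup>2 > 3 * l"
          using \<open>x \<notin> T n\<close> that unfolding T_def by blast
        then have "(cmod (h n (Complex x y)))\<^sup>2 \<le> (shift_seq k)\<^sup>2" by (simp add: l_def not_less)
        then show "(cmod (u (Complex x (y + shift_seq n)) - u (Complex x y)))\<^sup>2 \<le> (shift_seq k)\<^sup>2"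
          unfolding h_def shift_up_Complex .
      qed (rule shift_seq_nonneg)
      have "has_boundary_value (shift_up (shift_seq n) u) x (u (Complex x (shift_seq n)))"
        by (rule has_boundary_value_shift_up[OF hol]) simp
      then have "\<forall>\<^sub>F y in at_right 0. dist (u (Complex x (y + shift_seq n))) (u (Complex x (shift_seq n))) < shift_seq k"
        unfolding has_boundary_value_def shift_up_Complex by (rule tendstoD) simp
      then obtain \<eta> where \<eta>: "\<eta> > 0" "\<And>y. 0 < y \<Longrightarrow> y < \<eta> \<Longrightarrow>
          cmod (u (Complex x (y + shift_seq n)) - u (Complex x (shift_seq n))) < shift_seq k"
        unfolding eventually_at_right_field by (auto simp: dist_norm)
      have "osc k x" unfolding osc_def
      proof (intro exI[of _ \<eta>] conjI allI impI \<eta>(1))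
        fix y y' assume y: "0 < y" "y < \<eta>" "0 < y'" "y' < \<eta>"
        define a b c where "a = u (Complex x (y + shift_seq n))" and "b = u (Complex x (y' + shift_seq n))"
          and "c = u (Complex x (shift_seq n))"
        \<comment> \<open>The outer two differences are small because \<open>x\<close> avoids
          \<open>T n\<close>, the inner two because the translate is continuous at the real
          line.\<close>
        have "u (Complex x y) - u (Complex x y') = (u (Complex x y) - a) + (a - c) + (c - b) + (b - u (Complex x y'))" by simp
        also have "cmod \<dots> \<le> cmod (u (Complex x y) - a) + cmod (a - c) + cmod (c - b) + cmod (b - u (Complex x y'))"
          by (intro norm_triangle_mono order_refl)
        also have "\<dots> \<le> shift_seq k + shift_seq k + shift_seq k + shift_seq k"
          using le[OF y(1)] le[OF y(3)] \<eta>(2)[OF y(1,2)] \<eta>(2)[OF y(3,4)]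
          unfolding a_def b_def c_def by (intro add_mono) (auto simp: norm_minus_commute)
        finally show "cmod (u (Complex x y) - u (Complex x y')) \<le> 4 * shift_seq k" by simp
      qed
      with nosc show False by simp
    qed
  qed
  then have "AE x in lborel. \<forall>k. osc k x" by (simp add: AE_all_countable)
  then show ?thesis
    unfolding osc_def by eventually_elim (rule boundary_value_if_oscillation, blast)
qed

section \<open>Boundary values of Nevanlinna functions\<close>

lemma has_boundary_value_unique:
  "has_boundary_value u x w \<Longrightarrow> has_boundary_value u x w' \<Longrightarrow> w = w'"
  unfolding has_boundary_value_def by (rule tendsto_unique[OF trivial_limit_at_right_real])

text \<open>Taking the limit along a fixed sequence makes \<open>bv\<close> a Borel function on the
  whole line. Where the vertical limit does not exist the value has no meaning.\<close>

definition bv :: "(complex \<Rightarrow> complex) \<Rightarrow> real \<Rightarrow> complex" where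
  "bv u x = lim (\<lambda>n. u (Complex x (shift_seq n)))"

lemma bv_eq: "has_boundary_value u x w \<Longrightarrow> bv u x = w"
  unfolding bv_def by (rule limI[OF has_boundary_value_imp_LIMSEQ])

lemma has_boundary_value_bv: "\<exists>w. has_boundary_value u x w \<Longrightarrow> has_boundary_value u x (bv u x)"
  using bv_eq by metis

lemma bv_measurable:
  assumes "u holomorphic_on upper_half_plane"
  shows "bv u \<in> borel_measurable borel"
  unfolding bv_def using borel_measurable_line[OF assms shift_seq_pos] by (rule borel_measurable_lim_metric)

text \<open>For fixed \<open>k\<close> and \<open>m\<close> the oscillation condition ranges over a
  continuum of heights, but it cuts out an intersection of closed sets; only the countable
  operations over \<open>k\<close> and \<open>m\<close> then remain. Measurability matters because
  \<open>emeasure\<close> returns 0 on non-measurable sets.\<close>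

lemma boundary_domain_measurable:
  assumes hol: "u holomorphic_on upper_half_plane"
  shows "{x. \<exists>w. has_boundary_value u x w} \<in> sets borel"
proof -
  define E where "E k m = {x. \<forall>y y'. 0 < y \<longrightarrow> y < shift_seq m \<longrightarrow> 0 < y' \<longrightarrow> y' < shift_seq m \<longrightarrow>
      cmod (u (Complex x y) - u (Complex x y')) \<le> 4 * shift_seq k}" for k m
  have closed: "closed (E k m)" for k m
  proof -
    have "E k m = (\<Inter>y\<in>{0<..<shift_seq m}. \<Inter>y'\<in>{0<..<shift_seq m}.
        {x. cmod (u (Complex x y) - u (Complex x y')) \<le> 4 * shift_seq k})" by (auto simp: E_def)
    also have "closed \<dots>"
      by (intro closed_INT ballI closed_Collect_le continuous_intros continuous_on_line hol) auto
    finally show ?thesis .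
  qed
  have "{x. \<exists>w. has_boundary_value u x w} = (\<Inter>k. \<Union>m. E k m)"
  proof (intro set_eqI iffI)
    fix x assume "x \<in> (\<Inter>k. \<Union>m. E k m)"
    then have "\<exists>\<eta>>0. \<forall>y y'. 0 < y \<longrightarrow> y < \<eta> \<longrightarrow> 0 < y' \<longrightarrow> y' < \<eta> \<longrightarrow>
        cmod (u (Complex x y) - u (Complex x y')) \<le> 4 * shift_seq k" for k
      unfolding E_def using shift_seq_pos by blast
    then show "x \<in> {x. \<exists>w. has_boundary_value u x w}"
      by (auto intro: boundary_value_if_oscillation)
  next
    fix x assume "x \<in> {x. \<exists>w. has_boundary_value u x w}"
    then obtain w where w: "((\<lambda>y. u (Complex x y)) \<longlongrightarrow> w) (at_right 0)" by (auto simp: has_boundary_value_def)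
    have "x \<in> (\<Union>m. E k m)" for k
    proof -
      have "\<forall>\<^sub>F y in at_right 0. dist (u (Complex x y)) w < shift_seq k" by (rule tendstoD[OF w]) simp
      then obtain \<eta> where \<eta>: "\<eta> > 0" "\<And>y. 0 < y \<Longrightarrow> y < \<eta> \<Longrightarrow> cmod (u (Complex x y) - w) < shift_seq k"
        unfolding eventually_at_right_field by (auto simp: dist_norm)
      obtain m where m: "shift_seq m < \<eta>"
        using shift_seq_less[OF \<eta>(1)] by blast
      have "x \<in> E k m" unfolding E_def mem_Collect_eq
      proof (intro allI impI)
        fix y y' assume y: "0 < y" "y < shift_seq m" "0 < y'" "y' < shift_seq m"
        have "cmod (u (Complex x y) - u (Complex x y')) \<le> cmod (u (Complex x y) - w) + cmod (u (Complex x y') - w)"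
          by (metis norm_triangle_ineq4 diff_diff_eq2 diff_add_cancel add_diff_cancel_right)
        then show "cmod (u (Complex x y) - u (Complex x y')) \<le> 4 * shift_seq k"
          using \<eta>(2)[of y] \<eta>(2)[of y'] y m shift_seq_pos[of k] by linarith
      qed
      then show ?thesis by blast
    qed
    then show "x \<in> (\<Inter>k. \<Union>m. E k m)" by blast
  qed
  moreover have "(\<Inter>k. \<Union>m. E k m) \<in> sets borel"
    using closed by (intro sets.countable_INT'' sets.countable_UN'') auto
  ultimately show ?thesis by simp
qed

section \<open>Existence of boundary values for the symbol\<close>

text \<open>These are the consequences of the integral representation on which the argument rests.
  The last one records that the coefficient of \<open>z\<close> is 1.\<close>

locale nevanlinna =
  fixes \<Phi> :: "complex \<Rightarrow> complex"
  assumes hol_Phi: "\<Phi> holomorphic_on upper_half_plane"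
    and Im_Phi_ge: "\<And>z. Im z > 0 \<Longrightarrow> Im z \<le> Im (\<Phi> z)"
    and Phi_asymp: "((\<lambda>y. \<Phi> (Complex 0 y) / Complex 0 y) \<longlongrightarrow> 1) at_top"
begin

lemma Im_Phi_pos: "Im z > 0 \<Longrightarrow> Im (\<Phi> z) > 0"
  by (rule less_le_trans[OF _ Im_Phi_ge])

text \<open>After division of numerator and denominator by \<open>iy\<close> only
  \<open>Phi_asymp\<close> and two vanishing corrections remain. The shift \<open>y0\<close> covers
  resolvents seen from a line above the real axis, and \<open>y0 = 0\<close> those on the axis
  itself.\<close>

lemma resolvent_asymp:
  assumes "y0 \<ge> 0"
  shows "((\<lambda>y. - Complex 0 y / (c - \<Phi> (Complex 0 (y + y0)))) \<longlongrightarrow> 1) at_top"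
proof -
  have 1: "((\<lambda>y. \<Phi> (Complex 0 (y + y0)) / Complex 0 (y + y0)) \<longlongrightarrow> 1) at_top"
    by (rule filterlim_compose[OF Phi_asymp]) real_asymp
  have 2: "((\<lambda>y. complex_of_real ((y + y0) / y)) \<longlongrightarrow> complex_of_real 1) at_top"
    by (intro tendsto_of_real) real_asymp
  have 3: "((\<lambda>y. - \<i> * c * complex_of_real (1 / y)) \<longlongrightarrow> - \<i> * c * complex_of_real 0) at_top"
    by (intro tendsto_mult tendsto_const tendsto_of_real) real_asymp
  have "((\<lambda>y. 1 / (\<Phi> (Complex 0 (y + y0)) / Complex 0 (y + y0) * complex_of_real ((y + y0) / y) - (- \<i> * c * complex_of_real (1 / y)))) \<longlongrightarrow> 1 / (1 * complex_of_real 1 - (- \<i> * c * complex_of_real 0))) at_top"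
    by (intro tendsto_divide tendsto_diff tendsto_mult 1 2 3 tendsto_const) simp
  then have "((\<lambda>y. 1 / (\<Phi> (Complex 0 (y + y0)) / Complex 0 (y + y0) * complex_of_real ((y + y0) / y) - (- \<i> * c * complex_of_real (1 / y)))) \<longlongrightarrow> 1) at_top"
    by simp
  then show ?thesis
  proof (rule Lim_transform_eventually)
    show "\<forall>\<^sub>F y in at_top. 1 / (\<Phi> (Complex 0 (y + y0)) / Complex 0 (y + y0) * complex_of_real ((y + y0) / y) - (- \<i> * c * complex_of_real (1 / y)))
        = - Complex 0 y / (c - \<Phi> (Complex 0 (y + y0)))"
      using eventually_gt_at_top[of 0]
    proof eventually_elim
      case (elim y)
      define P where "P = \<Phi> (Complex 0 (y + y0))"
      have ne: "complex_of_real y \<noteq> 0" "complex_of_real y + complex_of_real y0 \<noteq> 0" using elim assms by (auto simp flip: of_real_add)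
      have "P / Complex 0 (y + y0) * complex_of_real ((y + y0) / y) = P / (\<i> * complex_of_real y)"
      proof -
        define Q where "Q = complex_of_real y + complex_of_real y0"
        have Q: "Complex 0 (y + y0) = \<i> * Q" "complex_of_real ((y + y0) / y) = Q / complex_of_real y" "Q \<noteq> 0"
          using ne by (simp_all add: Q_def Complex_eq)
        show ?thesis unfolding Q(1,2) using Q(3) by simp (simp add: divide_inverse)
      qed
      moreover have "- \<i> * c * complex_of_real (1 / y) = c / (\<i> * complex_of_real y)"
        using ne by (simp add: field_simps)
      ultimately have "P / Complex 0 (y + y0) * complex_of_real ((y + y0) / y) - (- \<i> * c * complex_of_real (1 / y)) = (P - c) / (\<i> * complex_of_real y)"
        by (simp add: diff_divide_distrib)
      then have "1 / (P / Complex 0 (y + y0) * complex_of_real ((y + y0) / y) - (- \<i> * c * complex_of_real (1 / y))) = (\<i> * complex_of_real y) / (P - c)"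
        by simp
      also have "\<dots> = - Complex 0 y / (c - P)"
        using minus_divide_divide[of "\<i> * complex_of_real y" "P - c"] by (simp add: Complex_eq)
      finally show ?case unfolding P_def .
    qed
  qed
qed

lemma resolvent_asymp_Im:
  assumes "y0 \<ge> 0"
  shows "((\<lambda>y. y * Im (1 / (c - \<Phi> (Complex 0 (y + y0))))) \<longlongrightarrow> 1) at_top"
proof -
  have "y * Im (1 / d) = Re (- Complex 0 y / d)" for y :: real and d :: complex
    by (simp add: Re_divide Im_divide)
  then show ?thesis
    using tendsto_Re[OF resolvent_asymp[OF assms, of c]] by simp
qed

lemma Im_resolvent: "Im (1 / (Complex s (- \<eta>) - w)) = (Im w + \<eta>) / (cmod (w - Complex s (- \<eta>)))\<^sup>2"
  by (simp add: Im_divide cmod_power2 power2_commute)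

lemma resolvent_ne: "\<eta> \<ge> 0 \<Longrightarrow> Im z > 0 \<Longrightarrow> Complex s (- \<eta>) - \<Phi> z \<noteq> 0"
  using Im_Phi_pos[of z] by (auto simp: complex_eq_iff)

lemma holomorphic_resolvent:
  "\<eta> \<ge> 0 \<Longrightarrow> (\<lambda>z. 1 / (Complex s (- \<eta>) - \<Phi> z)) holomorphic_on upper_half_plane"
  using resolvent_ne by (intro holomorphic_intros hol_Phi) auto

lemma resolvent_bound:
  assumes "\<eta> > 0" "Im w \<ge> 0"
  shows "cmod (1 / (Complex s (- \<eta>) - w)) \<le> 1 / \<eta>"
proof -
  have "\<eta> \<le> \<bar>Im (Complex s (- \<eta>) - w)\<bar>" using assms by simp
  also have "\<dots> \<le> cmod (Complex s (- \<eta>) - w)" by (rule abs_Im_le_cmod)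
  finally show ?thesis using assms by (simp add: norm_divide divide_simps)
qed

lemma resolvent_Im_nonneg: "\<eta> \<ge> 0 \<Longrightarrow> Im z > 0 \<Longrightarrow> Im (1 / (Complex s (- \<eta>) - \<Phi> z)) \<ge> 0"
  unfolding Im_resolvent using Im_Phi_pos[of z] by simp

text \<open>The squared modulus of this function is dominated by its imaginary part, whose integrals over
  horizontal lines equal \<open>\<pi>\<close>; hence it belongs to the Hardy space.\<close>

definition resolv :: "complex \<Rightarrow> complex" where
  "resolv z = 1 / (Complex 0 (-1) - \<Phi> z)"

lemma holomorphic_resolv: "resolv holomorphic_on upper_half_plane"
  unfolding resolv_def using holomorphic_resolvent[of 1 0] by simp

lemma resolv_hardy: "resolv \<in> hardy_space"
proof -
  have "line_norm_sq resolv y \<le> ennreal pi" if y: "y > 0" for y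
  proof -
    interpret bounded_boundary "shift_up y resolv" "\<lambda>x. resolv (Complex x y)" 1
    proof
      show "shift_up y resolv holomorphic_on upper_half_plane" using holomorphic_shift_up[OF holomorphic_resolv] y by simp
      show "cmod (shift_up y resolv z) \<le> 1" if "Im z > 0" for z
        using resolvent_bound[of 1 "\<Phi> (z + \<i> * complex_of_real y)" 0] Im_Phi_pos[of "z + \<i> * complex_of_real y"] that y
        by (simp add: shift_up_def resolv_def)
      show "(\<lambda>x. resolv (Complex x y)) \<in> borel_measurable borel" by (rule borel_measurable_line[OF holomorphic_resolv y])
      show "AE x in lborel. has_boundary_value (shift_up y resolv) x (resolv (Complex x y))"
        by (intro AE_I2 has_boundary_value_shift_up holomorphic_resolv y)
    qed
    have "line_norm_sq resolv y \<le> (\<integral>\<^sup>+t. ennreal (Im (resolv (Complex t y))) \<partial>lborel)"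
      unfolding line_norm_sq_def
    proof (intro nn_integral_mono ennreal_leI)
      fix t
      have "Im (\<Phi> (Complex t y)) > 0" using Im_Phi_pos y by simp
      then show "(cmod (resolv (Complex t y)))\<^sup>2 \<le> Im (resolv (Complex t y))"
        using Im_resolvent[of 0 1 "\<Phi> (Complex t y)"]
        by (simp add: resolv_def norm_divide power_divide norm_minus_commute divide_right_mono)
    qed
    also have "\<dots> = ennreal pi"
    proof (rule total_mass(1))
      show "Im (shift_up y resolv z) \<ge> 0" if "Im z > 0" for z
        using resolvent_Im_nonneg[of 1 "z + \<i> * complex_of_real y" 0] that y by (simp add: shift_up_def resolv_def)
      show "((\<lambda>w. w * Im (shift_up y resolv (Complex 0 w))) \<longlongrightarrow> 1) at_top"
        using resolvent_asymp_Im[of y "Complex 0 (-1)"] y by (simp add: resolv_def)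
    qed
    finally show ?thesis .
  qed
  then have "hardy_norm_sq resolv \<le> ennreal pi" by (rule hardy_norm_sq_le)
  also have "ennreal pi < \<infinity>" by simp
  finally show ?thesis using holomorphic_resolv by (simp add: hardy_space_def)
qed

lemma resolv_boundary: "AE x in lborel. has_boundary_value resolv x (bv resolv x)"
  using hardy_space_boundary_value[OF resolv_hardy] by eventually_elim (rule has_boundary_value_bv)

lemma resolv_ne: "Im z > 0 \<Longrightarrow> resolv z \<noteq> 0"
  unfolding resolv_def using resolvent_ne[of 1 z 0] by simp

lemma Phi_eq_resolv: "Im z > 0 \<Longrightarrow> \<Phi> z = - \<i> - 1 / resolv z"
  unfolding resolv_def by (simp add: complex_eq_iff)

text \<open>The functions \<open>i n / (\<Phi> + i n)\<close> are bounded by 1, converge to 1 and vanish wherever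
  \<open>\<Phi>\<close> has an infinite boundary limit; so the set of such points has harmonic measure 0.\<close>

lemma bv_resolv_ne: "AE x in lborel. bv resolv x \<noteq> 0"
proof -
  have [measurable]: "bv resolv \<in> borel_measurable borel" by (rule bv_measurable[OF holomorphic_resolv])
  define f where "f n z = \<i> * of_nat (Suc n) / (\<Phi> z + \<i> * of_nat (Suc n))" for n z
  \<comment> \<open>With \<open>v = resolv z\<close> one has
    \<open>\<Phi> z = - \<i> - 1 / v\<close>, so
    \<open>\<Phi> z + \<i> * of_nat (Suc n) = D n v / v\<close>; the \<open>-i\<close> lowers
    \<open>Suc n\<close> to \<open>n\<close>. Written through \<open>v\<close>, the function
    \<open>f n\<close> has a limit also where \<open>\<Phi>\<close> tends to infinity, namely
    \<open>F n 0 = 0\<close>.\<close>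
  define D where "D n v = \<i> * of_nat n * v - 1" for n and v :: complex
  define F where "F n v = \<i> * of_nat (Suc n) * v / D n v" for n v
  have Phi_ne: "\<Phi> z + \<i> * of_nat (Suc n) \<noteq> 0" if "Im z > 0" for z n
    using Im_Phi_pos[OF that] by (auto simp: complex_eq_iff)
  have f_bd: "cmod (f n z) \<le> 1" if "Im z > 0" for z n
  proof -
    have "real (Suc n) \<le> \<bar>Im (\<Phi> z + \<i> * of_nat (Suc n))\<bar>" using Im_Phi_pos[OF that] by simp
    also have "\<dots> \<le> cmod (\<Phi> z + \<i> * of_nat (Suc n))" by (rule abs_Im_le_cmod)
    finally show ?thesis using Phi_ne[OF that, of n] by (simp add: f_def norm_divide norm_mult divide_simps del: of_nat_Suc)
  qed
  have f_F: "f n z = F n (resolv z)" "D n (resolv z) \<noteq> 0" if z: "Im z > 0" for z n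
  proof -
    have P: "\<Phi> z + \<i> * of_nat (Suc n) = D n (resolv z) / resolv z"
      using resolv_ne[OF z] Phi_eq_resolv[OF z] by (simp add: D_def diff_divide_distrib algebra_simps)
    then show "D n (resolv z) \<noteq> 0" using Phi_ne[OF z, of n] by auto
    show "f n z = F n (resolv z)" unfolding f_def F_def P by simp
  qed
  have bv_D: "AE x in lborel. D n (bv resolv x) \<noteq> 0" for n
    using resolv_boundary
  proof eventually_elim
    case (elim x)
    have lim: "(\<lambda>k. resolv (Complex x (shift_seq k))) \<longlonglongrightarrow> bv resolv x" by (rule has_boundary_value_imp_LIMSEQ[OF elim])
    \<comment> \<open>The bound \<open>|f n| \<le> 1\<close>, cleared of its denominator, passes to
      the boundary. A zero of \<open>D n\<close> would then force \<open>bv resolv x = 0\<close>,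
      but \<open>D n 0 = -1\<close>.\<close>
    have "cmod (\<i> * of_nat (Suc n) * bv resolv x) \<le> cmod (D n (bv resolv x))"
    proof (rule LIMSEQ_le)
      show "(\<lambda>k. cmod (\<i> * of_nat (Suc n) * resolv (Complex x (shift_seq k)))) \<longlonglongrightarrow> cmod (\<i> * of_nat (Suc n) * bv resolv x)"
        by (intro tendsto_intros lim)
      show "(\<lambda>k. cmod (D n (resolv (Complex x (shift_seq k))))) \<longlonglongrightarrow> cmod (D n (bv resolv x))"
        unfolding D_def by (intro tendsto_intros lim)
      have "cmod (\<i> * of_nat (Suc n) * resolv (Complex x (shift_seq k))) \<le> cmod (D n (resolv (Complex x (shift_seq k))))" for k
        using f_bd[of "Complex x (shift_seq k)" n] f_F[of "Complex x (shift_seq k)" n]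
        by (simp add: F_def norm_divide divide_le_eq_1 del: of_nat_Suc)
      then show "\<exists>N. \<forall>k\<ge>N. cmod (\<i> * of_nat (Suc n) * resolv (Complex x (shift_seq k))) \<le> cmod (D n (resolv (Complex x (shift_seq k))))"
        by blast
    qed
    then show ?case by (auto simp: D_def simp del: of_nat_Suc)
  qed
  have bb: "bounded_boundary (f n) (\<lambda>x. F n (bv resolv x)) 1" for n
  proof
    show "f n holomorphic_on upper_half_plane"
      unfolding f_def by (intro holomorphic_intros hol_Phi) (use Phi_ne in auto)
    show "(\<lambda>x. F n (bv resolv x)) \<in> borel_measurable borel" unfolding F_def D_def by measurable
    show "AE x in lborel. has_boundary_value (f n) x (F n (bv resolv x))"
      using resolv_boundary bv_D[of n]
    proof eventually_elim
      case (elim x)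
      have "((\<lambda>y. F n (resolv (Complex x y))) \<longlongrightarrow> F n (bv resolv x)) (at_right 0)"
        unfolding F_def using elim unfolding D_def has_boundary_value_def by (intro tendsto_intros)
      then show ?case unfolding has_boundary_value_def
      proof (rule Lim_transform_eventually)
        show "\<forall>\<^sub>F y in at_right 0. F n (resolv (Complex x y)) = f n (Complex x y)"
          using eventually_at_right_less[of 0] by eventually_elim (simp add: f_F)
      qed
    qed
  qed (use f_bd in auto)
  \<comment> \<open>Harmonic measure, seen from \<open>\<i>\<close>, of the points where
    \<open>\<Phi>\<close> stays finite. It bounds every \<open>|f n \<i>|\<close>, and these tend to
    1.\<close>
  define J where "J = (LINT t|lborel. poisson \<i> t * indicator {t. bv resolv t \<noteq> 0} t)"
  have Jint: "integrable lborel (\<lambda>t. poisson \<i> t * indicator {t. bv resolv t \<noteq> 0} t)"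
    using poisson_integrable_mult[of \<i> "\<lambda>t. indicator {t. bv resolv t \<noteq> 0} t :: real" 1] by (auto split: split_indicator)
  have le: "cmod (f n \<i>) \<le> J" for n
  proof -
    interpret b: bounded_boundary "f n" "\<lambda>x. F n (bv resolv x)" 1 by (rule bb)
    have "cmod (f n \<i>) = cmod (LINT t|lborel. poisson \<i> t *\<^sub>R F n (bv resolv t))"
      by (simp add: b.poisson_formula)
    also have "\<dots> \<le> (LINT t|lborel. cmod (poisson \<i> t *\<^sub>R F n (bv resolv t)))"
      by (rule integral_norm_bound)
    also have "\<dots> \<le> J" unfolding J_def
    proof (rule integral_mono_AE)
      show "AE t in lborel. cmod (poisson \<i> t *\<^sub>R F n (bv resolv t)) \<le> poisson \<i> t * indicator {t. bv resolv t \<noteq> 0} t"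
        using b.fb_bdd by eventually_elim (auto simp: F_def poisson_nonneg intro!: mult_left_le split: split_indicator)
      show "integrable lborel (\<lambda>t. cmod (poisson \<i> t *\<^sub>R F n (bv resolv t)))"
        by (intro integrable_norm b.poisson_fb_integrable) simp
    qed (rule Jint)
    finally show ?thesis .
  qed
  have "(\<lambda>n. f n \<i>) \<longlonglongrightarrow> 1"
  proof -
    have "(\<lambda>n. \<Phi> \<i> / (\<i> * of_nat (Suc n))) \<longlonglongrightarrow> 0"
    proof -
      have "(\<lambda>n. (- \<i> * \<Phi> \<i>) * of_real (inverse (real (Suc n)))) \<longlonglongrightarrow> (- \<i> * \<Phi> \<i>) * of_real 0"
        by (intro tendsto_intros LIMSEQ_inverse_real_of_nat)
      moreover have "(- \<i> * \<Phi> \<i>) * of_real (inverse (real (Suc n))) = \<Phi> \<i> / (\<i> * of_nat (Suc n))" for n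
        by (simp add: divide_inverse del: of_nat_Suc)
      ultimately show ?thesis by simp
    qed
    then have "(\<lambda>n. 1 / (\<Phi> \<i> / (\<i> * of_nat (Suc n)) + 1)) \<longlonglongrightarrow> 1 / (0 + 1)"
      by (intro tendsto_intros) auto
    moreover have "1 / (\<Phi> \<i> / (\<i> * of_nat (Suc n)) + 1) = f n \<i>" for n
    proof -
      have "\<i> * of_nat (Suc n) \<noteq> (0::complex)" by (simp del: of_nat_Suc)
      then have "\<Phi> \<i> / (\<i> * of_nat (Suc n)) + 1 = (\<Phi> \<i> + \<i> * of_nat (Suc n)) / (\<i> * of_nat (Suc n))"
        by (simp add: add_divide_distrib del: of_nat_Suc)
      then show ?thesis by (simp add: f_def del: of_nat_Suc)
    qed
    ultimately show ?thesis by simp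
  qed
  then have "(\<lambda>n. cmod (f n \<i>)) \<longlonglongrightarrow> cmod 1" by (rule tendsto_norm)
  then have J: "1 \<le> J" using LIMSEQ_le_const2 le by fastforce
  define Z where "Z t = poisson \<i> t * (1 - indicator {t. bv resolv t \<noteq> 0} t)" for t
  have Zi: "integrable lborel Z" "(LINT t|lborel. Z t) = 1 - J"
    unfolding Z_def right_diff_distrib J_def using Jint poisson_integrable[of \<i>] poisson_integral[of \<i>] by auto
  have Zn: "AE t in lborel. 0 \<le> Z t" by (auto simp: Z_def poisson_nonneg split: split_indicator)
  have "(LINT t|lborel. Z t) = 0"
    using integral_nonneg_AE[OF Zn] J Zi(2) by simp
  then have "AE t in lborel. Z t = 0"
    using integral_nonneg_eq_0_iff_AE[OF Zi(1) Zn] by simp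
  then show ?thesis
  proof eventually_elim
    case (elim t)
    have "poisson \<i> t > 0" by (simp add: poisson_def complex_eq_iff)
    then show ?case using elim by (auto simp: Z_def split: split_indicator_asm)
  qed
qed

abbreviation "\<phi> \<equiv> bv \<Phi>"

lemma phi_measurable [measurable]: "\<phi> \<in> borel_measurable borel"
  by (rule bv_measurable[OF hol_Phi])

text \<open>Inverts the Moebius relation \<open>Phi_eq_resolv\<close> at the boundary, which is
  possible where the limit of \<open>resolv\<close> is nonzero.\<close>

lemma phi_boundary: "AE x in lborel. has_boundary_value \<Phi> x (\<phi> x)"
  using resolv_boundary bv_resolv_ne
proof eventually_elim
  case (elim x)
  have "((\<lambda>y. - \<i> - 1 / resolv (Complex x y)) \<longlongrightarrow> - \<i> - 1 / bv resolv x) (at_right 0)"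
    using elim unfolding has_boundary_value_def by (intro tendsto_intros)
  then have "has_boundary_value \<Phi> x (- \<i> - 1 / bv resolv x)"
    unfolding has_boundary_value_def
  proof (rule Lim_transform_eventually)
    show "\<forall>\<^sub>F y in at_right 0. - \<i> - 1 / resolv (Complex x y) = \<Phi> (Complex x y)"
      using eventually_at_right_less[of 0] by eventually_elim (simp add: Phi_eq_resolv)
  qed
  then show ?case by (intro has_boundary_value_bv) blast
qed

lemma phi_Im_nonneg: "AE x in lborel. Im (\<phi> x) \<ge> 0"
  using phi_boundary
proof eventually_elim
  case (elim x)
  have "(\<lambda>n. Im (\<Phi> (Complex x (shift_seq n)))) \<longlonglongrightarrow> Im (\<phi> x)"
    by (intro tendsto_Im has_boundary_value_imp_LIMSEQ elim)
  then show ?case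
    by (rule LIMSEQ_le_const) (auto intro!: less_imp_le Im_Phi_pos)
qed

text \<open>Replaces the relational preimage by the preimage under the Borel function
  \<open>\<phi>\<close>. The two sets differ by a null set, but both must be shown Borel before
  their measures can be compared.\<close>

lemma emeasure_boundary_preimage:
  assumes [measurable]: "S \<in> sets borel"
  shows "emeasure lborel (boundary_preimage \<Phi> S) = emeasure lborel {x. \<phi> x \<in> S}"
proof (rule emeasure_eq_AE)
  show "AE x in lborel. x \<in> boundary_preimage \<Phi> S \<longleftrightarrow> x \<in> {x. \<phi> x \<in> S}"
    using phi_boundary
    by eventually_elim (auto simp: boundary_preimage_def dest: has_boundary_value_unique)
  have "boundary_preimage \<Phi> S = {x. \<exists>w. has_boundary_value \<Phi> x w} \<inter> {x. \<phi> x \<in> S}"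
    by (auto simp: boundary_preimage_def bv_eq dest: has_boundary_value_bv)
  moreover have "{x. \<phi> x \<in> S} \<in> sets borel" by measurable
  ultimately show "boundary_preimage \<Phi> S \<in> sets lborel"
    using boundary_domain_measurable[OF hol_Phi] by simp
  show "{x. \<phi> x \<in> S} \<in> sets lborel" by measurable
qed

lemma resolvent_bounded_boundary:
  assumes \<eta>: "\<eta> > 0"
  shows "bounded_boundary (\<lambda>z. 1 / (Complex s (- \<eta>) - \<Phi> z)) (\<lambda>x. 1 / (Complex s (- \<eta>) - \<phi> x)) (1 / \<eta>)"
proof
  show "(\<lambda>z. 1 / (Complex s (- \<eta>) - \<Phi> z)) holomorphic_on upper_half_plane"
    using holomorphic_resolvent \<eta> by simp
  show "cmod (1 / (Complex s (- \<eta>) - \<Phi> z)) \<le> 1 / \<eta>" if "Im z > 0" for z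
    using resolvent_bound[OF \<eta>] Im_Phi_pos[OF that] by simp
  show "(\<lambda>x. 1 / (Complex s (- \<eta>) - \<phi> x)) \<in> borel_measurable borel" by measurable
  show "AE x in lborel. has_boundary_value (\<lambda>z. 1 / (Complex s (- \<eta>) - \<Phi> z)) x (1 / (Complex s (- \<eta>) - \<phi> x))"
    using phi_boundary phi_Im_nonneg
  proof eventually_elim
    case (elim x)
    have "Complex s (- \<eta>) - \<phi> x \<noteq> 0" using elim(2) \<eta> by (auto simp: complex_eq_iff)
    then show ?case using elim(1) unfolding has_boundary_value_def by (intro tendsto_intros)
  qed
qed

lemma Im_resolvent_poisson: "Im (1 / (Complex s (- \<eta>) - w)) = pi * poisson (w + \<i> * complex_of_real \<eta>) s"
  by (simp add: Im_divide poisson_def cmod_power2 power2_commute add.commute)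

text \<open>The value is exactly 1 for all \<open>s\<close> and \<open>\<eta>\<close> because the
  asymptotics of the resolvent at infinity do not depend on its pole.\<close>

lemma poisson_pushforward:
  assumes \<eta>: "\<eta> > 0"
  shows "(\<integral>\<^sup>+x. ennreal (poisson (\<phi> x + \<i> * complex_of_real \<eta>) s) \<partial>lborel) = 1"
proof -
  interpret bounded_boundary "\<lambda>z. 1 / (Complex s (- \<eta>) - \<Phi> z)" "\<lambda>x. 1 / (Complex s (- \<eta>) - \<phi> x)" "1 / \<eta>"
    by (rule resolvent_bounded_boundary[OF \<eta>])
  have "(\<integral>\<^sup>+x. ennreal (Im (1 / (Complex s (- \<eta>) - \<phi> x))) \<partial>lborel) = ennreal pi"
    by (rule total_mass) (use resolvent_Im_nonneg resolvent_asymp_Im[of 0] \<eta> in auto)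
  then have "ennreal pi * (\<integral>\<^sup>+x. ennreal (poisson (\<phi> x + \<i> * complex_of_real \<eta>) s) \<partial>lborel) = ennreal pi * 1"
    unfolding Im_resolvent_poisson by (simp add: ennreal_mult'' ennreal_mult' nn_integral_cmult)
  then show ?thesis by (subst (asm) ennreal_mult_cancel_left) auto
qed

end

section \<open>The mass carried by the real boundary values\<close>

context nevanlinna
begin

text \<open>The part of the Poisson kernel at \<open>w + i\<eta>\<close> that survives on the real boundary values as
  \<open>\<eta>\<close> tends to 0; up to the factor \<open>\<pi>/\<eta>\<close> it is the squared modulus of a reproducing kernel
  of the Hardy space.\<close>

definition ker :: "complex \<Rightarrow> real \<Rightarrow> real \<Rightarrow> real" where
  "ker w s \<eta> = \<eta> / (pi * (cmod (Complex s (- \<eta>) - w))\<^sup>2)"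

definition kernel_mass :: "real \<Rightarrow> real \<Rightarrow> ennreal" where
  "kernel_mass s \<eta> = (\<integral>\<^sup>+x. ennreal (ker (\<phi> x) s \<eta>) \<partial>lborel)"

definition interior_mass :: "real \<Rightarrow> real \<Rightarrow> ennreal" where
  "interior_mass s \<eta> = (\<integral>\<^sup>+x. ennreal (Im (\<phi> x) / (pi * (cmod (Complex s (- \<eta>) - \<phi> x))\<^sup>2)) \<partial>lborel)"

text \<open>This will be the mass of the absolutely continuous part of the Clark measure at
  \<open>s\<close>. Its complement \<open>sing_mass\<close> is the function \<open>m\<close> of the
  overview.\<close>

definition ac_mass :: "real \<Rightarrow> ennreal" where
  "ac_mass s = (\<integral>\<^sup>+x. ennreal (poisson (\<phi> x) s) \<partial>lborel)"

definition sing_mass :: "real \<Rightarrow> ennreal" where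
  "sing_mass s = 1 - ac_mass s"

lemma ker_measurable [measurable (raw)]:
  assumes [measurable]: "f \<in> borel_measurable M" "g \<in> borel_measurable M"
  shows "(\<lambda>x. ker (f x) (g x) \<eta>) \<in> borel_measurable M"
  unfolding ker_def by measurable

lemma ker_nonneg: "\<eta> \<ge> 0 \<Longrightarrow> ker w s \<eta> \<ge> 0"
  by (simp add: ker_def)

lemma cmod_shift: "cmod (complex_of_real s - (w + \<i> * complex_of_real \<eta>)) = cmod (Complex s (- \<eta>) - w)"
  by (rule arg_cong[where f = cmod]) (simp add: complex_eq_iff)

lemma poisson_eq_ker:
  "poisson (w + \<i> * complex_of_real \<eta>) s = ker w s \<eta> + Im w / (pi * (cmod (Complex s (- \<eta>) - w))\<^sup>2)"
  unfolding poisson_def cmod_shift ker_def by (simp add: add_divide_distrib)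

lemma ker_le_poisson: "Im w \<ge> 0 \<Longrightarrow> ker w s \<eta> \<le> poisson (w + \<i> * complex_of_real \<eta>) s"
  unfolding poisson_eq_ker by simp

lemma kernel_mass_add_interior_mass:
  assumes \<eta>: "\<eta> > 0"
  shows "kernel_mass s \<eta> + interior_mass s \<eta> = 1"
proof -
  have "kernel_mass s \<eta> + interior_mass s \<eta> = (\<integral>\<^sup>+x. ennreal (ker (\<phi> x) s \<eta>)
      + ennreal (Im (\<phi> x) / (pi * (cmod (Complex s (- \<eta>) - \<phi> x))\<^sup>2)) \<partial>lborel)"
    unfolding kernel_mass_def interior_mass_def by (rule nn_integral_add[symmetric]) measurable
  also have "\<dots> = (\<integral>\<^sup>+x. ennreal (poisson (\<phi> x + \<i> * complex_of_real \<eta>) s) \<partial>lborel)"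
  proof (rule nn_integral_cong_AE)
    show "AE x in lborel. ennreal (ker (\<phi> x) s \<eta>) + ennreal (Im (\<phi> x) / (pi * (cmod (Complex s (- \<eta>) - \<phi> x))\<^sup>2))
        = ennreal (poisson (\<phi> x + \<i> * complex_of_real \<eta>) s)"
      using phi_Im_nonneg
    proof eventually_elim
      case (elim x)
      then show ?case unfolding poisson_eq_ker using ker_nonneg[of \<eta>] \<eta> by (intro ennreal_plus[symmetric]) auto
    qed
  qed
  also have "\<dots> = 1" by (rule poisson_pushforward[OF \<eta>])
  finally show ?thesis .
qed

lemma kernel_mass_le_1: "\<eta> > 0 \<Longrightarrow> kernel_mass s \<eta> \<le> 1" and interior_mass_le_1: "\<eta> > 0 \<Longrightarrow> interior_mass s \<eta> \<le> 1"
  using kernel_mass_add_interior_mass[of \<eta> s] by (metis le_iff_add, metis le_iff_add add.commute)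

lemma cmod_resolvent_sq: "(cmod (Complex s (- \<eta>) - w))\<^sup>2 = (s - Re w)\<^sup>2 + (Im w + \<eta>)\<^sup>2"
  unfolding cmod_power2 by (simp add: power2_eq_square algebra_simps)

text \<open>The numerator does not involve \<open>\<eta>\<close> and the denominator decreases with
  it, so the convergence is monotone; at real boundary values all terms vanish.\<close>

lemma interior_mass_tendsto: "(\<lambda>n. interior_mass s (shift_seq n)) \<longlonglongrightarrow> ac_mass s"
  unfolding interior_mass_def ac_mass_def
proof (rule nn_integral_LIMSEQ)
  show "incseq (\<lambda>n x. ennreal (Im (\<phi> x) / (pi * (cmod (Complex s (- shift_seq n) - \<phi> x))\<^sup>2)))"
  proof (intro incseq_SucI le_funI)
    fix n x
    show "ennreal (Im (\<phi> x) / (pi * (cmod (Complex s (- shift_seq n) - \<phi> x))\<^sup>2))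
        \<le> ennreal (Im (\<phi> x) / (pi * (cmod (Complex s (- shift_seq (Suc n)) - \<phi> x))\<^sup>2))"
    proof (cases "Im (\<phi> x) \<ge> 0")
      case True
      have "shift_seq (Suc n) \<le> shift_seq n" by (rule decseq_SucD[OF decseq_shift_seq])
      then have "(Im (\<phi> x) + shift_seq (Suc n))\<^sup>2 \<le> (Im (\<phi> x) + shift_seq n)\<^sup>2"
        using True shift_seq_pos[of "Suc n"] by (intro power_mono) auto
      moreover have "Im (\<phi> x) + shift_seq m \<noteq> 0" for m
        using add_nonneg_pos[OF True shift_seq_pos[of m]] by simp
      ultimately show ?thesis
        unfolding cmod_resolvent_sq using True
        by (intro ennreal_leI divide_left_mono mult_left_mono mult_pos_pos add_left_mono)
           (auto simp: sum_power2_gt_zero_iff)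
    next
      case False
      then show ?thesis by (simp add: ennreal_neg divide_nonpos_nonneg)
    qed
  qed
  fix x
  show "(\<lambda>n. ennreal (Im (\<phi> x) / (pi * (cmod (Complex s (- shift_seq n) - \<phi> x))\<^sup>2))) \<longlonglongrightarrow> ennreal (poisson (\<phi> x) s)"
  proof (cases "Im (\<phi> x) > 0")
    case True
    have "(\<lambda>n. Im (\<phi> x) / (pi * ((s - Re (\<phi> x))\<^sup>2 + (Im (\<phi> x) + shift_seq n)\<^sup>2)))
        \<longlonglongrightarrow> Im (\<phi> x) / (pi * ((s - Re (\<phi> x))\<^sup>2 + (Im (\<phi> x) + 0)\<^sup>2))"
      using True by (intro tendsto_intros shift_seq_tendsto) (auto simp: add_nonneg_eq_0_iff)
    also have "Im (\<phi> x) / (pi * ((s - Re (\<phi> x))\<^sup>2 + (Im (\<phi> x) + 0)\<^sup>2)) = poisson (\<phi> x) s"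
      by (simp add: poisson_def cmod_power2)
    finally show ?thesis unfolding cmod_resolvent_sq by (intro tendsto_ennrealI)
  next
    case False
    then show ?thesis by (simp add: ennreal_neg divide_nonpos_nonneg poisson_def)
  qed
qed measurable

lemma ac_mass_le_1: "ac_mass s \<le> 1"
  by (rule LIMSEQ_le_const2[OF interior_mass_tendsto]) (intro exI allI impI interior_mass_le_1 shift_seq_pos)

lemma ac_mass_add_sing_mass: "ac_mass s + sing_mass s = 1"
  unfolding sing_mass_def by (simp add: ac_mass_le_1)

text \<open>Obtained by complementation from \<open>interior_mass\<close>. Exchanging limit and
  integral in \<open>kernel_mass\<close> itself would give 0, since \<open>ker w s \<eta>\<close>
  tends to 0 for every \<open>w\<close> in the closed half-plane other than \<open>s\<close>; the
  limit measures the mass that concentrates.\<close>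

lemma kernel_mass_tendsto: "(\<lambda>n. kernel_mass s (shift_seq n)) \<longlonglongrightarrow> sing_mass s"
proof -
  have "kernel_mass s (shift_seq n) = 1 - interior_mass s (shift_seq n)" for n
  proof -
    have "interior_mass s (shift_seq n) \<noteq> \<top>" using interior_mass_le_1[of "shift_seq n" s] by (auto simp: top_unique)
    then show ?thesis using kernel_mass_add_interior_mass[of "shift_seq n" s] ennreal_add_diff_cancel_right[of "interior_mass s (shift_seq n)" "kernel_mass s (shift_seq n)"] by simp
  qed
  moreover have "ac_mass s \<noteq> \<top>" using ac_mass_le_1[of s] by (auto simp: top_unique)
  ultimately show ?thesis unfolding sing_mass_def
    by (simp add: tendsto_diff_ennreal interior_mass_tendsto)
qed

lemma sing_mass_le_1: "sing_mass s \<le> 1"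
  unfolding sing_mass_def by (rule diff_le_self_ennreal)

lemma kernel_mass_measurable [measurable]: "(\<lambda>s. kernel_mass s \<eta>) \<in> borel_measurable borel"
  unfolding kernel_mass_def by measurable

lemma ac_mass_measurable [measurable]: "ac_mass \<in> borel_measurable borel"
  unfolding ac_mass_def[abs_def] by measurable

lemma sing_mass_measurable [measurable]: "sing_mass \<in> borel_measurable borel"
  unfolding sing_mass_def[abs_def] by measurable

section \<open>Upper bound for A, and contractivity of composition\<close>

text \<open>The test function is \<open>1/(z - (\<tau> - i \<eta>))\<close>, of squared norm
  \<open>pi / \<eta>\<close>. Its composition with \<open>\<Phi>\<close> is a bounded resolvent up
  to sign, so its line norms are controlled by the boundary integral, which is
  \<open>pi / \<eta>\<close> times \<open>kernel_mass\<close>.\<close>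

lemma const_A_le_kernel_mass:
  assumes \<eta>: "\<eta> > 0"
  shows "const_A \<Phi> \<le> kernel_mass \<tau> \<eta>"
proof -
  define u where "u z = 1 / (z - Complex \<tau> (- \<eta>))" for z
  have ne: "z - Complex \<tau> (- \<eta>) \<noteq> 0" if "Im z > 0" for z using that \<eta> by (auto simp: complex_eq_iff)
  have hol: "u holomorphic_on upper_half_plane"
    unfolding u_def by (intro holomorphic_intros) (use ne in auto)
  have line: "line_norm_sq u y = ennreal (pi / (y + \<eta>))" if y: "y > 0" for y
  proof -
    have pos: "y + \<eta> > 0" using y \<eta> by simp
    \<comment> \<open>The squared modulus at height \<open>y\<close> is a multiple of the Poisson
      kernel of the point \<open>\<tau> + i (y + \<eta>)\<close>, so the line norm can be read
      off.\<close>
    have eq: "(cmod (u (Complex x y)))\<^sup>2 = pi / (y + \<eta>) * poisson (Complex \<tau> (y + \<eta>)) x" for x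
      using pos by (simp add: u_def poisson_Complex norm_divide power_divide cmod_power2)
    have "line_norm_sq u y = (\<integral>\<^sup>+x. ennreal (pi / (y + \<eta>)) * ennreal (poisson (Complex \<tau> (y + \<eta>)) x) \<partial>lborel)"
      unfolding line_norm_sq_def eq using pos by (intro nn_integral_cong ennreal_mult) (auto simp: poisson_nonneg)
    also have "\<dots> = ennreal (pi / (y + \<eta>))"
      using pos by (subst nn_integral_cmult) (auto simp: poisson_nn_integral)
    finally show ?thesis .
  qed
  have "hardy_norm_sq u \<le> ennreal (pi / \<eta>)"
  proof (rule hardy_norm_sq_le)
    fix y :: real assume y: "y > 0"
    show "line_norm_sq u y \<le> ennreal (pi / \<eta>)"
      unfolding line[OF y] using y \<eta> by (intro ennreal_leI divide_left_mono) auto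
  qed
  moreover have "ennreal (pi / \<eta>) \<le> hardy_norm_sq u"
  proof (rule LIMSEQ_le_const2)
    have "(\<lambda>n. pi / (shift_seq n + \<eta>)) \<longlonglongrightarrow> pi / (0 + \<eta>)"
      using \<eta> by (intro tendsto_intros shift_seq_tendsto) auto
    then show "(\<lambda>n. ennreal (pi / (shift_seq n + \<eta>))) \<longlonglongrightarrow> ennreal (pi / \<eta>)"
      by (intro tendsto_ennrealI) simp
    show "\<exists>N. \<forall>n\<ge>N. ennreal (pi / (shift_seq n + \<eta>)) \<le> hardy_norm_sq u"
      using line_norm_sq_le_hardy[OF shift_seq_pos, of u] unfolding line[OF shift_seq_pos] by blast
  qed
  ultimately have Nu: "hardy_norm_sq u = ennreal (pi / \<eta>)" by (rule antisym)
  have "\<i> \<in> upper_half_plane \<and> u \<i> \<noteq> 0" using ne[of \<i>] by (simp add: u_def)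
  then have u: "u \<in> hardy_nonzero"
    using hol Nu by (auto simp: hardy_nonzero_def hardy_space_def)
  interpret bounded_boundary "\<lambda>z. 1 / (Complex \<tau> (- \<eta>) - \<Phi> z)" "\<lambda>x. 1 / (Complex \<tau> (- \<eta>) - \<phi> x)" "1 / \<eta>"
    by (rule resolvent_bounded_boundary[OF \<eta>])
  have "hardy_norm_sq (u \<circ> \<Phi>) \<le> ennreal (pi / \<eta>) * kernel_mass \<tau> \<eta>"
  proof (rule hardy_norm_sq_le)
    fix y :: real assume y: "y > 0"
    have "line_norm_sq (u \<circ> \<Phi>) y = (\<integral>\<^sup>+x. ennreal ((cmod (1 / (Complex \<tau> (- \<eta>) - \<Phi> (Complex x y))))\<^sup>2) \<partial>lborel)"
      unfolding line_norm_sq_def by (simp add: u_def norm_divide norm_minus_commute)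
    also have "\<dots> \<le> (\<integral>\<^sup>+x. ennreal ((cmod (1 / (Complex \<tau> (- \<eta>) - \<phi> x)))\<^sup>2) \<partial>lborel)"
      by (rule line_integral_le[OF y])
    also have "\<dots> = (\<integral>\<^sup>+x. ennreal (pi / \<eta>) * ennreal (ker (\<phi> x) \<tau> \<eta>) \<partial>lborel)"
    proof (rule nn_integral_cong)
      fix x
      have "(cmod (1 / (Complex \<tau> (- \<eta>) - \<phi> x)))\<^sup>2 = pi / \<eta> * ker (\<phi> x) \<tau> \<eta>"
        using \<eta> by (simp add: ker_def norm_divide power_divide)
      then show "ennreal ((cmod (1 / (Complex \<tau> (- \<eta>) - \<phi> x)))\<^sup>2) = ennreal (pi / \<eta>) * ennreal (ker (\<phi> x) \<tau> \<eta>)"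
        using \<eta> ker_nonneg[of \<eta> "\<phi> x" \<tau>] by (simp only:) (rule ennreal_mult, simp_all)
    qed
    also have "\<dots> = ennreal (pi / \<eta>) * kernel_mass \<tau> \<eta>"
      unfolding kernel_mass_def by (rule nn_integral_cmult) measurable
    finally show "line_norm_sq (u \<circ> \<Phi>) y \<le> ennreal (pi / \<eta>) * kernel_mass \<tau> \<eta>" .
  qed
  then have "hardy_norm_sq (u \<circ> \<Phi>) / hardy_norm_sq u \<le> (kernel_mass \<tau> \<eta> * ennreal (pi / \<eta>)) / ennreal (pi / \<eta>)"
    unfolding Nu by (intro divide_right_mono_ennreal) (simp add: mult.commute)
  also have "\<dots> = kernel_mass \<tau> \<eta>"
    using \<eta> by (intro ennreal_mult_divide_eq) (auto simp: ennreal_eq_0_iff not_le)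
  finally have "hardy_norm_sq (u \<circ> \<Phi>) / hardy_norm_sq u \<le> kernel_mass \<tau> \<eta>" .
  moreover have "const_A \<Phi> \<le> hardy_norm_sq (u \<circ> \<Phi>) / hardy_norm_sq u"
    unfolding const_A_def by (rule INF_lower[OF u])
  ultimately show ?thesis by (rule order_trans[rotated])
qed

lemma const_A_le_sing_mass: "const_A \<Phi> \<le> sing_mass \<tau>"
  by (rule LIMSEQ_le_const[OF kernel_mass_tendsto]) (intro exI allI impI const_A_le_kernel_mass shift_seq_pos)

text \<open>Here the pole may be the real point \<open>t\<close> itself: on the line at height
  \<open>y\<close> the imaginary part of \<open>\<Phi>\<close> is at least \<open>y\<close>, so the
  resolvent is bounded by \<open>1 / y\<close> above that line.\<close>

lemma poisson_pushforward_line: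
  assumes y: "y > 0"
  shows "(\<integral>\<^sup>+x. ennreal (poisson (\<Phi> (Complex x y)) t) \<partial>lborel) = 1"
proof -
  define R where "R z = 1 / (Complex t (- 0) - \<Phi> z)" for z
  have hol: "R holomorphic_on upper_half_plane" unfolding R_def by (rule holomorphic_resolvent) simp
  interpret bounded_boundary "shift_up y R" "\<lambda>x. R (Complex x y)" "1 / y"
  proof
    show "shift_up y R holomorphic_on upper_half_plane" using holomorphic_shift_up[OF hol] y by simp
    show "(\<lambda>x. R (Complex x y)) \<in> borel_measurable borel" by (rule borel_measurable_line[OF hol y])
    show "AE x in lborel. has_boundary_value (shift_up y R) x (R (Complex x y))"
      by (intro AE_I2 has_boundary_value_shift_up hol y)
    fix z assume z: "Im z > 0"
    have "y \<le> Im (\<Phi> (z + \<i> * complex_of_real y))"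
      using Im_Phi_ge[of "z + \<i> * complex_of_real y"] z y by simp
    also have "\<dots> \<le> \<bar>Im (Complex t (- 0) - \<Phi> (z + \<i> * complex_of_real y))\<bar>" by simp
    also have "\<dots> \<le> cmod (Complex t (- 0) - \<Phi> (z + \<i> * complex_of_real y))" by (rule abs_Im_le_cmod)
    finally show "cmod (shift_up y R z) \<le> 1 / y"
      unfolding shift_up_def R_def norm_divide using y by (simp add: frac_le)
  qed
  have "(\<integral>\<^sup>+x. ennreal (Im (R (Complex x y))) \<partial>lborel) = ennreal pi"
  proof (rule total_mass(1))
    show "Im (shift_up y R z) \<ge> 0" if "Im z > 0" for z
      unfolding shift_up_def R_def by (rule resolvent_Im_nonneg) (use that y in auto)
    show "((\<lambda>v. v * Im (shift_up y R (Complex 0 v))) \<longlongrightarrow> 1) at_top"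
      unfolding shift_up_Complex R_def by (rule resolvent_asymp_Im) (use y in simp)
  qed
  moreover have "Im (R (Complex x y)) = pi * poisson (\<Phi> (Complex x y)) t" for x
    unfolding R_def using Im_resolvent_poisson[of t 0] by simp
  ultimately have "(\<integral>\<^sup>+x. ennreal pi * ennreal (poisson (\<Phi> (Complex x y)) t) \<partial>lborel) = ennreal pi"
    by (simp add: ennreal_mult')
  moreover have "(\<lambda>x. ennreal (poisson (\<Phi> (Complex x y)) t)) \<in> borel_measurable lborel"
    using borel_measurable_line[OF hol_Phi y] by measurable
  ultimately have "ennreal pi * (\<integral>\<^sup>+x. ennreal (poisson (\<Phi> (Complex x y)) t) \<partial>lborel) = ennreal pi * 1"
    by (simp add: nn_integral_cmult)
  then show ?thesis by (subst (asm) ennreal_mult_cancel_left) auto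
qed

text \<open>\<open>poisson_jensen\<close> is applied to a translate of \<open>h\<close> at the point
  \<open>\<Phi>(x + iy)\<close>; integrating over \<open>x\<close>,
  \<open>poisson_pushforward_line\<close> makes the averaged kernel 1. Fatou's lemma removes the
  translation.\<close>

lemma hardy_contraction:
  assumes h: "h \<in> hardy_space"
  shows "hardy_norm_sq (h \<circ> \<Phi>) \<le> hardy_norm_sq h"
proof (rule hardy_norm_sq_le)
  fix y :: real assume y: "y > 0"
  note hol = hardy_space_holomorphic[OF h]
  have Phi_pos: "Im (\<Phi> (Complex x y)) > 0" for x using Im_Phi_pos y by simp
  have [measurable]: "(\<lambda>x. \<Phi> (Complex x y)) \<in> borel_measurable borel" by (rule borel_measurable_line[OF hol_Phi y])
  have le: "(\<integral>\<^sup>+x. ennreal ((cmod (shift_up (shift_seq n) h (\<Phi> (Complex x y))))\<^sup>2) \<partial>lborel) \<le> hardy_norm_sq h" for n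
  proof -
    let ?s = "shift_seq n"
    obtain M where "bounded_boundary (shift_up ?s h) (\<lambda>x. h (Complex x ?s)) M"
      using bounded_boundary_shift_up[OF h shift_seq_pos] .
    then interpret bounded_boundary "shift_up ?s h" "\<lambda>x. h (Complex x ?s)" M .
    have "(\<integral>\<^sup>+x. ennreal ((cmod (shift_up ?s h (\<Phi> (Complex x y))))\<^sup>2) \<partial>lborel)
        \<le> (\<integral>\<^sup>+x. (\<integral>\<^sup>+t. ennreal (poisson (\<Phi> (Complex x y)) t * (cmod (h (Complex t ?s)))\<^sup>2) \<partial>lborel) \<partial>lborel)"
      by (intro nn_integral_mono poisson_jensen Phi_pos)
    also have "\<dots> = (\<integral>\<^sup>+t. (\<integral>\<^sup>+x. ennreal (poisson (\<Phi> (Complex x y)) t * (cmod (h (Complex t ?s)))\<^sup>2) \<partial>lborel) \<partial>lborel)"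
      by (rule lborel_pair.Fubini') measurable
    also have "\<dots> = (\<integral>\<^sup>+t. (\<integral>\<^sup>+x. ennreal (poisson (\<Phi> (Complex x y)) t) \<partial>lborel) * ennreal ((cmod (h (Complex t ?s)))\<^sup>2) \<partial>lborel)"
      using Phi_pos by (subst nn_integral_multc[symmetric])
        (auto simp: ennreal_mult poisson_nonneg less_imp_le intro!: nn_integral_cong)
    also have "\<dots> = line_norm_sq h ?s"
      by (simp add: poisson_pushforward_line[OF y] line_norm_sq_def)
    also have "\<dots> \<le> hardy_norm_sq h" by (rule line_norm_sq_le_hardy) simp
    finally show ?thesis .
  qed
  have meas: "(\<lambda>x. ennreal ((cmod (shift_up (shift_seq n) h (\<Phi> (Complex x y))))\<^sup>2)) \<in> borel_measurable lborel" for n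
  proof -
    have "continuous_on UNIV (\<lambda>x. shift_up (shift_seq n) h (\<Phi> (Complex x y)))"
      by (rule continuous_on_compose2[OF holomorphic_on_imp_continuous_on[OF holomorphic_shift_up[OF hol]]
            continuous_on_line[OF hol_Phi y]]) (use Phi_pos in auto)
    then have "(\<lambda>x. shift_up (shift_seq n) h (\<Phi> (Complex x y))) \<in> borel_measurable borel"
      by (rule borel_measurable_continuous_onI)
    then show ?thesis by simp
  qed
  have "line_norm_sq (h \<circ> \<Phi>) y
      = (\<integral>\<^sup>+x. liminf (\<lambda>n. ennreal ((cmod (shift_up (shift_seq n) h (\<Phi> (Complex x y))))\<^sup>2)) \<partial>lborel)"
    unfolding line_norm_sq_def
  proof (rule nn_integral_cong)
    fix x
    have "isCont h (\<Phi> (Complex x y))"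
      using holomorphic_on_imp_continuous_on[OF hol] open_upper_half_plane Phi_pos
      by (simp add: continuous_on_eq_continuous_at)
    then have "(\<lambda>n. shift_up (shift_seq n) h (\<Phi> (Complex x y))) \<longlonglongrightarrow> h (\<Phi> (Complex x y))"
      unfolding shift_up_def by (rule isCont_tendsto_compose) (auto intro!: tendsto_eq_intros shift_seq_tendsto)
    then have "(\<lambda>n. ennreal ((cmod (shift_up (shift_seq n) h (\<Phi> (Complex x y))))\<^sup>2)) \<longlonglongrightarrow> ennreal ((cmod (h (\<Phi> (Complex x y))))\<^sup>2)"
      by (intro tendsto_intros)
    from lim_imp_Liminf[OF trivial_limit_sequentially this]
    show "ennreal ((cmod ((h \<circ> \<Phi>) (Complex x y)))\<^sup>2) = liminf (\<lambda>n. ennreal ((cmod (shift_up (shift_seq n) h (\<Phi> (Complex x y))))\<^sup>2))"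
      by simp
  qed
  also have "\<dots> \<le> liminf (\<lambda>n. \<integral>\<^sup>+x. ennreal ((cmod (shift_up (shift_seq n) h (\<Phi> (Complex x y))))\<^sup>2) \<partial>lborel)"
    by (rule nn_integral_liminf[OF meas])
  also have "\<dots> \<le> limsup (\<lambda>n. \<integral>\<^sup>+x. ennreal ((cmod (shift_up (shift_seq n) h (\<Phi> (Complex x y))))\<^sup>2) \<partial>lborel)"
    by (rule Liminf_le_Limsup) simp
  also have "\<dots> \<le> hardy_norm_sq h"
    by (rule Limsup_bounded) (simp add: le)
  finally show "line_norm_sq (h \<circ> \<Phi>) y \<le> hardy_norm_sq h" .
qed

end

section \<open>Pushforward of Lebesgue measure under the real boundary values\<close>

lemma real_segment_borel: "complex_of_real ` {a<..<b} \<in> sets borel"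
proof -
  have "complex_of_real ` {a<..<b} = {z. Im z = 0} \<inter> {z. a < Re z} \<inter> {z. Re z < b}"
    by (auto simp: complex_eq_iff image_iff)
  then show ?thesis by simp
qed

context nevanlinna
begin

text \<open>Where \<open>\<phi> x = c\<close> the Poisson kernel of \<open>c + i \<eta>\<close> at
  \<open>c\<close> equals \<open>1 / (pi * \<eta>)\<close>; its integral is at most 1, so the set
  has measure at most \<open>pi * \<eta>\<close>. This discards interval endpoints and, later, the
  pole of the Clark kernel.\<close>

lemma phi_ne: "AE x in lborel. \<phi> x \<noteq> complex_of_real c"
proof -
  define E where "E = {x. \<phi> x = complex_of_real c}"
  have [measurable]: "E \<in> sets borel" unfolding E_def by measurable
  have "emeasure lborel E \<le> ennreal (pi * shift_seq n)" for n
  proof -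
    let ?s = "shift_seq n"
    have "emeasure lborel E * ennreal (1 / (pi * ?s)) = (\<integral>\<^sup>+x. ennreal (1 / (pi * ?s)) * indicator E x \<partial>lborel)"
      by (subst nn_integral_cmult_indicator) (auto simp: mult.commute)
    also have "\<dots> \<le> (\<integral>\<^sup>+x. ennreal (poisson (\<phi> x + \<i> * complex_of_real ?s) c) \<partial>lborel)"
    proof (intro nn_integral_mono)
      fix x
      show "ennreal (1 / (pi * ?s)) * indicator E x \<le> ennreal (poisson (\<phi> x + \<i> * complex_of_real ?s) c)"
        by (auto simp: E_def poisson_def norm_mult power2_eq_square split: split_indicator)
    qed
    also have "\<dots> = 1" by (rule poisson_pushforward) simp
    finally have "emeasure lborel E * ennreal (1 / (pi * ?s)) * ennreal (pi * ?s) \<le> 1 * ennreal (pi * ?s)"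
      by (rule mult_right_mono) simp
    moreover have "ennreal (1 / (pi * ?s)) * ennreal (pi * ?s) = 1"
      by (simp add: shift_seq_def flip: ennreal_mult)
    ultimately show ?thesis by (simp add: mult.assoc)
  qed
  moreover have "(\<lambda>n. ennreal (pi * shift_seq n)) \<longlonglongrightarrow> ennreal (pi * 0)"
    by (intro tendsto_ennrealI tendsto_intros shift_seq_tendsto)
  ultimately have "emeasure lborel E \<le> ennreal (pi * 0)" by (intro LIMSEQ_le_const) auto
  then have "E \<in> null_sets lborel" by (intro null_setsI) auto
  then show ?thesis by (rule AE_I') (auto simp: E_def)
qed

text \<open>A majorant in \<open>w\<close> uniform in \<open>\<eta>\<close>:
  \<open>ker w 0 1\<close> is integrable along \<open>\<phi>\<close>. It rests on
  \<open>Q \<le> A + |s| + 1\<close>, the distance between the two poles being at most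
  \<open>|s| + 1\<close>. The kernel reappears on the right, harmlessly, since its integral over
  \<open>s\<close> is at most 1.\<close>

lemma ker_dominated:
  assumes \<eta>: "0 < \<eta>" "\<eta> \<le> 1" and w: "Im w \<ge> 0"
  shows "ker w s \<eta> \<le> pi * ker w 0 1 * (2 / pi + 2 * (\<bar>s\<bar> + 1)\<^sup>2 * ker w s \<eta>)"
proof -
  define A where "A = cmod (Complex s (- \<eta>) - w)"
  define Q where "Q = cmod (Complex 0 (- 1) - w)"
  have A: "A > 0" and Q: "Q > 0" using \<eta> w by (auto simp: A_def Q_def complex_eq_iff)
  have "cmod (Complex s (1 - \<eta>)) \<le> \<bar>s\<bar> + \<bar>1 - \<eta>\<bar>" using cmod_le[of "Complex s (1 - \<eta>)"] by simp
  also have "\<dots> \<le> \<bar>s\<bar> + 1" using \<eta> by simp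
  finally have c: "cmod (Complex s (1 - \<eta>)) \<le> \<bar>s\<bar> + 1" .
  have e: "Complex 0 (- 1) - w = (Complex s (- \<eta>) - w) - Complex s (1 - \<eta>)" by (simp add: complex_eq_iff)
  have "Q \<le> A + (\<bar>s\<bar> + 1)" unfolding Q_def A_def e
    using norm_triangle_ineq4[of "Complex s (- \<eta>) - w" "Complex s (1 - \<eta>)"] c by linarith
  then have "Q\<^sup>2 \<le> (A + (\<bar>s\<bar> + 1))\<^sup>2" using Q by (intro power_mono) auto
  also have "\<dots> \<le> 2 * A\<^sup>2 + 2 * (\<bar>s\<bar> + 1)\<^sup>2"
    using sum_squares_bound[of A "\<bar>s\<bar> + 1"] by (simp add: power2_sum)
  finally have "\<eta> / (pi * A\<^sup>2) * Q\<^sup>2 \<le> \<eta> / (pi * A\<^sup>2) * (2 * A\<^sup>2 + 2 * (\<bar>s\<bar> + 1)\<^sup>2)"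
    using \<eta> by (intro mult_left_mono) auto
  also have "\<dots> = \<eta> * (2 / pi) + 2 * (\<bar>s\<bar> + 1)\<^sup>2 * (\<eta> / (pi * A\<^sup>2))"
    using A by (simp add: distrib_left)
  also have "\<dots> \<le> 2 / pi + 2 * (\<bar>s\<bar> + 1)\<^sup>2 * (\<eta> / (pi * A\<^sup>2))"
    using \<eta> by (intro add_right_mono mult_left_le_one_le) auto
  finally have "ker w s \<eta> * Q\<^sup>2 \<le> 2 / pi + 2 * (\<bar>s\<bar> + 1)\<^sup>2 * ker w s \<eta>"
    by (simp add: ker_def A_def)
  then have "ker w s \<eta> \<le> (2 / pi + 2 * (\<bar>s\<bar> + 1)\<^sup>2 * ker w s \<eta>) / Q\<^sup>2"
    using Q by (simp add: pos_le_divide_eq)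
  also have "\<dots> = pi * ker w 0 1 * (2 / pi + 2 * (\<bar>s\<bar> + 1)\<^sup>2 * ker w s \<eta>)"
    by (simp add: ker_def[of w 0 1] Q_def)
  finally show ?thesis .
qed

text \<open>For real \<open>w\<close> the kernel is the Poisson kernel in \<open>s\<close>, an
  approximate identity; for non-real \<open>w\<close> it is of order \<open>\<eta>\<close>. The
  endpoints are excluded because \<open>F\<close> may jump there.\<close>

lemma ker_smoothing_tendsto:
  assumes [measurable]: "F \<in> borel_measurable borel" and F: "\<And>s. 0 \<le> F s" "\<And>s. F s \<le> M * indicator {a<..<b} s"
    and M: "M \<ge> 0" and ab: "a < b"
    and cont: "\<And>t. t \<noteq> a \<Longrightarrow> t \<noteq> b \<Longrightarrow> isCont F t"
    and w: "Im w \<ge> 0" "w \<noteq> complex_of_real a" "w \<noteq> complex_of_real b"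
  shows "(\<lambda>n. \<integral>\<^sup>+s. ennreal (F s * ker w s (shift_seq n)) \<partial>lborel)
      \<longlonglongrightarrow> (if Im w = 0 then ennreal (F (Re w)) else 0)"
proof (cases "Im w = 0")
  case True
  define t where "t = Re w"
  have wt: "w = complex_of_real t" using True by (simp add: t_def complex_eq_iff)
  have bound: "\<bar>F s\<bar> \<le> M" for s
    using F[of s] M by (cases "s \<in> {a<..<b}") auto
  have ker: "ker w s (shift_seq n) = poisson (Complex t (shift_seq n)) s" for s n
    unfolding wt ker_def cmod_resolvent_sq poisson_Complex by simp
  have "(\<integral>\<^sup>+s. ennreal (F s * ker w s (shift_seq n)) \<partial>lborel)
      = ennreal (LINT s|lborel. poisson (Complex t (shift_seq n)) s * F s)" for n
  proof -
    have "integrable lborel (\<lambda>s. poisson (Complex t (shift_seq n)) s *\<^sub>R F s)"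
      by (rule poisson_integrable_mult[where M = M]) (use bound in auto)
    then show ?thesis
      unfolding ker by (subst nn_integral_eq_integral[symmetric]) (auto simp: poisson_nonneg F(1) mult.commute)
  qed
  moreover have "(\<lambda>n. LINT s|lborel. poisson (Complex t (shift_seq n)) s * F s) \<longlonglongrightarrow> F t"
    by (rule poisson_approx_identity[OF _ bound]) (use w wt cont shift_seq_tendsto in auto)
  ultimately show ?thesis using True by (simp add: t_def tendsto_ennrealI)
next
  case False
  then have pos: "Im w > 0" using w(1) by simp
  define c where "c = M / (pi * (Im w)\<^sup>2)"
  have c: "c \<ge> 0" using M by (simp add: c_def)
  have le: "(\<integral>\<^sup>+s. ennreal (F s * ker w s (shift_seq n)) \<partial>lborel) \<le> ennreal (c * shift_seq n * (b - a))" for n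
  proof -
    have "F s * ker w s (shift_seq n) \<le> c * shift_seq n * indicator {a<..<b} s" for s
    proof -
      have "(Im w)\<^sup>2 \<le> (cmod (Complex s (- shift_seq n) - w))\<^sup>2"
      proof -
        have "(Im w)\<^sup>2 \<le> (Im w + shift_seq n)\<^sup>2" using pos by (intro power_mono) auto
        then show ?thesis unfolding cmod_resolvent_sq by (intro add_increasing) auto
      qed
      moreover have "- shift_seq n < Im w" using pos shift_seq_pos[of n] by linarith
      then have "Complex s (- shift_seq n) - w \<noteq> 0" by (auto simp: complex_eq_iff)
      ultimately have "ker w s (shift_seq n) \<le> shift_seq n / (pi * (Im w)\<^sup>2)"
        unfolding ker_def using pos by (intro divide_left_mono mult_left_mono mult_pos_pos) auto
      then have "F s * ker w s (shift_seq n) \<le> (M * indicator {a<..<b} s) * (shift_seq n / (pi * (Im w)\<^sup>2))"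
        using F M by (intro mult_mono) (auto simp: ker_nonneg)
      then show ?thesis by (simp add: c_def mult_ac)
    qed
    then have "(\<integral>\<^sup>+s. ennreal (F s * ker w s (shift_seq n)) \<partial>lborel)
        \<le> (\<integral>\<^sup>+s. ennreal (c * shift_seq n) * indicator {a<..<b} s \<partial>lborel)"
      by (intro nn_integral_mono) (auto intro!: ennreal_leI simp: ennreal_indicator[symmetric] c simp flip: ennreal_mult)
    also have "\<dots> = ennreal (c * shift_seq n * (b - a))"
      using ab c by (subst nn_integral_cmult_indicator) (auto simp: ennreal_mult)
    finally show ?thesis .
  qed
  have lim: "(\<lambda>n. ennreal (c * shift_seq n * (b - a))) \<longlonglongrightarrow> ennreal (c * 0 * (b - a))"
    by (intro tendsto_ennrealI tendsto_intros shift_seq_tendsto)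
  have "(\<lambda>n. \<integral>\<^sup>+s. ennreal (F s * ker w s (shift_seq n)) \<partial>lborel) \<longlonglongrightarrow> 0"
    by (rule tendsto_sandwich[OF _ _ tendsto_const]) (use le lim in auto)
  then show ?thesis using False by simp
qed

text \<open>Integrate \<open>F\<close> against \<open>kernel_mass\<close>, exchange the integrals
  and let \<open>\<eta>\<close> tend to 0: dominated by \<open>F\<close> on the left, by
  \<open>ker_dominated\<close> on the right. The weight \<open>f\<close> is needed twice, as the
  constant 1 for B and as \<open>|u|^2\<close> on a line for A.\<close>

lemma sing_mass_pushforward:
  fixes f :: "real \<Rightarrow> real"
  assumes f: "continuous_on UNIV f" "\<And>s. f s \<ge> 0" and ab: "a < b"
  shows "(\<integral>\<^sup>+s. ennreal (f s * indicator {a<..<b} s) * sing_mass s \<partial>lborel)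
    = (\<integral>\<^sup>+x. ennreal (f (Re (\<phi> x))) * indicator (complex_of_real ` {a<..<b}) (\<phi> x) \<partial>lborel)"
proof -
  have [measurable]: "f \<in> borel_measurable borel" using f(1) by (rule borel_measurable_continuous_onI)
  define F where "F s = f s * indicator {a<..<b} s" for s
  have [measurable]: "F \<in> borel_measurable borel" unfolding F_def by measurable
  have "compact (f ` {a..b})" by (intro compact_continuous_image continuous_on_subset[OF f(1)]) auto
  then obtain M where M: "\<And>s. s \<in> {a..b} \<Longrightarrow> f s \<le> M"
    using bounded_imp_bdd_above[OF compact_imp_bounded] unfolding bdd_above_def by fast
  have M0: "M \<ge> 0" using M[of a] f(2)[of a] ab by simp
  have F0: "0 \<le> F s" for s using f(2) by (simp add: F_def)
  have FM: "F s \<le> M * indicator {a<..<b} s" for s using M[of s] by (auto simp: F_def split: split_indicator)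
  have contF: "isCont F t" if "t \<noteq> a" "t \<noteq> b" for t
  proof -
    have "isCont (indicator {a<..<b} :: real \<Rightarrow> real) t"
      using that ab by (subst isCont_indicator) (auto simp: frontier_def interior_open)
    moreover have "isCont f t" using f(1) by (simp add: continuous_on_eq_continuous_at)
    ultimately show ?thesis unfolding F_def by (intro continuous_mult)
  qed
  define \<psi> where "\<psi> n w = (\<integral>\<^sup>+s. ennreal (F s * ker w s (shift_seq n)) \<partial>lborel)" for n w
  have [measurable]: "\<psi> n \<in> borel_measurable borel" for n
    unfolding \<psi>_def by measurable
  have Ffin: "(\<integral>\<^sup>+s. ennreal (F s) \<partial>lborel) < \<infinity>"
  proof -
    have "(\<integral>\<^sup>+s. ennreal (F s) \<partial>lborel) \<le> (\<integral>\<^sup>+s. ennreal M * indicator {a<..<b} s \<partial>lborel)"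
      using FM M0 by (intro nn_integral_mono) (auto intro!: ennreal_leI simp: ennreal_indicator[symmetric] simp flip: ennreal_mult)
    also have "\<dots> = ennreal M * ennreal (b - a)" using ab by (subst nn_integral_cmult_indicator) auto
    also have "\<dots> < \<infinity>" by (simp add: ennreal_mult_less_top)
    finally show ?thesis .
  qed
  have swap: "(\<integral>\<^sup>+s. ennreal (F s) * kernel_mass s (shift_seq n) \<partial>lborel) = (\<integral>\<^sup>+x. \<psi> n (\<phi> x) \<partial>lborel)" for n
  proof -
    have "(\<integral>\<^sup>+s. ennreal (F s) * kernel_mass s (shift_seq n) \<partial>lborel)
        = (\<integral>\<^sup>+s. (\<integral>\<^sup>+x. ennreal (F s * ker (\<phi> x) s (shift_seq n)) \<partial>lborel) \<partial>lborel)"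
      unfolding kernel_mass_def using F0
      by (intro nn_integral_cong, subst nn_integral_cmult[symmetric]) (auto simp: ennreal_mult ker_nonneg)
    also have "\<dots> = (\<integral>\<^sup>+x. \<psi> n (\<phi> x) \<partial>lborel)"
      unfolding \<psi>_def by (rule lborel_pair.Fubini') measurable
    finally show ?thesis .
  qed
  have "(\<lambda>n. \<integral>\<^sup>+s. ennreal (F s) * kernel_mass s (shift_seq n) \<partial>lborel) \<longlonglongrightarrow> (\<integral>\<^sup>+s. ennreal (F s) * sing_mass s \<partial>lborel)"
  proof (rule nn_integral_dominated_convergence[where w = "\<lambda>s. ennreal (F s)"])
    show "AE s in lborel. ennreal (F s) * kernel_mass s (shift_seq n) \<le> ennreal (F s)" for n
      using mult_left_mono[OF kernel_mass_le_1[OF shift_seq_pos]] by (intro AE_I2) fastforce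
    show "AE s in lborel. (\<lambda>n. ennreal (F s) * kernel_mass s (shift_seq n)) \<longlonglongrightarrow> ennreal (F s) * sing_mass s"
      by (intro AE_I2 ennreal_tendsto_cmult kernel_mass_tendsto) simp
  qed (use Ffin in auto)
  moreover have "(\<lambda>n. \<integral>\<^sup>+x. \<psi> n (\<phi> x) \<partial>lborel)
      \<longlonglongrightarrow> (\<integral>\<^sup>+x. ennreal (f (Re (\<phi> x))) * indicator (complex_of_real ` {a<..<b}) (\<phi> x) \<partial>lborel)"
  proof (rule nn_integral_dominated_convergence)
    define R where "R = \<bar>a\<bar> + \<bar>b\<bar>"
    \<comment> \<open>The integral over \<open>s\<close> in \<open>(a, b)\<close> of the second
      factor in \<open>ker_dominated\<close>, with \<open>|s| \<le> R\<close> and Poisson mass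
      1.\<close>
    define C where "C = M * (2 / pi) * (b - a) + M * (2 * (R + 1)\<^sup>2)"
    have C0: "C \<ge> 0" using M0 ab by (auto simp: C_def)
    show "AE x in lborel. \<psi> n (\<phi> x) \<le> ennreal (pi * C) * ennreal (ker (\<phi> x) 0 1)" for n
      using phi_Im_nonneg
    proof eventually_elim
      case (elim x)
      let ?w = "\<phi> x" and ?s = "shift_seq n"
      define p where "p = pi * ker ?w 0 1"
      have p: "p \<ge> 0" by (simp add: p_def ker_nonneg)
      have "F s * ker ?w s ?s \<le> p * (M * (2 / pi) * indicator {a<..<b} s + M * (2 * (R + 1)\<^sup>2) * poisson (?w + \<i> * complex_of_real ?s) s)" for s
      proof (cases "s \<in> {a<..<b}")
        case True
        have "(\<bar>s\<bar> + 1)\<^sup>2 \<le> (R + 1)\<^sup>2" using True unfolding R_def by (intro power_mono) auto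
        then have "2 * (\<bar>s\<bar> + 1)\<^sup>2 * ker ?w s ?s \<le> 2 * (R + 1)\<^sup>2 * poisson (?w + \<i> * complex_of_real ?s) s"
          using ker_le_poisson[OF elim] by (intro mult_mono) (auto simp: ker_nonneg)
        then have "p * (2 / pi + 2 * (\<bar>s\<bar> + 1)\<^sup>2 * ker ?w s ?s) \<le> p * (2 / pi + 2 * (R + 1)\<^sup>2 * poisson (?w + \<i> * complex_of_real ?s) s)"
          using p by (intro mult_left_mono add_left_mono) auto
        then have k: "ker ?w s ?s \<le> p * (2 / pi + 2 * (R + 1)\<^sup>2 * poisson (?w + \<i> * complex_of_real ?s) s)"
          using ker_dominated[OF shift_seq_pos shift_seq_le_1 elim, of s n] unfolding p_def by linarith
        have "F s * ker ?w s ?s \<le> M * (p * (2 / pi + 2 * (R + 1)\<^sup>2 * poisson (?w + \<i> * complex_of_real ?s) s))"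
          using FM[of s] True M0 by (intro mult_mono k) (auto simp: ker_nonneg)
        also have "\<dots> = p * (M * (2 / pi) + M * (2 * (R + 1)\<^sup>2) * poisson (?w + \<i> * complex_of_real ?s) s)"
          by (simp add: algebra_simps)
        finally show ?thesis using True by simp
      next
        case False
        then have "F s = 0" by (simp add: F_def)
        then show ?thesis using p M0 elim by (simp add: poisson_nonneg)
      qed
      then have "\<psi> n ?w \<le> (\<integral>\<^sup>+s. ennreal p * (ennreal (M * (2 / pi)) * indicator {a<..<b} s
          + ennreal (M * (2 * (R + 1)\<^sup>2)) * ennreal (poisson (?w + \<i> * complex_of_real ?s) s)) \<partial>lborel)"
        unfolding \<psi>_def using p M0 elim
        by (intro nn_integral_mono)
           (auto intro!: ennreal_leI simp: poisson_nonneg ennreal_indicator[symmetric] simp flip: ennreal_mult ennreal_plus)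
      also have "\<dots> = ennreal p * (ennreal (M * (2 / pi)) * ennreal (b - a) + ennreal (M * (2 * (R + 1)\<^sup>2)) * 1)"
        using ab elim by (simp add: nn_integral_cmult nn_integral_add poisson_nn_integral add_nonneg_pos)
      also have "\<dots> = ennreal p * ennreal C"
      proof -
        have eq: "ennreal X * ennreal (b - a) + ennreal Y * 1 = ennreal (X * (b - a) + Y)" if "X \<ge> 0" "Y \<ge> 0" for X Y
          using that ab by (simp add: ennreal_mult)
        then show ?thesis unfolding C_def by (subst eq) (use M0 in auto)
      qed
      also have "\<dots> = ennreal (pi * C) * ennreal (ker ?w 0 1)"
        unfolding p_def using C0 by (simp add: ker_nonneg mult_ac flip: ennreal_mult)
      finally show ?case .
    qed
    have "(\<integral>\<^sup>+x. ennreal (pi * C) * ennreal (ker (\<phi> x) 0 1) \<partial>lborel) = ennreal (pi * C) * kernel_mass 0 1"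
      unfolding kernel_mass_def by (rule nn_integral_cmult) measurable
    also have "\<dots> \<le> ennreal (pi * C) * 1" by (intro mult_left_mono kernel_mass_le_1) auto
    also have "\<dots> < \<infinity>" by simp
    finally show "(\<integral>\<^sup>+x. ennreal (pi * C) * ennreal (ker (\<phi> x) 0 1) \<partial>lborel) < \<infinity>" .
    show "AE x in lborel. (\<lambda>n. \<psi> n (\<phi> x)) \<longlonglongrightarrow> ennreal (f (Re (\<phi> x))) * indicator (complex_of_real ` {a<..<b}) (\<phi> x)"
      using phi_Im_nonneg phi_ne[of a] phi_ne[of b]
    proof eventually_elim
      case (elim x)
      have "(\<lambda>n. \<psi> n (\<phi> x)) \<longlonglongrightarrow> (if Im (\<phi> x) = 0 then ennreal (F (Re (\<phi> x))) else 0)"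
        unfolding \<psi>_def by (rule ker_smoothing_tendsto[OF _ F0 FM M0 ab contF elim]) simp_all
      moreover have "\<phi> x \<in> complex_of_real ` {a<..<b} \<longleftrightarrow> Im (\<phi> x) = 0 \<and> Re (\<phi> x) \<in> {a<..<b}"
        by (auto simp: complex_eq_iff image_iff)
      ultimately show ?case by (auto simp: F_def split: split_indicator if_splits)
    qed
    note [measurable] = real_segment_borel[of a b]
    show "(\<lambda>x. ennreal (f (Re (\<phi> x))) * indicator (complex_of_real ` {a<..<b}) (\<phi> x)) \<in> borel_measurable lborel"
      by measurable
  qed measurable
  ultimately show ?thesis unfolding swap F_def[symmetric] by (rule LIMSEQ_unique)
qed

end

section \<open>The constants B and C\<close>

lemma ennreal_le_divideI:
  fixes a b c :: ennreal
  assumes "a * c \<le> b" "c \<noteq> 0" "c \<noteq> \<top>"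
  shows "a \<le> b / c"
proof -
  have "a = a * c / c" using assms by (simp add: ennreal_mult_divide_eq)
  also have "\<dots> \<le> b / c" by (rule divide_right_mono_ennreal[OF assms(1)])
  finally show ?thesis .
qed

lemma ennreal_le_divideD:
  fixes a b c :: ennreal
  assumes "a \<le> b / c" "c \<noteq> 0" "c \<noteq> \<top>"
  shows "a * c \<le> b"
proof -
  have "a * c \<le> b / c * c" by (rule mult_right_mono[OF assms(1)]) simp
  also have "\<dots> = b" using assms by (simp add: ennreal_divide_times less_top)
  finally show ?thesis .
qed

lemma diameter_disk_subset: "a \<le> c \<Longrightarrow> d \<le> b \<Longrightarrow> diameter_disk c d \<subseteq> diameter_disk a b"
  unfolding diameter_disk_def ball_subset_ball_iff dist_of_real
  by (auto simp: dist_real_def abs_if field_simps)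

lemma diameter_disk_real:
  assumes "w \<in> diameter_disk a b" "Im w = 0"
  shows "w \<in> complex_of_real ` {a<..<b}"
proof -
  have "w = complex_of_real (Re w)" using assms(2) by (simp add: complex_eq_iff)
  moreover have "\<bar>(a + b) / 2 - Re w\<bar> < (b - a) / 2"
  proof -
    have "dist (complex_of_real ((a + b) / 2)) (complex_of_real (Re w)) < (b - a) / 2"
      using assms calculation by (simp add: diameter_disk_def)
    then show ?thesis by (simp add: dist_of_real dist_real_def del: of_real_divide of_real_add)
  qed
  then have "Re w \<in> {a<..<b}" by (auto simp: abs_if field_simps split: if_splits)
  ultimately show ?thesis by blast
qed

lemma segment_subset_diameter_disk: "complex_of_real ` {a<..<b} \<subseteq> diameter_disk a b"
proof
  fix w assume "w \<in> complex_of_real ` {a<..<b}"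
  then obtain t where t: "w = complex_of_real t" "a < t" "t < b" by auto
  have "dist (complex_of_real ((a + b) / 2)) (complex_of_real t) < (b - a) / 2"
    unfolding dist_of_real dist_real_def using t by (auto simp: abs_if field_simps)
  then show "w \<in> diameter_disk a b" by (simp add: diameter_disk_def t(1))
qed

lemma diameter_disk_Im: "w \<in> diameter_disk a b \<Longrightarrow> \<bar>Im w\<bar> < (b - a) / 2"
  using abs_Im_le_cmod[of "complex_of_real ((a + b) / 2) - w"]
  by (simp add: diameter_disk_def dist_norm)

context nevanlinna
begin

lemma preimage_real_eq:
  assumes "a < b"
  shows "emeasure lborel (boundary_preimage \<Phi> (complex_of_real ` {a<..<b}))
    = (\<integral>\<^sup>+s. indicator {a<..<b} s * sing_mass s \<partial>lborel)"
proof -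
  note [measurable] = real_segment_borel[of a b]
  have "emeasure lborel (boundary_preimage \<Phi> (complex_of_real ` {a<..<b}))
      = emeasure lborel {x. \<phi> x \<in> complex_of_real ` {a<..<b}}"
    by (rule emeasure_boundary_preimage) measurable
  also have "\<dots> = (\<integral>\<^sup>+x. indicator {x. \<phi> x \<in> complex_of_real ` {a<..<b}} x \<partial>lborel)"
    by (rule nn_integral_indicator[symmetric]) measurable
  also have "\<dots> = (\<integral>\<^sup>+x. ennreal ((\<lambda>_. 1) (Re (\<phi> x))) * indicator (complex_of_real ` {a<..<b}) (\<phi> x) \<partial>lborel)"
    by (intro nn_integral_cong) (auto split: split_indicator)
  also have "\<dots> = (\<integral>\<^sup>+s. ennreal ((\<lambda>_. 1) s * indicator {a<..<b} s) * sing_mass s \<partial>lborel)"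
    by (rule sing_mass_pushforward[symmetric]) (use assms in auto)
  finally show ?thesis by (simp add: ennreal_indicator)
qed

lemma const_B_upper: "const_B \<Phi> \<le> emeasure lborel (boundary_preimage \<Phi> (complex_of_real ` {a<..<b})) / ennreal (b - a)"
  if "a < b"
proof -
  have "const_B \<Phi> \<le> (case (a, b) of (a, b) \<Rightarrow> emeasure lborel (boundary_preimage \<Phi> (complex_of_real ` {a<..<b})) / ennreal (b - a))"
    unfolding const_B_def by (rule INF_lower) (use that in simp)
  then show ?thesis by simp
qed

lemma const_C_upper: "const_C \<Phi> \<le> emeasure lborel (boundary_preimage \<Phi> (diameter_disk a b)) / ennreal (b - a)"
  if "a < b"
proof -
  have "const_C \<Phi> \<le> (case (a, b) of (a, b) \<Rightarrow> emeasure lborel (boundary_preimage \<Phi> (diameter_disk a b)) / ennreal (b - a))"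
    unfolding const_C_def by (rule INF_lower) (use that in simp)
  then show ?thesis by simp
qed

lemma sing_le_const_B:
  assumes "\<And>s. c \<le> sing_mass s"
  shows "c \<le> const_B \<Phi>"
  unfolding const_B_def
proof (rule INF_greatest, clarify)
  fix a b :: real assume ab: "a < b"
  have "c * ennreal (b - a) = (\<integral>\<^sup>+s. c * indicator {a<..<b} s \<partial>lborel)"
    using ab by (subst nn_integral_cmult_indicator) auto
  also have "\<dots> \<le> (\<integral>\<^sup>+s. indicator {a<..<b} s * sing_mass s \<partial>lborel)"
    using assms by (intro nn_integral_mono) (auto split: split_indicator)
  also have "\<dots> = emeasure lborel (boundary_preimage \<Phi> (complex_of_real ` {a<..<b}))"
    by (rule preimage_real_eq[OF ab, symmetric])
  finally show "c \<le> emeasure lborel (boundary_preimage \<Phi> (complex_of_real ` {a<..<b})) / ennreal (b - a)"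
    by (rule ennreal_le_divideI) (use ab in auto)
qed

text \<open>By Fatou's lemma \<open>sing_mass\<close> is upper semicontinuous, so its infimum is already
  seen by averages over short intervals.\<close>

lemma const_B_le_sing_mass: "const_B \<Phi> \<le> sing_mass \<tau>"
proof (rule ccontr)
  assume "\<not> const_B \<Phi> \<le> sing_mass \<tau>"
  then obtain c where c: "sing_mass \<tau> < c" "c < const_B \<Phi>" using dense by (auto simp: not_le)
  have "\<exists>s. \<bar>s - \<tau>\<bar> < shift_seq n \<and> c \<le> sing_mass s" for n
  proof (rule ccontr)
    assume "\<not> (\<exists>s. \<bar>s - \<tau>\<bar> < shift_seq n \<and> c \<le> sing_mass s)"
    then have less: "sing_mass s \<le> c" if "\<bar>s - \<tau>\<bar> < shift_seq n" for s
      using that by (meson not_le less_imp_le)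
    define a b where "a = \<tau> - shift_seq n" and "b = \<tau> + shift_seq n"
    have ab: "a < b" using shift_seq_pos[of n] unfolding a_def b_def by linarith
    have "const_B \<Phi> * ennreal (b - a) \<le> emeasure lborel (boundary_preimage \<Phi> (complex_of_real ` {a<..<b}))"
      by (rule ennreal_le_divideD[OF const_B_upper[OF ab]]) (use ab in auto)
    also have "\<dots> = (\<integral>\<^sup>+s. indicator {a<..<b} s * sing_mass s \<partial>lborel)"
      by (rule preimage_real_eq[OF ab])
    also have "\<dots> \<le> (\<integral>\<^sup>+s. c * indicator {a<..<b} s \<partial>lborel)"
    proof (rule nn_integral_mono)
      fix s
      show "indicator {a<..<b} s * sing_mass s \<le> c * indicator {a<..<b} s"
      proof (cases "s \<in> {a<..<b}")
        case True
        then have "\<bar>s - \<tau>\<bar> < shift_seq n" unfolding a_def b_def abs_less_iff by auto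
        then show ?thesis using less True by simp
      qed simp
    qed
    also have "\<dots> = c * ennreal (b - a)" using ab by (subst nn_integral_cmult_indicator) auto
    finally have "const_B \<Phi> \<le> c * ennreal (b - a) / ennreal (b - a)"
      by (rule ennreal_le_divideI) (use ab in auto)
    also have "\<dots> = c" using ab by (intro ennreal_mult_divide_eq) auto
    finally show False using c(2) by simp
  qed
  then obtain s where s: "\<And>n. \<bar>s n - \<tau>\<bar> < shift_seq n" "\<And>n. c \<le> sing_mass (s n)" by metis
  have s_lim: "s \<longlonglongrightarrow> \<tau>"
  proof -
    have "(\<lambda>n. s n - \<tau>) \<longlonglongrightarrow> 0"
      by (rule Lim_null_comparison[OF _ shift_seq_tendsto]) (use s(1) in \<open>simp add: less_imp_le\<close>)
    then show ?thesis by (simp add: LIM_zero_iff)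
  qed
  \<comment> \<open>Upper semicontinuity of \<open>sing_mass\<close> is used as lower semicontinuity
    of \<open>ac_mass\<close>, the form in which Fatou's lemma delivers it.\<close>
  have ac: "ac_mass (s n) \<le> 1 - c" for n
  proof -
    have "c \<le> 1" using s(2)[of n] sing_mass_le_1[of "s n"] by (rule order_trans)
    then have "c \<noteq> \<top>" by (auto simp: top_unique)
    have "ac_mass (s n) + c \<le> 1"
      using add_left_mono[OF s(2)[of n], of "ac_mass (s n)"] ac_mass_add_sing_mass[of "s n"] by simp
    then show ?thesis using \<open>c \<noteq> \<top>\<close> by (simp add: ennreal_le_minus_iff add.commute)
  qed
  have "ac_mass \<tau> = (\<integral>\<^sup>+x. liminf (\<lambda>n. ennreal (poisson (\<phi> x) (s n))) \<partial>lborel)"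
    unfolding ac_mass_def
  proof (rule nn_integral_cong)
    fix x
    have "(\<lambda>n. poisson (\<phi> x) (s n)) \<longlonglongrightarrow> poisson (\<phi> x) \<tau>"
    proof (cases "Im (\<phi> x) = 0")
      case True
      then show ?thesis by (simp add: poisson_def)
    next
      case False
      then show ?thesis unfolding poisson_def
        by (intro tendsto_intros s_lim) (auto simp: complex_eq_iff)
    qed
    then have "(\<lambda>n. ennreal (poisson (\<phi> x) (s n))) \<longlonglongrightarrow> ennreal (poisson (\<phi> x) \<tau>)" by (rule tendsto_ennrealI)
    from lim_imp_Liminf[OF trivial_limit_sequentially this]
    show "ennreal (poisson (\<phi> x) \<tau>) = liminf (\<lambda>n. ennreal (poisson (\<phi> x) (s n)))" by (rule sym)
  qed
  also have "\<dots> \<le> liminf (\<lambda>n. ac_mass (s n))"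
    unfolding ac_mass_def by (rule nn_integral_liminf) measurable
  also have "\<dots> \<le> limsup (\<lambda>n. ac_mass (s n))" by (rule Liminf_le_Limsup) simp
  also have "\<dots> \<le> 1 - c" by (rule Limsup_bounded) (simp add: ac)
  finally have "ac_mass \<tau> + c \<le> (1 - c) + c" by (rule add_right_mono)
  also have "\<dots> = ac_mass \<tau> + sing_mass \<tau>"
    using order_trans[OF s(2)[of 0] sing_mass_le_1] by (simp add: ac_mass_add_sing_mass diff_add_cancel_ennreal)
  finally have "c \<le> sing_mass \<tau>"
    using ac_mass_le_1[of \<tau>] by (auto simp: ennreal_add_left_cancel_le top_unique)
  with c(1) show False by simp
qed

lemma const_B_le_const_C: "const_B \<Phi> \<le> const_C \<Phi>"
  unfolding const_C_def
proof (rule INF_greatest, clarify)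
  fix a b :: real assume ab: "a < b"
  have [measurable]: "diameter_disk a b \<in> sets borel" by (simp add: diameter_disk_def)
  note [measurable] = real_segment_borel[of a b]
  have "emeasure lborel (boundary_preimage \<Phi> (complex_of_real ` {a<..<b})) = emeasure lborel {x. \<phi> x \<in> complex_of_real ` {a<..<b}}"
    by (rule emeasure_boundary_preimage) measurable
  also have "\<dots> \<le> emeasure lborel {x. \<phi> x \<in> diameter_disk a b}"
    using segment_subset_diameter_disk[of a b] by (intro emeasure_mono) auto
  also have "\<dots> = emeasure lborel (boundary_preimage \<Phi> (diameter_disk a b))"
    by (rule emeasure_boundary_preimage[symmetric]) measurable
  finally show "const_B \<Phi> \<le> emeasure lborel (boundary_preimage \<Phi> (diameter_disk a b)) / ennreal (b - a)"
    by (intro order_trans[OF const_B_upper[OF ab]] divide_right_mono_ennreal)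
qed

text \<open>Chebyshev's inequality: on the preimage \<open>|\<phi> x + i| \<le> R\<close>, so
  \<open>ker (\<phi> x) 0 1\<close> is bounded below, while its integral is at most 1. Finiteness is
  what continuity from above will require.\<close>

lemma preimage_disk_finite:
  "emeasure lborel {x. \<phi> x \<in> diameter_disk a b} < \<infinity>"
proof -
  have [measurable]: "diameter_disk a b \<in> sets borel" by (simp add: diameter_disk_def)
  define R where "R = 1 + \<bar>a + b\<bar> / 2 + \<bar>b - a\<bar> / 2"
  have R: "R > 0" unfolding R_def by (intro add_pos_nonneg) auto
  have "ennreal (1 / (pi * R\<^sup>2)) * emeasure lborel {x. \<phi> x \<in> diameter_disk a b}
      = (\<integral>\<^sup>+x. ennreal (1 / (pi * R\<^sup>2)) * indicator {x. \<phi> x \<in> diameter_disk a b} x \<partial>lborel)"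
    by (rule nn_integral_cmult_indicator[symmetric]) measurable
  also have "\<dots> \<le> kernel_mass 0 1" unfolding kernel_mass_def
  proof (rule nn_integral_mono_AE)
    show "AE x in lborel. ennreal (1 / (pi * R\<^sup>2)) * indicator {x. \<phi> x \<in> diameter_disk a b} x \<le> ennreal (ker (\<phi> x) 0 1)"
      using phi_Im_nonneg
    proof eventually_elim
      case (elim x)
      show ?case
      proof (cases "\<phi> x \<in> diameter_disk a b")
        case True
        define m where "m = complex_of_real ((a + b) / 2)"
        have "cmod (m - \<phi> x) < (b - a) / 2" using True by (simp add: diameter_disk_def m_def dist_norm)
        moreover have "cmod m = \<bar>a + b\<bar> / 2" by (simp add: m_def norm_divide flip: of_real_add)
        moreover have "cmod (Complex 0 (- 1) - \<phi> x) \<le> cmod (Complex 0 (- 1)) + cmod m + cmod (m - \<phi> x)"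
          using norm_triangle_ineq4[of "Complex 0 (- 1)" "\<phi> x"] norm_triangle_ineq2[of "\<phi> x" m]
          by (simp add: norm_minus_commute)
        moreover have "cmod (Complex 0 (- 1)) = 1" by (simp add: cmod_def)
        moreover have "(b - a) / 2 \<le> \<bar>b - a\<bar> / 2" by (intro divide_right_mono abs_ge_self) simp
        ultimately have "cmod (Complex 0 (- 1) - \<phi> x) \<le> R" unfolding R_def by (smt (verit))
        moreover have "Complex 0 (- 1) - \<phi> x \<noteq> 0" using elim by (auto simp: complex_eq_iff)
        ultimately have "1 / (pi * R\<^sup>2) \<le> ker (\<phi> x) 0 1"
          unfolding ker_def using R by (intro divide_left_mono mult_left_mono power_mono mult_pos_pos) auto
        then show ?thesis using True by (simp add: ennreal_leI)
      qed simp
    qed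
  qed
  also have "\<dots> \<le> 1" by (rule kernel_mass_le_1) simp
  finally have "ennreal (1 / (pi * R\<^sup>2)) * emeasure lborel {x. \<phi> x \<in> diameter_disk a b} \<le> 1" .
  then show ?thesis using R
    by (cases "emeasure lborel {x. \<phi> x \<in> diameter_disk a b}") (auto simp: ennreal_mult_top top_unique)
qed

text \<open>Covering \<open>(a, b)\<close> by \<open>N\<close> small disks, the non-real part of their union shrinks to the empty set
  inside the fixed disk \<open>D\<^sub>a\<^sub>b\<close>, whose preimage has finite measure.\<close>

lemma const_C_le_const_B: "const_C \<Phi> \<le> const_B \<Phi>"
  unfolding const_B_def
proof (rule INF_greatest, clarify)
  fix a b :: real assume ab: "a < b"
  note [measurable] = real_segment_borel[of a b]
  have disk [measurable]: "diameter_disk c d \<in> sets borel" for c d by (simp add: diameter_disk_def)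
  define X where "X = {x. \<phi> x \<in> complex_of_real ` {a<..<b}}"
  \<comment> \<open>Excluding \<open>Im (\<phi> x) = 0\<close> makes the intersection of the
    \<open>S n\<close> empty; the real points are counted in \<open>X\<close>.\<close>
  define S where "S n = {x. \<phi> x \<in> diameter_disk a b \<and> Im (\<phi> x) \<noteq> 0 \<and> \<bar>Im (\<phi> x)\<bar> < (b - a) * shift_seq n}" for n
  have [measurable]: "X \<in> sets borel" unfolding X_def by measurable
  have S_sets [measurable]: "S n \<in> sets borel" for n unfolding S_def by measurable
  have S_lim: "(\<lambda>n. emeasure lborel (S n)) \<longlonglongrightarrow> 0"
  proof -
    have "(\<lambda>n. emeasure lborel (S n)) \<longlonglongrightarrow> emeasure lborel (\<Inter>n. S n)"
    proof (rule Lim_emeasure_decseq)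
      show "decseq S"
      proof (rule decseq_SucI)
        fix n
        have "(b - a) * shift_seq (Suc n) \<le> (b - a) * shift_seq n"
          using ab by (intro mult_left_mono decseq_SucD[OF decseq_shift_seq]) auto
        then show "S (Suc n) \<subseteq> S n" unfolding S_def by force
      qed
      show "emeasure lborel (S n) \<noteq> \<infinity>" for n
      proof -
        have "emeasure lborel (S n) \<le> emeasure lborel {x. \<phi> x \<in> diameter_disk a b}"
          by (intro emeasure_mono) (auto simp: S_def)
        also note preimage_disk_finite
        finally show ?thesis by simp
      qed
    qed auto
    moreover have "(\<Inter>n. S n) = {}"
    proof -
      have False if x: "\<And>n. x \<in> S n" for x
      proof -
        have "\<bar>Im (\<phi> x)\<bar> / (b - a) > 0" using x[of 0] ab by (simp add: S_def)
        from shift_seq_less[OF this] obtain n where "shift_seq n < \<bar>Im (\<phi> x)\<bar> / (b - a)" by blast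
        then show False using x[of n] ab by (simp add: S_def field_simps)
      qed
      then show ?thesis by blast
    qed
    ultimately show ?thesis by simp
  qed
  have main: "const_C \<Phi> * ennreal (b - a) \<le> emeasure lborel X + emeasure lborel (S n)" for n
  proof -
    \<comment> \<open>\<open>Suc n\<close> adjacent disks of diameter \<open>\<delta>\<close> fill
      the interval exactly, so the lower bounds for their preimages add up to
      \<open>const_C \<Phi> * (b - a)\<close>.\<close>
    define \<delta> where "\<delta> = (b - a) * shift_seq n"
    have \<delta>: "\<delta> > 0" using ab by (simp add: \<delta>_def)
    have N\<delta>: "real (Suc n) * \<delta> = b - a" by (simp add: \<delta>_def shift_seq_def)
    define p where "p i = a + real i * \<delta>" for i :: nat
    define T where "T i = {x. \<phi> x \<in> diameter_disk (p i) (p (Suc i))}" for i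
    have p_diff: "p (Suc i) - p i = \<delta>" for i by (simp add: p_def algebra_simps)
    have [measurable]: "T i \<in> sets borel" for i unfolding T_def by measurable
    have p_ge: "a \<le> p i" for i using \<delta> by (simp add: p_def)
    have p_le: "p (Suc i) \<le> b" if "i < Suc n" for i
    proof -
      have "real (Suc i) * \<delta> \<le> real (Suc n) * \<delta>" using that \<delta> by (intro mult_right_mono) auto
      then show ?thesis using N\<delta> by (simp add: p_def)
    qed
    have C_le: "const_C \<Phi> * ennreal \<delta> \<le> emeasure lborel (T i)" for i
    proof -
      have lt: "p i < p (Suc i)" using p_diff[of i] \<delta> by linarith
      have "const_C \<Phi> * ennreal (p (Suc i) - p i) \<le> emeasure lborel (boundary_preimage \<Phi> (diameter_disk (p i) (p (Suc i))))"
        by (rule ennreal_le_divideD[OF const_C_upper[OF lt]]) (use lt in auto)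
      also have "\<dots> = emeasure lborel (T i)" unfolding T_def by (rule emeasure_boundary_preimage) measurable
      finally show ?thesis by (simp only: p_diff)
    qed
    \<comment> \<open>A common point would put the two centres at distance less than
      \<open>\<delta>\<close>, but distinct centres are at least \<open>\<delta>\<close>
      apart.\<close>
    have disj: "T i \<inter> T j = {}" if ij: "i < j" for i j
    proof -
      have False if x: "x \<in> T i" "x \<in> T j" for x
      proof -
        define m where "m k = (p k + p (Suc k)) / 2" for k
        have "dist (complex_of_real (m i)) (complex_of_real (m j)) < \<delta> / 2 + \<delta> / 2"
          using x dist_triangle2[of "complex_of_real (m i)" "complex_of_real (m j)" "\<phi> x"]
          unfolding T_def diameter_disk_def p_diff m_def by simp
        then have "\<bar>m i - m j\<bar> < \<delta>" by (simp add: dist_of_real dist_real_def)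
        moreover have "m j - m i = (real j - real i) * \<delta>" by (simp add: m_def p_def field_simps)
        moreover have "1 * \<delta> \<le> (real j - real i) * \<delta>" using ij \<delta> by (intro mult_right_mono) auto
        ultimately show False by linarith
      qed
      then show ?thesis by blast
    qed
    have "const_C \<Phi> * ennreal (b - a) = (\<Sum>i<Suc n. const_C \<Phi> * ennreal \<delta>)"
    proof -
      have "ennreal (b - a) = of_nat (Suc n) * ennreal \<delta>"
        unfolding N\<delta>[symmetric] using \<delta> by (simp add: ennreal_mult ennreal_of_nat_eq_real_of_nat)
      then show ?thesis by (simp add: mult_ac)
    qed
    also have "\<dots> \<le> (\<Sum>i<Suc n. emeasure lborel (T i))" by (rule sum_mono) (rule C_le)
    also have "\<dots> = emeasure lborel (\<Union>i<Suc n. T i)"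
    proof (rule sum_emeasure)
      show "disjoint_family_on T {..<Suc n}"
        unfolding disjoint_family_on_def using disj by (metis Int_commute linorder_neqE_nat)
    qed auto
    also have "\<dots> \<le> emeasure lborel (X \<union> S n)"
    proof (rule emeasure_mono)
      show "(\<Union>i<Suc n. T i) \<subseteq> X \<union> S n"
      proof
        fix x assume "x \<in> (\<Union>i<Suc n. T i)"
        then obtain i where i: "i < Suc n" "\<phi> x \<in> diameter_disk (p i) (p (Suc i))" by (auto simp: T_def)
        have ab_disk: "\<phi> x \<in> diameter_disk a b"
          using diameter_disk_subset[OF p_ge p_le[OF i(1)]] i(2) by blast
        have "\<bar>Im (\<phi> x)\<bar> < \<delta> / 2" using diameter_disk_Im[OF i(2)] by (simp add: p_diff)
        then have "\<bar>Im (\<phi> x)\<bar> < \<delta>" using \<delta> by linarith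
        then show "x \<in> X \<union> S n"
          using ab_disk diameter_disk_real[OF ab_disk] by (auto simp: X_def S_def \<delta>_def)
      qed
    qed auto
    also have "\<dots> \<le> emeasure lborel X + emeasure lborel (S n)" by (rule emeasure_subadditive) auto
    finally show ?thesis .
  qed
  have "const_C \<Phi> * ennreal (b - a) \<le> emeasure lborel X + 0"
  proof (rule LIMSEQ_le_const)
    show "(\<lambda>n. emeasure lborel X + emeasure lborel (S n)) \<longlonglongrightarrow> emeasure lborel X + 0"
      by (intro tendsto_add tendsto_const S_lim)
  qed (use main in blast)
  also have "emeasure lborel X + 0 = emeasure lborel (boundary_preimage \<Phi> (complex_of_real ` {a<..<b}))"
    unfolding X_def by (subst emeasure_boundary_preimage) auto
  finally show "const_C \<Phi> \<le> emeasure lborel (boundary_preimage \<Phi> (complex_of_real ` {a<..<b})) / ennreal (b - a)"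
    by (rule ennreal_le_divideI) (use ab in auto)
qed

end

section \<open>Lower bound for A\<close>

lemma hardy_norm_sq_positive:
  assumes "u \<in> hardy_nonzero"
  shows "hardy_norm_sq u \<noteq> 0" "hardy_norm_sq u \<noteq> \<top>"
proof -
  have u: "u \<in> hardy_space" using assms by (simp add: hardy_nonzero_def)
  then show "hardy_norm_sq u \<noteq> \<top>" by (auto simp: hardy_space_def)
  obtain z where z: "Im z > 0" "u z \<noteq> 0" using assms by (auto simp: hardy_nonzero_def)
  show "hardy_norm_sq u \<noteq> 0"
  proof
    assume "hardy_norm_sq u = 0"
    then have "(cmod (u z))\<^sup>2 \<le> 0" using hardy_space_pointwise_bound[OF u z(1)] by simp
    then show False using z(2) by simp
  qed
qed

text \<open>Young's inequality \<open>2 |p| |q| \<le> \<theta> |p|^2 + |q|^2 / \<theta>\<close>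
  replaces the triangle inequality, keeping everything in squared norms.\<close>

lemma line_norm_sq_add_le:
  assumes "f holomorphic_on upper_half_plane" "g holomorphic_on upper_half_plane" and y: "y > 0" and \<theta>: "\<theta> > 0"
  shows "line_norm_sq (\<lambda>z. f z + g z) y \<le> ennreal (1 + \<theta>) * line_norm_sq f y + ennreal (1 + 1 / \<theta>) * line_norm_sq g y"
proof -
  have [measurable]: "(\<lambda>x. f (Complex x y)) \<in> borel_measurable borel" "(\<lambda>x. g (Complex x y)) \<in> borel_measurable borel"
    using borel_measurable_line[OF assms(1) y] borel_measurable_line[OF assms(2) y] by simp_all
  have *: "(cmod (p + q))\<^sup>2 \<le> (1 + \<theta>) * (cmod p)\<^sup>2 + (1 + 1 / \<theta>) * (cmod q)\<^sup>2" for p q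
  proof -
    have "(cmod (p + q))\<^sup>2 \<le> (cmod p + cmod q)\<^sup>2" by (intro power_mono norm_triangle_ineq) auto
    also have "\<dots> = (cmod p)\<^sup>2 + (cmod q)\<^sup>2 + 2 * (sqrt \<theta> * cmod p) * (cmod q / sqrt \<theta>)"
      using \<theta> by (simp add: power2_sum)
    also have "2 * (sqrt \<theta> * cmod p) * (cmod q / sqrt \<theta>) \<le> (sqrt \<theta> * cmod p)\<^sup>2 + (cmod q / sqrt \<theta>)\<^sup>2"
      by (rule sum_squares_bound)
    also have "\<dots> = \<theta> * (cmod p)\<^sup>2 + 1 / \<theta> * (cmod q)\<^sup>2"
      using \<theta> by (simp add: power_mult_distrib power_divide)
    finally show ?thesis by (simp add: algebra_simps)
  qed
  have "line_norm_sq (\<lambda>z. f z + g z) y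
      \<le> (\<integral>\<^sup>+x. ennreal (1 + \<theta>) * ennreal ((cmod (f (Complex x y)))\<^sup>2) + ennreal (1 + 1 / \<theta>) * ennreal ((cmod (g (Complex x y)))\<^sup>2) \<partial>lborel)"
    unfolding line_norm_sq_def
  proof (rule nn_integral_mono)
    fix x
    have "ennreal ((cmod (f (Complex x y) + g (Complex x y)))\<^sup>2)
        \<le> ennreal ((1 + \<theta>) * (cmod (f (Complex x y)))\<^sup>2 + (1 + 1 / \<theta>) * (cmod (g (Complex x y)))\<^sup>2)"
      by (rule ennreal_leI[OF *])
    also have "\<dots> = ennreal (1 + \<theta>) * ennreal ((cmod (f (Complex x y)))\<^sup>2) + ennreal (1 + 1 / \<theta>) * ennreal ((cmod (g (Complex x y)))\<^sup>2)"
      using \<theta> by (subst ennreal_plus) (simp_all add: ennreal_mult)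
    finally show "ennreal ((cmod (f (Complex x y) + g (Complex x y)))\<^sup>2)
        \<le> ennreal (1 + \<theta>) * ennreal ((cmod (f (Complex x y)))\<^sup>2) + ennreal (1 + 1 / \<theta>) * ennreal ((cmod (g (Complex x y)))\<^sup>2)" .
  qed
  also have "\<dots> = ennreal (1 + \<theta>) * line_norm_sq f y + ennreal (1 + 1 / \<theta>) * line_norm_sq g y"
    unfolding line_norm_sq_def by (subst nn_integral_add) (simp_all add: nn_integral_cmult)
  finally show ?thesis .
qed

context nevanlinna
begin

lemma holomorphic_comp_Phi:
  assumes "u holomorphic_on upper_half_plane"
  shows "(u \<circ> \<Phi>) holomorphic_on upper_half_plane"
  by (rule holomorphic_on_compose_gen[OF hol_Phi assms]) (auto intro: Im_Phi_pos)

text \<open>For \<open>s > 0\<close> the translate is continuous at \<open>\<phi> x\<close> even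
  when that value is real, so Fatou's lemma along the lines at heights \<open>shift_seq n\<close>
  applies.\<close>

lemma boundary_integral_le:
  assumes u: "u \<in> hardy_space" and s: "s > 0"
  shows "(\<integral>\<^sup>+x. ennreal ((cmod (shift_up s u (\<phi> x)))\<^sup>2) \<partial>lborel) \<le> hardy_norm_sq (shift_up s u \<circ> \<Phi>)"
proof -
  note hol = hardy_space_holomorphic[OF u]
  let ?v = "shift_up s u"
  have holv: "?v holomorphic_on upper_half_plane" using holomorphic_shift_up[OF hol] s by simp
  have meas: "(\<lambda>x. ennreal ((cmod (?v (\<Phi> (Complex x (shift_seq n)))))\<^sup>2)) \<in> borel_measurable lborel" for n
    using borel_measurable_line[OF holomorphic_comp_Phi[OF holv] shift_seq_pos[of n]] by simp
  have "(\<integral>\<^sup>+x. ennreal ((cmod (?v (\<phi> x)))\<^sup>2) \<partial>lborel)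
      = (\<integral>\<^sup>+x. liminf (\<lambda>n. ennreal ((cmod (?v (\<Phi> (Complex x (shift_seq n)))))\<^sup>2)) \<partial>lborel)"
  proof (rule nn_integral_cong_AE)
    show "AE x in lborel. ennreal ((cmod (?v (\<phi> x)))\<^sup>2) = liminf (\<lambda>n. ennreal ((cmod (?v (\<Phi> (Complex x (shift_seq n)))))\<^sup>2))"
      using phi_boundary phi_Im_nonneg
    proof eventually_elim
      case (elim x)
      have "Im (\<phi> x + \<i> * complex_of_real s) > 0" using elim(2) s by simp
      then have "isCont u (\<phi> x + \<i> * complex_of_real s)"
        using holomorphic_on_imp_continuous_on[OF hol] open_upper_half_plane
        by (simp add: continuous_on_eq_continuous_at)
      moreover have "(\<lambda>n. \<Phi> (Complex x (shift_seq n)) + \<i> * complex_of_real s) \<longlonglongrightarrow> \<phi> x + \<i> * complex_of_real s"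
        by (intro tendsto_add tendsto_const has_boundary_value_imp_LIMSEQ elim)
      ultimately have "(\<lambda>n. ?v (\<Phi> (Complex x (shift_seq n)))) \<longlonglongrightarrow> ?v (\<phi> x)"
        unfolding shift_up_def by (rule isCont_tendsto_compose)
      then have "(\<lambda>n. ennreal ((cmod (?v (\<Phi> (Complex x (shift_seq n)))))\<^sup>2)) \<longlonglongrightarrow> ennreal ((cmod (?v (\<phi> x)))\<^sup>2)"
        by (intro tendsto_intros)
      from lim_imp_Liminf[OF trivial_limit_sequentially this] show ?case by (rule sym)
    qed
  qed
  also have "\<dots> \<le> liminf (\<lambda>n. \<integral>\<^sup>+x. ennreal ((cmod (?v (\<Phi> (Complex x (shift_seq n)))))\<^sup>2) \<partial>lborel)"
    by (rule nn_integral_liminf[OF meas])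
  also have "\<dots> = liminf (\<lambda>n. line_norm_sq (?v \<circ> \<Phi>) (shift_seq n))"
    by (simp add: line_norm_sq_def)
  also have "\<dots> \<le> limsup (\<lambda>n. line_norm_sq (?v \<circ> \<Phi>) (shift_seq n))"
    by (rule Liminf_le_Limsup) simp
  also have "\<dots> \<le> hardy_norm_sq (?v \<circ> \<Phi>)"
    by (rule Limsup_bounded) (simp add: line_norm_sq_le_hardy)
  finally show ?thesis .
qed

text \<open>Only the points where \<open>\<phi>\<close> is real and in a bounded interval are kept;
  there the pushforward formula brings in the density \<open>sing_mass \<ge> c\<close>. The
  intervals then exhaust the line.\<close>

lemma norm_lower_bound_shift:
  assumes u: "u \<in> hardy_space" and s: "s > 0" and c: "\<And>t. c \<le> sing_mass t"
  shows "c * line_norm_sq u s \<le> hardy_norm_sq (shift_up s u \<circ> \<Phi>)"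
proof -
  note hol = hardy_space_holomorphic[OF u]
  define f where "f t = (cmod (u (Complex t s)))\<^sup>2" for t
  have f: "continuous_on UNIV f" "\<And>t. f t \<ge> 0"
    unfolding f_def by (auto intro!: continuous_intros continuous_on_line[OF hol s])
  have [measurable]: "f \<in> borel_measurable borel" using f(1) by (rule borel_measurable_continuous_onI)
  let ?I = "\<lambda>n. {- real (Suc n)<..<real (Suc n)}"
  have le: "c * (\<integral>\<^sup>+t. ennreal (f t * indicator (?I n) t) \<partial>lborel) \<le> hardy_norm_sq (shift_up s u \<circ> \<Phi>)" for n
  proof -
    have "c * (\<integral>\<^sup>+t. ennreal (f t * indicator (?I n) t) \<partial>lborel) = (\<integral>\<^sup>+t. c * ennreal (f t * indicator (?I n) t) \<partial>lborel)"
      by (rule nn_integral_cmult[symmetric]) measurable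
    also have "\<dots> \<le> (\<integral>\<^sup>+t. ennreal (f t * indicator (?I n) t) * sing_mass t \<partial>lborel)"
      by (intro nn_integral_mono) (simp add: mult.commute[of c] mult_left_mono c)
    also have "\<dots> = (\<integral>\<^sup>+x. ennreal (f (Re (\<phi> x))) * indicator (complex_of_real ` ?I n) (\<phi> x) \<partial>lborel)"
      by (rule sing_mass_pushforward[OF f]) simp
    also have "\<dots> \<le> (\<integral>\<^sup>+x. ennreal ((cmod (shift_up s u (\<phi> x)))\<^sup>2) \<partial>lborel)"
    proof (rule nn_integral_mono)
      fix x
      show "ennreal (f (Re (\<phi> x))) * indicator (complex_of_real ` ?I n) (\<phi> x) \<le> ennreal ((cmod (shift_up s u (\<phi> x)))\<^sup>2)"
      proof (cases "\<phi> x \<in> complex_of_real ` ?I n")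
        case True
        then have "\<phi> x = Complex (Re (\<phi> x)) 0" by (auto simp: complex_eq_iff)
        then have "shift_up s u (\<phi> x) = u (Complex (Re (\<phi> x)) s)"
          by (metis shift_up_Complex add_0)
        then show ?thesis using True by (simp add: f_def)
      qed simp
    qed
    also have "\<dots> \<le> hardy_norm_sq (shift_up s u \<circ> \<Phi>)" by (rule boundary_integral_le[OF u s])
    finally show ?thesis .
  qed
  have "(\<lambda>n. \<integral>\<^sup>+t. ennreal (f t * indicator (?I n) t) \<partial>lborel) \<longlonglongrightarrow> (\<integral>\<^sup>+t. ennreal (f t) \<partial>lborel)"
  proof (rule nn_integral_LIMSEQ)
    show "incseq (\<lambda>n t. ennreal (f t * indicator (?I n) t))"
      using f(2) by (intro incseq_SucI le_funI ennreal_leI mult_left_mono) (auto split: split_indicator)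
    fix t
    obtain N :: nat where N: "\<bar>t\<bar> < real N" using reals_Archimedean2 by blast
    have "\<forall>\<^sub>F n in sequentially. ennreal (f t * indicator (?I n) t) = ennreal (f t)"
      using eventually_ge_at_top[of N]
    proof eventually_elim
      case (elim n)
      then have "real N \<le> real n" by simp
      then have "t \<in> ?I n" using N unfolding abs_less_iff by auto
      then show ?case by simp
    qed
    then show "(\<lambda>n. ennreal (f t * indicator (?I n) t)) \<longlonglongrightarrow> ennreal (f t)" by (rule tendsto_eventually)
  qed measurable
  then have "(\<lambda>n. \<integral>\<^sup>+t. ennreal (f t * indicator (?I n) t) \<partial>lborel) \<longlonglongrightarrow> line_norm_sq u s"
    by (simp add: f_def line_norm_sq_def)
  moreover have "c \<noteq> \<top>" using order_trans[OF c[of 0] sing_mass_le_1[of 0]] by (auto simp: top_unique)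
  ultimately have "(\<lambda>n. c * (\<integral>\<^sup>+t. ennreal (f t * indicator (?I n) t) \<partial>lborel)) \<longlonglongrightarrow> c * line_norm_sq u s"
    by (intro ennreal_tendsto_cmult) (auto simp: less_top)
  then show ?thesis by (rule LIMSEQ_le_const2) (use le in blast)
qed

text \<open>The composition of a translate of \<open>u\<close> with \<open>\<Phi>\<close> is not a
  translate of the composition. It is instead split as \<open>u \<circ> \<Phi>\<close> plus
  \<open>h n \<circ> \<Phi>\<close>, and contractivity bounds the second term by the norm of
  \<open>h n\<close>, which tends to 0. The loss \<open>1 + \<theta>\<close> from Young's inequality
  is removed last.\<close>

lemma norm_lower_bound:
  assumes u: "u \<in> hardy_space" and c: "\<And>t. c \<le> sing_mass t"
  shows "c * hardy_norm_sq u \<le> hardy_norm_sq (u \<circ> \<Phi>)"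
proof -
  note hol = hardy_space_holomorphic[OF u]
  define X where "X = hardy_norm_sq (u \<circ> \<Phi>)"
  have "hardy_norm_sq u < \<infinity>" using u by (simp add: hardy_space_def)
  with hardy_contraction[OF u] have Xfin: "X < \<infinity>" unfolding X_def by (rule le_less_trans)
  have cfin: "c \<noteq> \<top>" using order_trans[OF c[of 0] sing_mass_le_1[of 0]] by (auto simp: top_unique)
  have \<theta>: "c * hardy_norm_sq u \<le> ennreal (1 + \<theta>) * X" if \<theta>: "\<theta> > 0" for \<theta> :: real
  proof -
    define h where "h n = (\<lambda>z. shift_up (shift_seq n) u z - u z)" for n
    have h: "h n \<in> hardy_space" for n
      unfolding h_def by (intro hardy_space_diff_add hardy_space_shift_up u) simp
    have le: "c * line_norm_sq u (shift_seq n) \<le> ennreal (1 + \<theta>) * X + ennreal (1 + 1 / \<theta>) * hardy_norm_sq (h n)" for n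
    proof -
      have "c * line_norm_sq u (shift_seq n) \<le> hardy_norm_sq (shift_up (shift_seq n) u \<circ> \<Phi>)"
        by (rule norm_lower_bound_shift[OF u shift_seq_pos c])
      also have "shift_up (shift_seq n) u \<circ> \<Phi> = (\<lambda>z. (u \<circ> \<Phi>) z + (h n \<circ> \<Phi>) z)"
        by (simp add: fun_eq_iff h_def)
      also have "hardy_norm_sq \<dots> \<le> ennreal (1 + \<theta>) * X + ennreal (1 + 1 / \<theta>) * hardy_norm_sq (h n)"
      proof (rule hardy_norm_sq_le)
        fix y :: real assume y: "y > 0"
        have "line_norm_sq (\<lambda>z. (u \<circ> \<Phi>) z + (h n \<circ> \<Phi>) z) y
            \<le> ennreal (1 + \<theta>) * line_norm_sq (u \<circ> \<Phi>) y + ennreal (1 + 1 / \<theta>) * line_norm_sq (h n \<circ> \<Phi>) y"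
          by (rule line_norm_sq_add_le[OF holomorphic_comp_Phi[OF hol]
                holomorphic_comp_Phi[OF hardy_space_holomorphic[OF h]] y \<theta>])
        also have "\<dots> \<le> ennreal (1 + \<theta>) * X + ennreal (1 + 1 / \<theta>) * hardy_norm_sq (h n)"
        proof (intro add_mono mult_left_mono)
          show "line_norm_sq (u \<circ> \<Phi>) y \<le> X" unfolding X_def by (rule line_norm_sq_le_hardy[OF y])
          show "line_norm_sq (h n \<circ> \<Phi>) y \<le> hardy_norm_sq (h n)"
            by (rule order_trans[OF line_norm_sq_le_hardy[OF y] hardy_contraction[OF h]])
        qed simp_all
        finally show "line_norm_sq (\<lambda>z. (u \<circ> \<Phi>) z + (h n \<circ> \<Phi>) z) y
            \<le> ennreal (1 + \<theta>) * X + ennreal (1 + 1 / \<theta>) * hardy_norm_sq (h n)" .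
      qed
      finally show ?thesis .
    qed
    have "(\<lambda>n. ennreal (1 + \<theta>) * X + ennreal (1 + 1 / \<theta>) * hardy_norm_sq (h n))
        \<longlonglongrightarrow> ennreal (1 + \<theta>) * X + ennreal (1 + 1 / \<theta>) * 0"
      unfolding h_def by (intro tendsto_add tendsto_const ennreal_tendsto_cmult hardy_shift_continuous[OF u]) simp
    moreover have "(\<lambda>n. c * line_norm_sq u (shift_seq n)) \<longlonglongrightarrow> c * hardy_norm_sq u"
      using cfin by (intro ennreal_tendsto_cmult hardy_norm_sq_LIMSEQ[OF u]) (simp add: less_top)
    ultimately have "c * hardy_norm_sq u \<le> ennreal (1 + \<theta>) * X + ennreal (1 + 1 / \<theta>) * 0"
      using le by (intro LIMSEQ_le) auto
    then show ?thesis by simp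
  qed
  have "(\<lambda>n. X * ennreal (1 + shift_seq n)) \<longlonglongrightarrow> X * ennreal (1 + 0)"
    using Xfin by (intro ennreal_tendsto_cmult tendsto_ennrealI tendsto_intros shift_seq_tendsto) auto
  then have "c * hardy_norm_sq u \<le> X * ennreal (1 + 0)"
  proof (rule LIMSEQ_le_const)
    show "\<exists>N. \<forall>n\<ge>N. c * hardy_norm_sq u \<le> X * ennreal (1 + shift_seq n)"
      using \<theta>[OF shift_seq_pos] by (simp add: mult.commute)
  qed
  then show ?thesis by (simp add: X_def)
qed

lemma sing_le_const_A:
  assumes "\<And>t. c \<le> sing_mass t"
  shows "c \<le> const_A \<Phi>"
  unfolding const_A_def
proof (rule INF_greatest)
  fix u assume u: "u \<in> hardy_nonzero"
  then have "u \<in> hardy_space" by (simp add: hardy_nonzero_def)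
  from norm_lower_bound[OF this assms] show "c \<le> hardy_norm_sq (u \<circ> \<Phi>) / hardy_norm_sq u"
    by (rule ennreal_le_divideI) (use hardy_norm_sq_positive[OF u] in auto)
qed

theorem constants_eq:
  "const_A \<Phi> = (INF t. sing_mass t)" "const_B \<Phi> = (INF t. sing_mass t)" "const_C \<Phi> = (INF t. sing_mass t)"
proof -
  have inf: "(INF t. sing_mass t) \<le> sing_mass s" for s by (rule INF_lower) simp
  show "const_A \<Phi> = (INF t. sing_mass t)"
    by (intro antisym INF_greatest const_A_le_sing_mass sing_le_const_A inf)
  show B: "const_B \<Phi> = (INF t. sing_mass t)"
    by (intro antisym INF_greatest const_B_le_sing_mass sing_le_const_B inf)
  show "const_C \<Phi> = (INF t. sing_mass t)"
    unfolding B[symmetric] by (intro antisym const_C_le_const_B const_B_le_const_C)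
qed

end

section \<open>Cauchy transforms and Lebesgue decompositions\<close>

lemma inverse_diff_bound:
  assumes "Im z > 0"
  shows "cmod (1 / (complex_of_real t - z)) \<le> 1 / Im z"
proof -
  have "Im z \<le> \<bar>Im (complex_of_real t - z)\<bar>" by simp
  also have "\<dots> \<le> cmod (complex_of_real t - z)" by (rule abs_Im_le_cmod)
  finally show ?thesis using assms by (simp add: norm_divide frac_le)
qed

lemma Im_inverse_diff: "Im (1 / (complex_of_real t - z)) = pi * poisson z t"
  by (simp add: Im_divide poisson_def cmod_power2)

locale finite_real_measure = finite_measure \<mu> for \<mu> :: "real measure" +
  assumes sets_borel [measurable_cong]: "sets \<mu> = sets borel"
begin

lemma space_UNIV: "space \<mu> = UNIV"
  using sets_eq_imp_space_eq[OF sets_borel] by simp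

definition cauchy_transform :: "complex \<Rightarrow> complex" where
  "cauchy_transform z = (LINT t|\<mu>. 1 / (complex_of_real t - z))"

lemma cauchy_kernel_integrable:
  "Im z > 0 \<Longrightarrow> integrable \<mu> (\<lambda>t. 1 / (complex_of_real t - z))"
  by (rule integrable_const_bound[where B = "1 / Im z"]) (auto intro: inverse_diff_bound)

lemma cauchy_transform_bound: "Im z > 0 \<Longrightarrow> cmod (cauchy_transform z) \<le> measure \<mu> (space \<mu>) / Im z"
proof -
  assume z: "Im z > 0"
  have "cmod (cauchy_transform z) \<le> (LINT t|\<mu>. cmod (1 / (complex_of_real t - z)))"
    unfolding cauchy_transform_def by (rule integral_norm_bound)
  also have "\<dots> \<le> (LINT t|\<mu>. 1 / Im z)"
    by (intro integral_mono integrable_norm cauchy_kernel_integrable z inverse_diff_bound) simp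
  finally show ?thesis by simp
qed

lemma cauchy_transform_Im_integral:
  assumes z: "Im z > 0"
  shows "(\<integral>\<^sup>+t. ennreal (poisson z t) \<partial>\<mu>) = ennreal (Im (cauchy_transform z) / pi)"
proof -
  have int: "integrable \<mu> (\<lambda>t. Im (1 / (complex_of_real t - z)))"
    by (intro integrable_Im cauchy_kernel_integrable z)
  have Im: "Im (cauchy_transform z) = (LINT t|\<mu>. pi * poisson z t)"
    unfolding cauchy_transform_def by (subst integral_Im[OF cauchy_kernel_integrable[OF z], symmetric]) (simp only: Im_inverse_diff)
  have "integrable \<mu> (poisson z)"
    using int unfolding Im_inverse_diff by simp
  then have "(\<integral>\<^sup>+t. ennreal (poisson z t) \<partial>\<mu>) = ennreal (LINT t|\<mu>. poisson z t)"
    using z by (intro nn_integral_eq_integral) (auto simp: poisson_nonneg)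
  then show ?thesis unfolding Im by simp
qed

lemma holomorphic_cauchy_transform: "cauchy_transform holomorphic_on upper_half_plane"
proof -
  have "(cauchy_transform has_field_derivative (LINT t|\<mu>. (1 / (complex_of_real t - z))\<^sup>2)) (at z)" if z: "Im z > 0" for z
    unfolding DERIV_def tendsto_at_iff_sequentially
  proof (intro allI impI)
    fix h :: "nat \<Rightarrow> complex" assume h0: "\<forall>i. h i \<in> UNIV - {0}" and hlim: "h \<longlonglongrightarrow> 0"
    have "\<forall>\<^sub>F n in sequentially. dist (h n) 0 < Im z / 2" by (rule tendstoD[OF hlim]) (use z in simp)
    then obtain N where N: "\<And>n. n \<ge> N \<Longrightarrow> cmod (h n) < Im z / 2" by (auto simp: eventually_sequentially)
    \<comment> \<open>Dropping \<open>N\<close> terms keeps \<open>z + k n\<close> above half the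
      height of \<open>z\<close>, which gives the constant majorant
      \<open>2 / Im z * (1 / Im z)\<close> for the difference quotients.\<close>
    define k where "k n = h (n + N)" for n
    have k: "cmod (k n) < Im z / 2" "k n \<noteq> 0" for n using N[of "n + N"] h0 by (auto simp: k_def)
    have klim: "k \<longlonglongrightarrow> 0" unfolding k_def using hlim by (rule LIMSEQ_ignore_initial_segment)
    have Imk: "Im (z + k n) > Im z / 2" for n
      using abs_Im_le_cmod[of "k n"] k(1)[of n] by simp
    have Imk0: "Im (z + k n) > 0" for n using Imk[of n] z by simp
    have quot: "(cauchy_transform (z + k n) - cauchy_transform z) / k n
        = (LINT t|\<mu>. 1 / (complex_of_real t - (z + k n)) * (1 / (complex_of_real t - z)))" for n
    proof -
      have ptw: "(1 / (complex_of_real t - (z + k n)) - 1 / (complex_of_real t - z)) / k n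
          = 1 / (complex_of_real t - (z + k n)) * (1 / (complex_of_real t - z))" for t
      proof -
        have "complex_of_real t - (z + k n) \<noteq> 0" "complex_of_real t - z \<noteq> 0"
          using Imk0[of n] z by (auto simp: complex_eq_iff)
        then have "1 / (complex_of_real t - (z + k n)) - 1 / (complex_of_real t - z)
            = k n / ((complex_of_real t - (z + k n)) * (complex_of_real t - z))"
          by (subst diff_frac_eq) auto
        then show ?thesis using k(2)[of n] by simp
      qed
      show ?thesis
        unfolding cauchy_transform_def ptw[symmetric]
        using cauchy_kernel_integrable[OF z] cauchy_kernel_integrable[OF Imk0[of n]] by simp
    qed
    have "(\<lambda>n. LINT t|\<mu>. 1 / (complex_of_real t - (z + k n)) * (1 / (complex_of_real t - z)))
        \<longlonglongrightarrow> (LINT t|\<mu>. (1 / (complex_of_real t - z))\<^sup>2)"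
    proof (rule integral_dominated_convergence[where w = "\<lambda>_. 2 / Im z * (1 / Im z)"])
      show "AE t in \<mu>. (\<lambda>n. 1 / (complex_of_real t - (z + k n)) * (1 / (complex_of_real t - z))) \<longlonglongrightarrow> (1 / (complex_of_real t - z))\<^sup>2"
      proof (rule AE_I2)
        fix t
        have "complex_of_real t - z \<noteq> 0" using z by (auto simp: complex_eq_iff)
        then have "(\<lambda>n. 1 / (complex_of_real t - (z + k n)) * (1 / (complex_of_real t - z)))
            \<longlonglongrightarrow> 1 / (complex_of_real t - (z + 0)) * (1 / (complex_of_real t - z))"
          by (intro tendsto_intros klim) simp
        then show "(\<lambda>n. 1 / (complex_of_real t - (z + k n)) * (1 / (complex_of_real t - z))) \<longlonglongrightarrow> (1 / (complex_of_real t - z))\<^sup>2"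
          by (simp add: power2_eq_square)
      qed
      show "AE t in \<mu>. norm (1 / (complex_of_real t - (z + k n)) * (1 / (complex_of_real t - z))) \<le> 2 / Im z * (1 / Im z)" for n
      proof (rule AE_I2)
        fix t
        have "cmod (1 / (complex_of_real t - (z + k n))) \<le> 1 / Im (z + k n)" by (rule inverse_diff_bound[OF Imk0])
        also have "\<dots> \<le> 1 / (Im z / 2)" using Imk[of n] z by (intro divide_left_mono) auto
        finally have "cmod (1 / (complex_of_real t - (z + k n))) \<le> 2 / Im z" by simp
        then show "norm (1 / (complex_of_real t - (z + k n)) * (1 / (complex_of_real t - z))) \<le> 2 / Im z * (1 / Im z)"
          unfolding norm_mult using inverse_diff_bound[OF z, of t] z by (intro mult_mono) auto
      qed
    qed auto
    then have "(\<lambda>n. (cauchy_transform (z + k n) - cauchy_transform z) / k n) \<longlonglongrightarrow> (LINT t|\<mu>. (1 / (complex_of_real t - z))\<^sup>2)"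
      unfolding quot .
    then have "(\<lambda>n. (cauchy_transform (z + h (n + N)) - cauchy_transform z) / h (n + N)) \<longlonglongrightarrow> (LINT t|\<mu>. (1 / (complex_of_real t - z))\<^sup>2)"
      unfolding k_def .
    then show "((\<lambda>h. (cauchy_transform (z + h) - cauchy_transform z) / h) \<circ> h) \<longlonglongrightarrow> (LINT t|\<mu>. (1 / (complex_of_real t - z))\<^sup>2)"
      unfolding comp_def by (rule LIMSEQ_offset)
  qed
  note deriv = this
  show ?thesis
    unfolding holomorphic_on_open[OF open_upper_half_plane] by (intro ballI exI, rule deriv) simp
qed

lemma poisson_swap:
  fixes F :: "real \<Rightarrow> ennreal"
  assumes [measurable]: "F \<in> borel_measurable borel" and y: "y > 0"
  shows "(\<integral>\<^sup>+x. F x * (\<integral>\<^sup>+t. ennreal (poisson (Complex x y) t) \<partial>\<mu>) \<partial>lborel)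
    = (\<integral>\<^sup>+t. (\<integral>\<^sup>+x. F x * ennreal (poisson (Complex t y) x) \<partial>lborel) \<partial>\<mu>)"
proof -
  interpret pair_sigma_finite lborel \<mu> ..
  have "(\<integral>\<^sup>+x. F x * (\<integral>\<^sup>+t. ennreal (poisson (Complex x y) t) \<partial>\<mu>) \<partial>lborel)
      = (\<integral>\<^sup>+x. (\<integral>\<^sup>+t. F x * ennreal (poisson (Complex x y) t) \<partial>\<mu>) \<partial>lborel)"
    by (intro nn_integral_cong nn_integral_cmult[symmetric]) measurable
  also have "\<dots> = (\<integral>\<^sup>+t. (\<integral>\<^sup>+x. F x * ennreal (poisson (Complex x y) t) \<partial>lborel) \<partial>\<mu>)"
    by (rule Fubini'[symmetric]) measurable
  finally show ?thesis by (subst (2) poisson_commute)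
qed

text \<open>Exchanging the integrals moves the Poisson kernel onto the test function
  \<open>F\<close>, where it is an approximate identity.\<close>

lemma stieltjes_inversion:
  assumes F: "\<And>x. isCont F x" "\<And>x. 0 \<le> F x" "\<And>x. F x \<le> M"
  shows "(\<lambda>n. \<integral>\<^sup>+x. ennreal (F x) * (\<integral>\<^sup>+t. ennreal (poisson (Complex x (shift_seq n)) t) \<partial>\<mu>) \<partial>lborel)
    \<longlonglongrightarrow> (\<integral>\<^sup>+t. ennreal (F t) \<partial>\<mu>)"
proof -
  have [measurable]: "F \<in> borel_measurable borel"
    using F(1) by (intro borel_measurable_continuous_onI continuous_at_imp_continuous_on) auto
  have inner: "(\<integral>\<^sup>+x. ennreal (F x) * ennreal (poisson (Complex t (shift_seq n)) x) \<partial>lborel)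
      = ennreal (LINT x|lborel. poisson (Complex t (shift_seq n)) x * F x)" for n t
  proof -
    have "integrable lborel (\<lambda>x. poisson (Complex t (shift_seq n)) x *\<^sub>R F x)"
      by (rule poisson_integrable_mult[where M = M]) (use F in auto)
    then show ?thesis
      using F(2) by (subst nn_integral_eq_integral[symmetric])
        (auto simp: poisson_nonneg mult.commute ennreal_mult intro!: nn_integral_cong)
  qed
  have bound: "(\<integral>\<^sup>+x. ennreal (F x) * ennreal (poisson (Complex t (shift_seq n)) x) \<partial>lborel) \<le> ennreal M" for n t
  proof -
    have "(\<integral>\<^sup>+x. ennreal (F x) * ennreal (poisson (Complex t (shift_seq n)) x) \<partial>lborel)
        \<le> (\<integral>\<^sup>+x. ennreal M * ennreal (poisson (Complex t (shift_seq n)) x) \<partial>lborel)"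
      by (intro nn_integral_mono mult_right_mono ennreal_leI F) simp
    also have "\<dots> = ennreal M" by (subst nn_integral_cmult) (auto simp: poisson_nn_integral)
    finally show ?thesis .
  qed
  have "(\<lambda>n. \<integral>\<^sup>+t. (\<integral>\<^sup>+x. ennreal (F x) * ennreal (poisson (Complex t (shift_seq n)) x) \<partial>lborel) \<partial>\<mu>)
      \<longlonglongrightarrow> (\<integral>\<^sup>+t. ennreal (F t) \<partial>\<mu>)"
  proof (rule nn_integral_dominated_convergence[where w = "\<lambda>_. ennreal M"])
    show "AE t in \<mu>. (\<lambda>n. \<integral>\<^sup>+x. ennreal (F x) * ennreal (poisson (Complex t (shift_seq n)) x) \<partial>lborel) \<longlonglongrightarrow> ennreal (F t)"
    proof (rule AE_I2)
      fix t
      have "(\<lambda>n. LINT x|lborel. poisson (Complex t (shift_seq n)) x * F x) \<longlonglongrightarrow> F t"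
        by (rule poisson_approx_identity[where M = M]) (use F shift_seq_tendsto in auto)
      then show "(\<lambda>n. \<integral>\<^sup>+x. ennreal (F x) * ennreal (poisson (Complex t (shift_seq n)) x) \<partial>lborel) \<longlonglongrightarrow> ennreal (F t)"
        unfolding inner by (rule tendsto_ennrealI)
    qed
    show "(\<integral>\<^sup>+t. ennreal M \<partial>\<mu>) < \<infinity>"
      by (simp add: emeasure_eq_measure ennreal_mult_less_top)
  qed (use bound in auto)
  then show ?thesis by (subst poisson_swap) auto
qed

end

text \<open>The imaginary part of the Cauchy transform is a Poisson integral, from which inversion
  recovers the integrals of bounded continuous functions. Those of cosine and sine give the
  characteristic function, which determines the measure.\<close>

lemma prob_space_eq_if_cauchy_transform_eq:
  fixes \<mu> \<nu> :: "real measure"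
  assumes \<mu>: "prob_space \<mu>" "sets \<mu> = sets borel" and \<nu>: "prob_space \<nu>" "sets \<nu> = sets borel"
    and eq: "\<And>z. Im z > 0 \<Longrightarrow> (LINT t|\<mu>. 1 / (complex_of_real t - z)) = (LINT t|\<nu>. 1 / (complex_of_real t - z))"
  shows "\<mu> = \<nu>"
proof -
  interpret \<mu>: prob_space \<mu> by (rule \<mu>)
  interpret \<nu>: prob_space \<nu> by (rule \<nu>)
  interpret m: finite_real_measure \<mu> by standard (rule \<mu>(2))
  interpret n: finite_real_measure \<nu> by standard (rule \<nu>(2))
  interpret rm: real_distribution \<mu> by standard (rule \<mu>(2))
  interpret rn: real_distribution \<nu> by standard (rule \<nu>(2))
  have P: "(\<integral>\<^sup>+t. ennreal (poisson z t) \<partial>\<mu>) = (\<integral>\<^sup>+t. ennreal (poisson z t) \<partial>\<nu>)" if "Im z > 0" for z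
    using eq[OF that] by (simp add: m.cauchy_transform_Im_integral[OF that] n.cauchy_transform_Im_integral[OF that]
        m.cauchy_transform_def n.cauchy_transform_def)
  have nn: "(\<integral>\<^sup>+t. ennreal (F t) \<partial>\<mu>) = (\<integral>\<^sup>+t. ennreal (F t) \<partial>\<nu>)"
    if F: "\<And>x. isCont F x" "\<And>x. 0 \<le> F x" "\<And>x. F x \<le> M" for F M
    using m.stieltjes_inversion[of F M, OF F] n.stieltjes_inversion[of F M, OF F] P
    by (simp add: LIMSEQ_unique)
  have int: "(LINT t|\<mu>. F t) = (LINT t|\<nu>. F t)" if F: "\<And>x. isCont F x" "\<And>x. \<bar>F x\<bar> \<le> 1" for F :: "real \<Rightarrow> real"
  proof -
    have [measurable]: "F \<in> borel_measurable borel"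
      using F(1) by (intro borel_measurable_continuous_onI continuous_at_imp_continuous_on) auto
    \<comment> \<open>Inversion was stated for non-negative functions; adding 1 is harmless since
      both measures have mass 1.\<close>
    have pos: "0 \<le> 1 + F x" "1 + F x \<le> 2" for x using F(2)[of x] by linarith+
    have i: "integrable \<mu> F" "integrable \<nu> F"
      using F(2) by (auto intro: \<mu>.integrable_const_bound[where B = 1] \<nu>.integrable_const_bound[where B = 1])
    have "(\<integral>\<^sup>+t. ennreal (1 + F t) \<partial>\<mu>) = (\<integral>\<^sup>+t. ennreal (1 + F t) \<partial>\<nu>)"
      by (rule nn[of "\<lambda>t. 1 + F t" 2]) (use F(1) pos in \<open>auto intro!: continuous_intros\<close>)
    then have "(LINT t|\<mu>. 1 + F t) = (LINT t|\<nu>. 1 + F t)"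
      using pos by (simp add: integral_eq_nn_integral)
    then show ?thesis using i \<mu>.prob_space \<nu>.prob_space by (simp add: m.space_UNIV n.space_UNIV)
  qed
  have "char \<mu> = char \<nu>"
  proof
    fix s
    have "char \<mu> s = complex_of_real (LINT x|\<mu>. cos (s * x)) + \<i> * complex_of_real (LINT x|\<mu>. sin (s * x))"
      if "prob_space \<mu>" "sets \<mu> = sets borel" for \<mu>
    proof -
      interpret prob_space \<mu> by (rule that(1))
      have [measurable_cong]: "sets \<mu> = sets borel" by (rule that(2))
      have i: "integrable \<mu> (\<lambda>x. iexp (s * x))"
        by (rule integrable_const_bound[where B = 1]) auto
      have "Re (char \<mu> s) = (LINT x|\<mu>. cos (s * x))" "Im (char \<mu> s) = (LINT x|\<mu>. sin (s * x))"
        unfolding char_def using integral_Re[OF i] integral_Im[OF i] by (simp_all add: Re_exp Im_exp)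
      then show ?thesis by (simp add: complex_eq_iff)
    qed
    then show "char \<mu> s = char \<nu> s"
      using \<mu> \<nu> int[of "\<lambda>x. cos (s * x)"] int[of "\<lambda>x. sin (s * x)"] by simp
  qed
  then show ?thesis
    by (intro Levy_uniqueness rm.real_distribution_axioms rn.real_distribution_axioms)
qed

text \<open>Both singular parts are the restriction of \<open>\<mu>\<close> to the union of the two
  carrying null sets, where the absolutely continuous parts vanish. This makes the definite
  description in \<open>singular_part\<close> meaningful.\<close>

lemma lebesgue_decomposition_unique:
  assumes "lebesgue_decomposition \<mu> a1 s1" "lebesgue_decomposition \<mu> a2 s2"
  shows "s1 = s2"
proof -
  obtain N1 N2 where N: "N1 \<in> null_sets lborel" "emeasure s1 (- N1) = 0" "N2 \<in> null_sets lborel" "emeasure s2 (- N2) = 0"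
    using assms by (auto simp: lebesgue_decomposition_def)
  define N where "N = N1 \<union> N2"
  have Nn: "N \<in> null_sets lborel" unfolding N_def using N by auto
  then have [measurable]: "N \<in> sets borel" by auto
  have restrict: "emeasure s E = emeasure \<mu> (E \<inter> N)"
    if d: "lebesgue_decomposition \<mu> a s" and z: "emeasure s (- N') = 0" "N' \<in> sets borel" "N' \<subseteq> N" and E: "E \<in> sets borel" for a s E N'
  proof -
    have sets: "sets s = sets borel" "sets a = sets borel" using d by (auto simp: lebesgue_decomposition_def)
    have "emeasure s (E - N) \<le> emeasure s (- N')" using z by (intro emeasure_mono) (auto simp: sets)
    then have z': "emeasure s (E - N) = 0" using z(1) by simp
    have "emeasure s E = emeasure s (E \<inter> N) + emeasure s (E - N)"
      using E by (subst plus_emeasure) (auto simp: sets Un_Diff_Int Int_Diff_Un)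
    moreover have "emeasure a (E \<inter> N) = 0"
    proof -
      have "E \<inter> N \<in> null_sets lborel" using Nn E by (intro null_set_Int1) auto
      then have "E \<inter> N \<in> null_sets a" using d by (auto simp: lebesgue_decomposition_def absolutely_continuous_def)
      then show ?thesis by auto
    qed
    moreover have "emeasure \<mu> (E \<inter> N) = emeasure a (E \<inter> N) + emeasure s (E \<inter> N)"
      using d E by (simp add: lebesgue_decomposition_def)
    ultimately show ?thesis using z' by simp
  qed
  show ?thesis
  proof (rule measure_eqI)
    show "sets s1 = sets s2" using assms by (simp add: lebesgue_decomposition_def)
    fix E assume "E \<in> sets s1"
    then have E: "E \<in> sets borel" using assms by (simp add: lebesgue_decomposition_def)
    have "N1 \<in> sets borel" "N2 \<in> sets borel" using N(1,3) by auto
    then show "emeasure s1 E = emeasure s2 E"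
      using restrict[OF assms(1) N(2) _ _ E] restrict[OF assms(2) N(4) _ _ E] by (auto simp: N_def)
  qed
qed

lemma singular_part_eq: "lebesgue_decomposition \<mu> a s \<Longrightarrow> singular_part \<mu> = s"
  unfolding singular_part_def by (rule the_equality) (auto dest: lebesgue_decomposition_unique)

context finite_real_measure
begin

text \<open>A Lebesgue null set of maximal \<open>\<mu>\<close>-measure carries the singular part.\<close>

lemma lebesgue_decomposition_exists:
  obtains N where "N \<in> null_sets lborel"
    "absolutely_continuous lborel (density \<mu> (indicator (- N)))"
    "lebesgue_decomposition \<mu> (density \<mu> (indicator (- N))) (density \<mu> (indicator N))"
proof -
  obtain A where A: "range A \<subseteq> emeasure \<mu> ` null_sets lborel"
      "Sup (emeasure \<mu> ` null_sets lborel) = Sup (range (A :: nat \<Rightarrow> ennreal))"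
    using ennreal_SUP_countable_SUP[of "null_sets lborel" "emeasure \<mu>"] by auto
  have "\<forall>n. \<exists>B\<in>null_sets lborel. A n = emeasure \<mu> B" using A(1) by blast
  then obtain B where B: "\<And>n. B n \<in> null_sets lborel" "\<And>n. A n = emeasure \<mu> (B n)" by metis
  define N where "N = (\<Union>n. B n)"
  have N: "N \<in> null_sets lborel" unfolding N_def using B(1) by (intro null_sets_UN) auto
  then have Nb [measurable]: "N \<in> sets borel" by auto
  have max: "emeasure \<mu> E \<le> emeasure \<mu> N" if E: "E \<in> null_sets lborel" for E
  proof -
    have "emeasure \<mu> E \<le> (SUP n. A n)" unfolding A(2)[symmetric] by (rule SUP_upper[OF E])
    also have "\<dots> \<le> emeasure \<mu> N"
    proof (rule SUP_least)
      fix n show "A n \<le> emeasure \<mu> N" unfolding B(2) N_def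
        by (rule emeasure_mono) (use Nb in \<open>auto simp: N_def sets_borel\<close>)
    qed
    finally show ?thesis .
  qed
  have ac: "absolutely_continuous lborel (density \<mu> (indicator (- N)))"
    unfolding absolutely_continuous_def
  proof
    fix E :: "real set" assume E: "E \<in> null_sets lborel"
    then have Eb: "E \<in> sets borel" by auto
    \<comment> \<open>\<open>N \<union> E\<close> is again a null set, so maximality of
      \<open>N\<close> and finiteness of \<open>\<mu>\<close> leave no mass for
      \<open>E - N\<close>.\<close>
    have "emeasure \<mu> N + emeasure \<mu> (E - N) = emeasure \<mu> (N \<union> E)"
      using Eb by (subst plus_emeasure) (auto simp: sets_borel)
    also have "\<dots> \<le> emeasure \<mu> N + 0" using max[of "N \<union> E"] N E by auto
    finally have "emeasure \<mu> (E - N) = 0"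
      using emeasure_finite[of N] by (simp add: ennreal_add_left_cancel_le)
    moreover have "emeasure (density \<mu> (indicator (- N))) E = emeasure \<mu> (E - N)"
      using Eb by (subst emeasure_density) (auto simp: sets_borel Diff_eq indicator_inter_arith[symmetric] nn_integral_indicator[symmetric] intro!: nn_integral_cong split: split_indicator simp del: nn_integral_indicator)
    ultimately show "E \<in> null_sets (density \<mu> (indicator (- N)))"
      using Eb by (auto intro!: null_setsI simp: sets_borel)
  qed
  have split: "emeasure \<mu> E = emeasure (density \<mu> (indicator (- N))) E + emeasure (density \<mu> (indicator N)) E"
    if E: "E \<in> sets borel" for E
  proof -
    have "emeasure \<mu> E = (\<integral>\<^sup>+x. indicator E x \<partial>\<mu>)" using E by (simp add: sets_borel)
    also have "\<dots> = (\<integral>\<^sup>+x. indicator (- N) x * indicator E x + indicator N x * indicator E x \<partial>\<mu>)"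
      by (intro nn_integral_cong) (auto split: split_indicator)
    also have "\<dots> = (\<integral>\<^sup>+x. indicator (- N) x * indicator E x \<partial>\<mu>) + (\<integral>\<^sup>+x. indicator N x * indicator E x \<partial>\<mu>)"
      using E by (intro nn_integral_add) (auto simp: sets_borel)
    also have "\<dots> = emeasure (density \<mu> (indicator (- N))) E + emeasure (density \<mu> (indicator N)) E"
      using E by (subst (1 2) emeasure_density) (auto simp: sets_borel)
    finally show ?thesis .
  qed
  have "emeasure (density \<mu> (indicator N)) (- N) = 0"
  proof -
    have "emeasure (density \<mu> (indicator N)) (- N) = (\<integral>\<^sup>+x. indicator N x * indicator (- N) x \<partial>\<mu>)"
      by (subst emeasure_density) (auto simp: sets_borel)
    also have "\<dots> = (\<integral>\<^sup>+x. 0 \<partial>\<mu>)" by (intro nn_integral_cong) (auto split: split_indicator)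
    finally show ?thesis by simp
  qed
  then have "lebesgue_decomposition \<mu> (density \<mu> (indicator (- N))) (density \<mu> (indicator N))"
    unfolding lebesgue_decomposition_def using split ac N by (auto simp: sets_borel)
  then show ?thesis by (rule that[OF N ac])
qed

end

section \<open>Clark measures\<close>

text \<open>Open mapping theorem: the image lies in the real line and so contains no disk.\<close>

lemma holomorphic_Im_zero_imp_constant:
  assumes hol: "f holomorphic_on upper_half_plane" and Im: "\<And>z. Im z > 0 \<Longrightarrow> Im (f z) = 0"
  obtains c where "\<And>z. Im z > 0 \<Longrightarrow> f z = c"
proof -
  have "f constant_on upper_half_plane"
  proof (rule ccontr)
    assume nc: "\<not> f constant_on upper_half_plane"
    have "connected upper_half_plane"
      unfolding upper_half_plane_def by (intro convex_connected convex_halfspace_Im_gt)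
    from open_mapping_thm[OF hol open_upper_half_plane this open_upper_half_plane order_refl nc]
    have "open (f ` upper_half_plane)" .
    moreover have "f \<i> \<in> f ` upper_half_plane" by simp
    ultimately obtain r where r: "r > 0" "ball (f \<i>) r \<subseteq> f ` upper_half_plane"
      unfolding open_contains_ball by blast
    have "f \<i> + \<i> * complex_of_real (r / 2) \<in> ball (f \<i>) r"
      using r(1) by (simp add: dist_norm norm_mult)
    then obtain z where "Im z > 0" "f z = f \<i> + \<i> * complex_of_real (r / 2)" using r(2) by (auto simp: image_iff)
    then show False using Im[of z] Im[of \<i>] r(1) by simp
  qed
  then show ?thesis using that unfolding constant_on_def by auto
qed

context finite_real_measure
begin

lemma cauchy_transform_Im: "Im z > 0 \<Longrightarrow> Im (cauchy_transform z) = (LINT t|\<mu>. pi * poisson z t)"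
  unfolding cauchy_transform_def by (subst integral_Im[OF cauchy_kernel_integrable, symmetric]) (simp_all only: Im_inverse_diff)

lemma cauchy_transform_Im_nonneg: "Im z > 0 \<Longrightarrow> Im (cauchy_transform z) \<ge> 0"
  unfolding cauchy_transform_Im by (intro integral_nonneg_AE AE_I2) (simp add: poisson_nonneg)

text \<open>\<open>y * Im (cauchy_transform (iy))\<close> is the integral of
  \<open>y^2 / (t^2 + y^2)\<close>, which is at most 1 everywhere and at most 1/2 on the
  tail.\<close>

lemma tail_bound:
  assumes P: "prob_space \<mu>" and y: "y > 0"
  shows "measure \<mu> {t. y \<le> \<bar>t\<bar>} \<le> 2 * (1 - y * Im (cauchy_transform (Complex 0 y)))"
proof -
  interpret prob_space \<mu> by (rule P)
  let ?A = "{t. y \<le> \<bar>t\<bar>} :: real set"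
  have [measurable]: "?A \<in> sets borel" by measurable
  have A: "?A \<in> sets \<mu>" by (simp add: sets_borel)
  have int: "integrable \<mu> (\<lambda>t. y * (pi * poisson (Complex 0 y) t))"
    using integrable_Im[OF cauchy_kernel_integrable[of "Complex 0 y"]] y unfolding Im_inverse_diff by simp
  have le: "y * (pi * poisson (Complex 0 y) t) \<le> 1 - 1 / 2 * indicator ?A t" for t
  proof -
    have eq: "y * (pi * poisson (Complex 0 y) t) = y\<^sup>2 / (t\<^sup>2 + y\<^sup>2)"
      by (simp add: poisson_Complex power2_eq_square)
    have pos: "t\<^sup>2 + y\<^sup>2 > 0" using y by (simp add: add_nonneg_pos)
    show ?thesis
    proof (cases "t \<in> ?A")
      case True
      then have "y\<^sup>2 \<le> \<bar>t\<bar>\<^sup>2" using y by (intro power_mono) auto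
      then have "y\<^sup>2 / (t\<^sup>2 + y\<^sup>2) \<le> 1 / 2" using pos by (simp add: divide_le_eq)
      then show ?thesis unfolding eq using True by simp
    next
      case False
      then show ?thesis unfolding eq using pos by (simp add: divide_le_eq)
    qed
  qed
  have "y * Im (cauchy_transform (Complex 0 y)) = (LINT t|\<mu>. y * (pi * poisson (Complex 0 y) t))"
    using y by (simp add: cauchy_transform_Im)
  also have "\<dots> \<le> (LINT t|\<mu>. 1 - 1 / 2 * indicator ?A t)"
  proof (intro integral_mono int le)
    show "integrable \<mu> (\<lambda>t. 1 - 1 / 2 * indicator ?A t :: real)"
      by (rule integrable_const_bound[where B = 1]) (auto split: split_indicator)
  qed
  also have "\<dots> = 1 - 1 / 2 * measure \<mu> ?A"
  proof -
    have "integrable \<mu> (indicator ?A :: real \<Rightarrow> real)"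
      by (rule integrable_const_bound[where B = 1]) (auto split: split_indicator)
    then show ?thesis using prob_space by (simp add: space_UNIV)
  qed
  finally show ?thesis by simp
qed

end

context nevanlinna
begin

text \<open>The measure represented by the resolvent with pole \<open>\<tau> - i \<eta>\<close>. It
  has an explicit density; a singular part can appear only in the weak limit as
  \<open>\<eta>\<close> tends to 0.\<close>

definition clark_approx :: "real \<Rightarrow> real \<Rightarrow> real measure" where
  "clark_approx \<tau> \<eta> = density lborel (\<lambda>x. ennreal (poisson (\<phi> x + \<i> * complex_of_real \<eta>) \<tau>))"

lemma clark_approx_prob: "\<eta> > 0 \<Longrightarrow> prob_space (clark_approx \<tau> \<eta>)"
  by (rule prob_spaceI) (simp add: clark_approx_def emeasure_density poisson_pushforward)

lemma sets_clark_approx [simp]: "sets (clark_approx \<tau> \<eta>) = sets borel"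
  by (simp add: clark_approx_def)

text \<open>The Poisson formula gives equality of imaginary parts, so the two sides differ by a
  constant; both tend to 0 along the imaginary axis.\<close>

lemma clark_approx_transform:
  assumes \<eta>: "\<eta> > 0" and z: "Im z > 0"
  shows "(LINT t|clark_approx \<tau> \<eta>. 1 / (complex_of_real t - z)) = 1 / (Complex \<tau> (- \<eta>) - \<Phi> z)"
proof -
  interpret p: prob_space "clark_approx \<tau> \<eta>" by (rule clark_approx_prob[OF \<eta>])
  interpret m: finite_real_measure "clark_approx \<tau> \<eta>" by standard simp
  define f where "f z = 1 / (Complex \<tau> (- \<eta>) - \<Phi> z)" for z
  define fb where "fb x = 1 / (Complex \<tau> (- \<eta>) - \<phi> x)" for x
  interpret bounded_boundary f fb "1 / \<eta>"
    unfolding f_def[abs_def] fb_def[abs_def] by (rule resolvent_bounded_boundary[OF \<eta>])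
  have Im_fb: "Im (fb x) = pi * poisson (\<phi> x + \<i> * complex_of_real \<eta>) \<tau>" for x
    unfolding fb_def by (rule Im_resolvent_poisson)
  have Im_eq: "Im (f z) = Im (m.cauchy_transform z)" if z: "Im z > 0" for z
  proof -
    have "ennreal (Im (m.cauchy_transform z) / pi) = (\<integral>\<^sup>+t. ennreal (poisson z t) \<partial>clark_approx \<tau> \<eta>)"
      by (rule m.cauchy_transform_Im_integral[OF z, symmetric])
    also have "\<dots> = (\<integral>\<^sup>+t. ennreal (poisson (\<phi> t + \<i> * complex_of_real \<eta>) \<tau>) * ennreal (poisson z t) \<partial>lborel)"
      unfolding clark_approx_def by (rule nn_integral_density) measurable
    also have "\<dots> = (\<integral>\<^sup>+t. ennreal (1 / pi * (poisson z t * Im (fb t))) \<partial>lborel)"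
    proof (rule nn_integral_cong_AE)
      show "AE t in lborel. ennreal (poisson (\<phi> t + \<i> * complex_of_real \<eta>) \<tau>) * ennreal (poisson z t) = ennreal (1 / pi * (poisson z t * Im (fb t)))"
        using phi_Im_nonneg
      proof eventually_elim
        case (elim t)
        then have "poisson (\<phi> t + \<i> * complex_of_real \<eta>) \<tau> \<ge> 0" using \<eta> by (intro poisson_nonneg) simp
        then show ?case using z unfolding Im_fb by (simp add: poisson_nonneg mult.commute flip: ennreal_mult)
      qed
    qed
    also have "\<dots> = ennreal (LINT t|lborel. 1 / pi * (poisson z t * Im (fb t)))"
    proof (rule nn_integral_eq_integral)
      show "integrable lborel (\<lambda>t. 1 / pi * (poisson z t * Im (fb t)))"
        using poisson_formula_Im(1)[OF z] by (rule integrable_mult_right)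
      show "AE t in lborel. 0 \<le> 1 / pi * (poisson z t * Im (fb t))"
        using phi_Im_nonneg
      proof eventually_elim
        case (elim t)
        then have "poisson (\<phi> t + \<i> * complex_of_real \<eta>) \<tau> \<ge> 0" using \<eta> by (intro poisson_nonneg) simp
        then show ?case using z unfolding Im_fb by (simp add: poisson_nonneg)
      qed
    qed
    also have "(LINT t|lborel. 1 / pi * (poisson z t * Im (fb t))) = Im (f z) / pi"
      by (subst Bochner_Integration.integral_mult_right_zero) (simp only: poisson_formula_Im(2)[OF z], simp)
    finally have "Im (m.cauchy_transform z) / pi = Im (f z) / pi"
      using m.cauchy_transform_Im_nonneg[OF z] resolvent_Im_nonneg[of \<eta> z \<tau>] \<eta> z
      by (subst (asm) ennreal_inj) (auto simp: f_def)
    then show ?thesis by simp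
  qed
  have "(\<lambda>z. f z - m.cauchy_transform z) holomorphic_on upper_half_plane"
    by (intro holomorphic_intros hol m.holomorphic_cauchy_transform)
  then obtain c where c: "\<And>z. Im z > 0 \<Longrightarrow> f z - m.cauchy_transform z = c"
    by (rule holomorphic_Im_zero_imp_constant) (simp add: Im_eq, blast)
  \<comment> \<open>At the point \<open>i (n + 1)\<close> each of the two functions is at most
    \<open>shift_seq n\<close>: the resolvent because \<open>Im \<Phi> \<ge> Im z\<close>, the
    transform because the mass is 1.\<close>
  have "cmod c \<le> 2 * shift_seq n" for n
  proof -
    let ?w = "Complex 0 (1 / shift_seq n)"
    have w: "Im ?w > 0" by simp
    have "1 / shift_seq n \<le> Im (\<Phi> ?w)" using Im_Phi_ge[OF w] by simp
    also have "\<dots> \<le> \<bar>Im (Complex \<tau> (- \<eta>) - \<Phi> ?w)\<bar>" using \<eta> by simp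
    also have "\<dots> \<le> cmod (Complex \<tau> (- \<eta>) - \<Phi> ?w)" by (rule abs_Im_le_cmod)
    finally have "cmod (f ?w) \<le> 1 / (1 / shift_seq n)"
      unfolding f_def norm_divide norm_one by (intro frac_le) simp_all
    moreover have "cmod (m.cauchy_transform ?w) \<le> shift_seq n"
      using m.cauchy_transform_bound[OF w] p.prob_space by simp
    moreover have "cmod c \<le> cmod (f ?w) + cmod (m.cauchy_transform ?w)"
      unfolding c[OF w, symmetric] by (rule norm_triangle_ineq4)
    ultimately show ?thesis by simp
  qed
  note c_bound = this
  have "(\<lambda>n. 2 * shift_seq n) \<longlonglongrightarrow> 2 * 0" by (intro tendsto_intros shift_seq_tendsto)
  then have "cmod c \<le> 2 * 0" by (rule LIMSEQ_le_const) (use c_bound in blast)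
  then have "f z = m.cauchy_transform z" using c[OF z] by simp
  then show ?thesis by (simp add: f_def m.cauchy_transform_def)
qed

text \<open>The bound does not involve \<open>\<eta>\<close>, which gives tightness. With
  \<open>c\<close> the pole and \<open>P\<close> the value of \<open>\<Phi>\<close> at
  \<open>iy\<close>, the defect in \<open>tail_bound\<close> is the real part of
  \<open>(c - (P - iy)) / (c - P)\<close>, whose denominator has modulus at least
  \<open>y\<close>.\<close>

lemma clark_approx_tail:
  assumes \<eta>: "0 < \<eta>" "\<eta> \<le> 1" and y: "y > 0"
  shows "measure (clark_approx \<tau> \<eta>) {t. y \<le> \<bar>t\<bar>}
    \<le> 2 * (cmod (\<Phi> (Complex 0 y) / Complex 0 y - 1) + (\<bar>\<tau>\<bar> + 1) / y)"
proof -
  interpret p: prob_space "clark_approx \<tau> \<eta>" by (rule clark_approx_prob[OF \<eta>(1)])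
  interpret m: finite_real_measure "clark_approx \<tau> \<eta>" by standard simp
  define P where "P = \<Phi> (Complex 0 y)"
  define c where "c = Complex \<tau> (- \<eta>)"
  have ct: "m.cauchy_transform (Complex 0 y) = 1 / (c - P)"
    using clark_approx_transform[OF \<eta>(1), of "Complex 0 y" \<tau>] y by (simp add: m.cauchy_transform_def P_def c_def)
  have "y \<le> Im P" unfolding P_def using Im_Phi_ge[of "Complex 0 y"] y by simp
  also have "\<dots> \<le> \<bar>Im (c - P)\<bar>" using \<eta> by (simp add: c_def)
  also have "\<dots> \<le> cmod (c - P)" by (rule abs_Im_le_cmod)
  finally have ycP: "y \<le> cmod (c - P)" .
  then have ne: "c - P \<noteq> 0" using y by auto
  have "1 - y * Im (1 / (c - P)) = Re (1 - (- Complex 0 y) / (c - P))"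
  proof -
    have "y * Im (1 / d) = Re (- Complex 0 y / d)" for d by (simp add: Re_divide Im_divide)
    then show ?thesis by simp
  qed
  also have "1 - (- Complex 0 y) / (c - P) = (c - (P - Complex 0 y)) / (c - P)"
    using ne by (simp add: field_simps)
  also have "Re \<dots> \<le> cmod \<dots>" by (rule complex_Re_le_cmod)
  also have "\<dots> = cmod (c - (P - Complex 0 y)) / cmod (c - P)" by (rule norm_divide)
  also have "\<dots> \<le> (cmod (P - Complex 0 y) + (\<bar>\<tau>\<bar> + 1)) / y"
  proof (rule frac_le)
    have "cmod c \<le> \<bar>\<tau>\<bar> + \<bar>- \<eta>\<bar>" using cmod_le[of c] by (simp add: c_def)
    then have "cmod c \<le> \<bar>\<tau>\<bar> + 1" using \<eta> by simp
    then show "cmod (c - (P - Complex 0 y)) \<le> cmod (P - Complex 0 y) + (\<bar>\<tau>\<bar> + 1)"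
      using norm_triangle_ineq4[of c "P - Complex 0 y"] by linarith
  qed (use y ycP in auto)
  also have "\<dots> = cmod (P / Complex 0 y - 1) + (\<bar>\<tau>\<bar> + 1) / y"
  proof -
    have "Complex 0 y \<noteq> 0" using y by (simp add: complex_eq_iff)
    then have "P / Complex 0 y - 1 = (P - Complex 0 y) / Complex 0 y" by (simp add: diff_divide_distrib)
    moreover have "cmod (Complex 0 y) = y" using y by (simp add: cmod_def)
    ultimately show ?thesis by (simp add: norm_divide add_divide_distrib)
  qed
  finally have "1 - y * Im (m.cauchy_transform (Complex 0 y)) \<le> cmod (P / Complex 0 y - 1) + (\<bar>\<tau>\<bar> + 1) / y"
    unfolding ct .
  from order_trans[OF m.tail_bound[OF p.prob_space_axioms y] mult_left_mono[OF this]] show ?thesis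
    by (simp add: P_def)
qed

lemma clark_approx_tight: "tight (\<lambda>n. clark_approx \<tau> (shift_seq n))"
  unfolding tight_def
proof (intro conjI allI impI)
  show rd: "real_distribution (clark_approx \<tau> (shift_seq n))" for n
  proof -
    interpret prob_space "clark_approx \<tau> (shift_seq n)" by (rule clark_approx_prob) simp
    show ?thesis by standard simp
  qed
  fix \<epsilon> :: real assume \<epsilon>: "\<epsilon> > 0"
  have "((\<lambda>y. 2 * (cmod (\<Phi> (Complex 0 y) / Complex 0 y - 1) + (\<bar>\<tau>\<bar> + 1) / y)) \<longlongrightarrow> 2 * (cmod (1 - 1) + 0)) at_top"
  proof (intro tendsto_mult tendsto_add tendsto_norm tendsto_diff Phi_asymp tendsto_const)
    show "((\<lambda>y. (\<bar>\<tau>\<bar> + 1) / y) \<longlongrightarrow> 0) at_top" by real_asymp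
  qed
  then have "\<forall>\<^sub>F y in at_top. 2 * (cmod (\<Phi> (Complex 0 y) / Complex 0 y - 1) + (\<bar>\<tau>\<bar> + 1) / y) < \<epsilon>"
    using \<epsilon> by (intro order_tendstoD(2)) auto
  with eventually_gt_at_top[of 0] have "\<forall>\<^sub>F y in at_top. y > 0 \<and> 2 * (cmod (\<Phi> (Complex 0 y) / Complex 0 y - 1) + (\<bar>\<tau>\<bar> + 1) / y) < \<epsilon>"
    by eventually_elim simp
  then obtain y where y: "y > 0" "2 * (cmod (\<Phi> (Complex 0 y) / Complex 0 y - 1) + (\<bar>\<tau>\<bar> + 1) / y) < \<epsilon>"
    using eventually_happens'[OF trivial_limit_at_top_linorder] by blast
  show "\<exists>a b. a < b \<and> (\<forall>n. 1 - \<epsilon> < measure (clark_approx \<tau> (shift_seq n)) {a<..b})"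
  proof (rule exI[of _ "- y"], rule exI[of _ y], intro conjI allI)
    show "- y < y" using y(1) by simp
    fix n
    interpret real_distribution "clark_approx \<tau> (shift_seq n)" by (rule rd)
    have "prob (- {- y<..y}) \<le> prob {t. y \<le> \<bar>t\<bar>}"
      by (rule finite_measure_mono) auto
    also have "\<dots> < \<epsilon>"
      using clark_approx_tail[OF shift_seq_pos shift_seq_le_1 y(1), of \<tau> n] y(2) by linarith
    finally show "1 - \<epsilon> < prob {- y<..y}"
      using prob_compl[of "{- y<..y}"] by (simp add: Compl_eq_Diff_UNIV)
  qed
qed

text \<open>Tightness yields a weakly convergent subsequence of \<open>clark_approx\<close>. For
  fixed \<open>z\<close> the kernel \<open>1/(t - z)\<close> is bounded and continuous in
  \<open>t\<close>, so the Cauchy transforms converge as well.\<close>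

lemma clark_measure_exists: "\<exists>\<mu>. is_clark_measure \<Phi> \<tau> \<mu>"
proof -
  obtain r M where r: "strict_mono (r :: nat \<Rightarrow> nat)" and M: "real_distribution M"
    and conv: "weak_conv_m ((\<lambda>n. clark_approx \<tau> (shift_seq n)) \<circ> id \<circ> r) M"
    using tight_imp_convergent_subsubsequence[OF clark_approx_tight strict_mono_id] by blast
  interpret M: real_distribution M by (rule M)
  define m where "m = (\<lambda>n. clark_approx \<tau> (shift_seq (r n)))"
  have conv': "weak_conv_m m M" using conv by (simp add: m_def comp_def)
  have rd: "real_distribution (m n)" for n
    using clark_approx_tight[of \<tau>] by (simp add: tight_def m_def)
  have "1 / (complex_of_real \<tau> - \<Phi> z) = (LINT t|M. 1 / (complex_of_real t - z))" if z: "Im z > 0" for z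
  proof -
    have "(\<lambda>n. LINT t|m n. 1 / (complex_of_real t - z)) \<longlonglongrightarrow> (LINT t|M. 1 / (complex_of_real t - z))"
    proof (rule weak_conv_imp_integral_bdd_continuous_conv[OF rd M conv'])
      show "isCont (\<lambda>t. 1 / (complex_of_real t - z)) t" for t
        using z by (intro continuous_intros) (auto simp: complex_eq_iff)
      show "norm (1 / (complex_of_real t - z)) \<le> 1 / Im z" for t by (rule inverse_diff_bound[OF z])
    qed
    then have "(\<lambda>n. 1 / (Complex \<tau> (- shift_seq (r n)) - \<Phi> z)) \<longlonglongrightarrow> (LINT t|M. 1 / (complex_of_real t - z))"
      using z by (simp add: m_def clark_approx_transform)
    moreover have "(\<lambda>n. 1 / (Complex \<tau> (- shift_seq (r n)) - \<Phi> z)) \<longlonglongrightarrow> 1 / (Complex \<tau> (- 0) - \<Phi> z)"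
    proof -
      have "(\<lambda>n. shift_seq (r n)) \<longlonglongrightarrow> 0"
        using LIMSEQ_subseq_LIMSEQ[OF shift_seq_tendsto r] by (simp add: comp_def)
      then show ?thesis
        using resolvent_ne[of 0 z \<tau>] z by (intro tendsto_intros) auto
    qed
    ultimately have "1 / (Complex \<tau> (- 0) - \<Phi> z) = (LINT t|M. 1 / (complex_of_real t - z))"
      using LIMSEQ_unique by blast
    then show ?thesis by (simp add: complex_of_real_def)
  qed
  then have "is_clark_measure \<Phi> \<tau> M"
    using M.prob_space_axioms by (simp add: is_clark_measure_def)
  then show ?thesis by blast
qed

lemma clark_measure_unique:
  assumes "is_clark_measure \<Phi> \<tau> \<mu>" "is_clark_measure \<Phi> \<tau> \<nu>"
  shows "\<mu> = \<nu>"
  using assms by (intro prob_space_eq_if_cauchy_transform_eq) (auto simp: is_clark_measure_def)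

lemma is_clark_measure_clark_measure: "is_clark_measure \<Phi> \<tau> (clark_measure \<Phi> \<tau>)"
  unfolding clark_measure_def using clark_measure_exists clark_measure_unique by (metis (mono_tags) theI)

end

section \<open>Mass of the absolutely continuous part from boundary limits of the Poisson
  integral\<close>

lemma poisson_mass_tendsto_indicator:
  assumes [measurable]: "A \<in> sets borel" and t: "t \<notin> frontier A"
  shows "(\<lambda>n. \<integral>\<^sup>+x. indicator A x * ennreal (poisson (Complex t (shift_seq n)) x) \<partial>lborel) \<longlonglongrightarrow> indicator A t"
proof -
  have eq: "(\<integral>\<^sup>+x. indicator A x * ennreal (poisson (Complex t (shift_seq n)) x) \<partial>lborel)
      = ennreal (LINT x|lborel. poisson (Complex t (shift_seq n)) x * indicator A x)" for n
  proof -
    have "integrable lborel (\<lambda>x. poisson (Complex t (shift_seq n)) x *\<^sub>R (indicator A x :: real))"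
      by (rule poisson_integrable_mult[where M = 1]) (auto split: split_indicator)
    then show ?thesis
      by (subst nn_integral_eq_integral[symmetric])
         (auto simp: poisson_nonneg intro!: nn_integral_cong split: split_indicator)
  qed
  have "(\<lambda>n. LINT x|lborel. poisson (Complex t (shift_seq n)) x * indicator A x) \<longlonglongrightarrow> indicator A t"
    by (rule poisson_approx_identity[where M = 1])
       (use t shift_seq_tendsto in \<open>auto simp: isCont_indicator split: split_indicator\<close>)
  then show ?thesis unfolding eq by (subst ennreal_indicator[symmetric]) (rule tendsto_ennrealI)
qed

lemma poisson_mass_le_1:
  assumes [measurable]: "A \<in> sets borel"
  shows "(\<integral>\<^sup>+x. indicator A x * ennreal (poisson (Complex t (shift_seq n)) x) \<partial>lborel) \<le> 1"
proof -
  have "(\<integral>\<^sup>+x. indicator A x * ennreal (poisson (Complex t (shift_seq n)) x) \<partial>lborel)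
      \<le> (\<integral>\<^sup>+x. ennreal (poisson (Complex t (shift_seq n)) x) \<partial>lborel)"
    by (intro nn_integral_mono) (auto split: split_indicator)
  then show ?thesis by (simp add: poisson_nn_integral)
qed

text \<open>No differentiation theory for measures is needed: by Fatou's lemma \<open>h\<close> is dominated by \<open>\<mu>\<close> on
  closed sets, hence on all Borel sets by inner regularity.\<close>

lemma (in finite_real_measure) ac_part_mass_ge:
  assumes [measurable]: "h \<in> borel_measurable borel"
    and lim: "AE x in lborel. (\<lambda>n. \<integral>\<^sup>+t. ennreal (poisson (Complex x (shift_seq n)) t) \<partial>\<mu>) \<longlonglongrightarrow> h x"
    and fin: "(\<integral>\<^sup>+x. h x \<partial>lborel) < \<infinity>"
    and N: "N \<in> null_sets lborel"
  shows "(\<integral>\<^sup>+x. h x \<partial>lborel) \<le> emeasure \<mu> (- N)"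
proof -
  have Nb [measurable]: "N \<in> sets borel" using N by auto
  define p where "p n x = (\<integral>\<^sup>+t. ennreal (poisson (Complex x (shift_seq n)) t) \<partial>\<mu>)" for n x
  have [measurable]: "p n \<in> borel_measurable borel" for n unfolding p_def by measurable
  have closed_le: "emeasure (density lborel h) C \<le> emeasure \<mu> C" if C: "closed C" for C
  proof -
    have Cb [measurable]: "C \<in> sets borel" using C by simp
    define q where "q n t = (\<integral>\<^sup>+x. indicator C x * ennreal (poisson (Complex t (shift_seq n)) x) \<partial>lborel)" for n t
    have [measurable]: "q n \<in> borel_measurable borel" for n unfolding q_def by measurable
    have "emeasure (density lborel h) C = (\<integral>\<^sup>+x. liminf (\<lambda>n. indicator C x * p n x) \<partial>lborel)"
      unfolding emeasure_density[OF \<open>h \<in> borel_measurable borel\<close>[folded measurable_lborel2] Cb[folded sets_lborel]]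
    proof (rule nn_integral_cong_AE)
      show "AE x in lborel. h x * indicator C x = liminf (\<lambda>n. indicator C x * p n x)"
        using lim
      proof eventually_elim
        case (elim x)
        have "(\<lambda>n. indicator C x * p n x) \<longlonglongrightarrow> indicator C x * h x"
          using elim unfolding p_def by (intro ennreal_tendsto_cmult) (auto split: split_indicator)
        from lim_imp_Liminf[OF trivial_limit_sequentially this] show ?case by (simp add: mult.commute)
      qed
    qed
    also have "\<dots> \<le> liminf (\<lambda>n. \<integral>\<^sup>+x. indicator C x * p n x \<partial>lborel)"
      by (rule nn_integral_liminf) measurable
    also have "\<dots> = liminf (\<lambda>n. \<integral>\<^sup>+t. q n t \<partial>\<mu>)"
      unfolding p_def q_def by (subst poisson_swap) auto
    \<comment> \<open>\<open>q n\<close> converges to the indicator only off the frontier, which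
      \<open>\<mu>\<close> may charge. The maximum with the indicator is 1 on all of
      \<open>C\<close>, as \<open>q n \<le> 1\<close>, so it converges everywhere.\<close>
    also have "\<dots> \<le> liminf (\<lambda>n. \<integral>\<^sup>+t. max (indicator C t) (q n t) \<partial>\<mu>)"
      by (intro Liminf_mono always_eventually allI nn_integral_mono) simp
    also have "\<dots> = (\<integral>\<^sup>+t. indicator C t \<partial>\<mu>)"
    proof (rule lim_imp_Liminf[OF trivial_limit_sequentially], rule nn_integral_dominated_convergence[where w = "\<lambda>_. 1"])
      show "AE t in \<mu>. (\<lambda>n. max (indicator C t) (q n t)) \<longlonglongrightarrow> indicator C t"
      proof (rule AE_I2)
        fix t
        show "(\<lambda>n. max (indicator C t) (q n t)) \<longlonglongrightarrow> indicator C t"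
        proof (cases "t \<in> C")
          case True
          have "q n t \<le> 1" for n unfolding q_def by (rule poisson_mass_le_1[OF Cb])
          then have "max (indicator C t) (q n t) = 1" for n using True by (simp add: max_absorb1)
          then show ?thesis using True by simp
        next
          case False
          then have "t \<notin> frontier C" using C by (simp add: frontier_def)
          then have "(\<lambda>n. q n t) \<longlonglongrightarrow> indicator C t"
            unfolding q_def by (rule poisson_mass_tendsto_indicator[OF Cb])
          then show ?thesis using False by simp
        qed
      qed
      show "AE t in \<mu>. max (indicator C t) (q n t) \<le> 1" for n
        unfolding q_def using poisson_mass_le_1[OF Cb] by (auto split: split_indicator)
    qed (auto simp: emeasure_eq_measure)
    also have "\<dots> = emeasure \<mu> C" using Cb by (simp add: sets_borel)
    finally show ?thesis .
  qed
  have "(\<integral>\<^sup>+x. h x \<partial>lborel) = (\<integral>\<^sup>+x. h x * indicator (- N) x \<partial>lborel)"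
  proof (rule nn_integral_cong_AE)
    show "AE x in lborel. h x = h x * indicator (- N) x"
      using AE_not_in[OF N] by eventually_elim simp
  qed
  also have "\<dots> = emeasure (density lborel h) (- N)"
    by (rule emeasure_density[symmetric]) auto
  also have "\<dots> = (SUP K\<in>{K. K \<subseteq> - N \<and> compact K}. emeasure (density lborel h) K)"
    by (rule inner_regular) (use fin in \<open>auto simp: emeasure_density\<close>)
  also have "\<dots> \<le> emeasure \<mu> (- N)"
  proof (rule SUP_least)
    fix K assume K: "K \<in> {K. K \<subseteq> - N \<and> compact K}"
    then have "emeasure (density lborel h) K \<le> emeasure \<mu> K" by (intro closed_le compact_imp_closed) auto
    also have "\<dots> \<le> emeasure \<mu> (- N)" using K by (intro emeasure_mono) (auto simp: sets_borel)
    finally show "emeasure (density lborel h) K \<le> emeasure \<mu> (- N)" .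
  qed
  finally show ?thesis .
qed

text \<open>Conversely the Poisson integral of \<open>\<mu>\<close> is at least that of a bounded, compactly supported
  truncation of the density of its absolutely continuous part, where dominated convergence applies.\<close>

lemma (in finite_real_measure) ac_part_mass_le:
  assumes [measurable]: "h \<in> borel_measurable borel"
    and lim: "AE x in lborel. (\<lambda>n. \<integral>\<^sup>+t. ennreal (poisson (Complex x (shift_seq n)) t) \<partial>\<mu>) \<longlonglongrightarrow> h x"
    and N [measurable]: "N \<in> sets borel"
    and ac: "absolutely_continuous lborel (density \<mu> (indicator (- N)))"
  shows "emeasure \<mu> (- N) \<le> (\<integral>\<^sup>+x. h x \<partial>lborel)"
proof -
  define p where "p n x = (\<integral>\<^sup>+t. ennreal (poisson (Complex x (shift_seq n)) t) \<partial>\<mu>)" for n x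
  have [measurable]: "p n \<in> borel_measurable borel" for n unfolding p_def by measurable
  let ?ac = "density \<mu> (indicator (- N))"
  define k where "k = RN_deriv lborel ?ac"
  have kb [measurable]: "k \<in> borel_measurable borel" using borel_measurable_RN_deriv[of lborel ?ac] by (simp add: k_def)
  have dens: "density lborel k = ?ac"
    unfolding k_def by (rule sigma_finite_measure.density_RN_deriv[OF sigma_finite_lborel ac]) (simp add: sets_borel)
  \<comment> \<open>The open interval gives weight 0 to the endpoints of the closed interval
    \<open>?I\<close> used below, where \<open>q n\<close> need not tend to the indicator.\<close>
  define km where "km m t = min (k t) (of_nat m) * indicator {- real m<..<real m} t" for m t
  have [measurable]: "km m \<in> borel_measurable borel" for m unfolding km_def by measurable
  have p_ge: "(\<integral>\<^sup>+t. ennreal (poisson (Complex x (shift_seq n)) t) * km m t \<partial>lborel) \<le> p n x" for n m x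
  proof -
    have "(\<integral>\<^sup>+t. ennreal (poisson (Complex x (shift_seq n)) t) * km m t \<partial>lborel)
        \<le> (\<integral>\<^sup>+t. k t * ennreal (poisson (Complex x (shift_seq n)) t) \<partial>lborel)"
      by (intro nn_integral_mono) (auto simp: km_def mult.commute intro!: mult_right_mono split: split_indicator)
    also have "\<dots> = (\<integral>\<^sup>+t. ennreal (poisson (Complex x (shift_seq n)) t) \<partial>density lborel k)"
      by (rule nn_integral_density[symmetric]) measurable
    also have "\<dots> = (\<integral>\<^sup>+t. indicator (- N) t * ennreal (poisson (Complex x (shift_seq n)) t) \<partial>\<mu>)"
      unfolding dens by (rule nn_integral_density) (auto simp: sets_borel)
    also have "\<dots> \<le> p n x"
      unfolding p_def by (intro nn_integral_mono) (auto split: split_indicator)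
    finally show ?thesis .
  qed
  \<comment> \<open>This second bound permits replacing \<open>p n\<close> by its minimum with
    \<open>m\<close>, which on the bounded interval \<open>?I\<close> has an integrable
    majorant.\<close>
  have p_ge': "(\<integral>\<^sup>+t. ennreal (poisson (Complex x (shift_seq n)) t) * km m t \<partial>lborel) \<le> of_nat m" for n m x
  proof -
    have "(\<integral>\<^sup>+t. ennreal (poisson (Complex x (shift_seq n)) t) * km m t \<partial>lborel)
        \<le> (\<integral>\<^sup>+t. ennreal (poisson (Complex x (shift_seq n)) t) * of_nat m \<partial>lborel)"
      by (intro nn_integral_mono mult_left_mono) (auto simp: km_def split: split_indicator)
    also have "\<dots> = of_nat m" by (subst nn_integral_multc) (auto simp: poisson_nn_integral)
    finally show ?thesis .
  qed
  have km_le: "(\<integral>\<^sup>+t. km m t \<partial>lborel) \<le> (\<integral>\<^sup>+x. h x \<partial>lborel)" for m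
  proof -
    let ?I = "{- real m..real m}"
    define q where "q n t = (\<integral>\<^sup>+x. indicator ?I x * ennreal (poisson (Complex t (shift_seq n)) x) \<partial>lborel)" for n t
    have [measurable]: "q n \<in> borel_measurable borel" for n unfolding q_def by measurable
    have le: "(\<integral>\<^sup>+t. km m t * q n t \<partial>lborel) \<le> (\<integral>\<^sup>+x. indicator ?I x * min (p n x) (of_nat m) \<partial>lborel)" for n
    proof -
      have "(\<integral>\<^sup>+t. km m t * q n t \<partial>lborel)
          = (\<integral>\<^sup>+t. (\<integral>\<^sup>+x. km m t * (indicator ?I x * ennreal (poisson (Complex t (shift_seq n)) x)) \<partial>lborel) \<partial>lborel)"
        unfolding q_def by (intro nn_integral_cong nn_integral_cmult[symmetric]) measurable
      also have "\<dots> = (\<integral>\<^sup>+x. (\<integral>\<^sup>+t. km m t * (indicator ?I x * ennreal (poisson (Complex t (shift_seq n)) x)) \<partial>lborel) \<partial>lborel)"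
        by (rule lborel_pair.Fubini') measurable
      also have "\<dots> = (\<integral>\<^sup>+x. indicator ?I x * (\<integral>\<^sup>+t. ennreal (poisson (Complex x (shift_seq n)) t) * km m t \<partial>lborel) \<partial>lborel)"
        by (intro nn_integral_cong, subst nn_integral_cmult[symmetric], measurable)
           (intro nn_integral_cong, subst poisson_commute, simp add: mult_ac)
      also have "\<dots> \<le> (\<integral>\<^sup>+x. indicator ?I x * min (p n x) (of_nat m) \<partial>lborel)"
        using p_ge p_ge' by (intro nn_integral_mono mult_left_mono) auto
      finally show ?thesis .
    qed
    have "(\<integral>\<^sup>+t. km m t \<partial>lborel) \<le> (\<integral>\<^sup>+t. liminf (\<lambda>n. km m t * q n t) \<partial>lborel)"
    proof (rule nn_integral_mono)
      fix t
      show "km m t \<le> liminf (\<lambda>n. km m t * q n t)"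
      proof (cases "t \<in> {- real m<..<real m}")
        case True
        then have "t \<in> interior ?I" by simp
        then have "t \<notin> frontier ?I" by (simp add: frontier_def)
        then have "(\<lambda>n. q n t) \<longlonglongrightarrow> indicator ?I t"
          unfolding q_def by (rule poisson_mass_tendsto_indicator[rotated]) simp
        then have "(\<lambda>n. q n t) \<longlonglongrightarrow> 1" using True by simp
        moreover have "km m t < \<top>"
        proof -
          have "km m t \<le> of_nat m" by (auto simp: km_def split: split_indicator)
          also have "of_nat m < (\<top> :: ennreal)" by (rule of_nat_less_top)
          finally show ?thesis .
        qed
        ultimately have "(\<lambda>n. km m t * q n t) \<longlonglongrightarrow> km m t * 1" by (intro ennreal_tendsto_cmult)
        from lim_imp_Liminf[OF trivial_limit_sequentially this] show ?thesis by simp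
      qed (simp add: km_def)
    qed
    also have "\<dots> \<le> liminf (\<lambda>n. \<integral>\<^sup>+t. km m t * q n t \<partial>lborel)"
      by (rule nn_integral_liminf) measurable
    also have "\<dots> \<le> liminf (\<lambda>n. \<integral>\<^sup>+x. indicator ?I x * min (p n x) (of_nat m) \<partial>lborel)"
      by (intro Liminf_mono always_eventually allI le)
    also have "\<dots> = (\<integral>\<^sup>+x. indicator ?I x * min (h x) (of_nat m) \<partial>lborel)"
    proof (rule lim_imp_Liminf[OF trivial_limit_sequentially], rule nn_integral_dominated_convergence[where w = "\<lambda>x. of_nat m * indicator ?I x"])
      show "AE x in lborel. (\<lambda>n. indicator ?I x * min (p n x) (of_nat m)) \<longlonglongrightarrow> indicator ?I x * min (h x) (of_nat m)"
        using lim
      proof eventually_elim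
        case (elim x)
        then show ?case unfolding p_def
          by (intro ennreal_tendsto_cmult tendsto_min tendsto_const) (auto split: split_indicator)
      qed
      show "AE x in lborel. indicator ?I x * min (p n x) (of_nat m) \<le> of_nat m * indicator ?I x" for n
        by (auto split: split_indicator)
      show "(\<integral>\<^sup>+x. of_nat m * indicator ?I x \<partial>lborel) < \<infinity>"
        by (subst nn_integral_cmult_indicator) (auto simp: ennreal_mult_less_top of_nat_less_top)
    qed measurable
    also have "\<dots> \<le> (\<integral>\<^sup>+x. h x \<partial>lborel)"
      by (intro nn_integral_mono) (auto split: split_indicator)
    finally show ?thesis .
  qed
  have "(\<lambda>m. \<integral>\<^sup>+t. km m t \<partial>lborel) \<longlonglongrightarrow> (\<integral>\<^sup>+t. k t \<partial>lborel)"
  proof (rule nn_integral_LIMSEQ)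
    show "incseq km"
    proof (intro incseq_SucI le_funI)
      fix m t
      have "min (k t) (of_nat m) \<le> min (k t) (of_nat (Suc m))" by (intro min.mono order_refl) simp
      then show "km m t \<le> km (Suc m) t" unfolding km_def by (intro mult_mono) (auto split: split_indicator)
    qed
    fix t
    have "(\<lambda>m. min (k t) (of_nat m)) \<longlonglongrightarrow> min (k t) \<top>"
      by (intro tendsto_min tendsto_const of_nat_tendsto_top_ennreal)
    then have "(\<lambda>m. min (k t) (of_nat m)) \<longlonglongrightarrow> k t" by simp
    then show "(\<lambda>m. km m t) \<longlonglongrightarrow> k t"
    proof (rule Lim_transform_eventually)
      obtain M :: nat where M: "\<bar>t\<bar> < real M" using reals_Archimedean2 by blast
      show "\<forall>\<^sub>F m in sequentially. min (k t) (of_nat m) = km m t"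
        using eventually_ge_at_top[of M]
      proof eventually_elim
        case (elim m)
        then have "real M \<le> real m" by simp
        then have "t \<in> {- real m<..<real m}" using M unfolding abs_less_iff by auto
        then show ?case by (simp add: km_def)
      qed
    qed
  qed measurable
  then have "(\<integral>\<^sup>+t. k t \<partial>lborel) \<le> (\<integral>\<^sup>+x. h x \<partial>lborel)"
    by (rule LIMSEQ_le_const2) (use km_le in blast)
  moreover have "(\<integral>\<^sup>+t. k t \<partial>lborel) = emeasure (density lborel k) UNIV"
    by (subst emeasure_density) auto
  moreover have "emeasure (density lborel k) UNIV = emeasure \<mu> (- N)"
    unfolding dens by (subst emeasure_density) (auto simp: sets_borel)
  ultimately show ?thesis by simp
qed

context nevanlinna
begin

text \<open>Imaginary parts in the defining identity show that the Poisson integral of the Clark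
  measure at \<open>z\<close> is \<open>poisson (\<Phi> z) \<tau>\<close>. Its limit at the line is
  \<open>poisson (\<phi> x) \<tau>\<close> since \<open>\<phi> x \<noteq> \<tau>\<close> almost
  everywhere, so the two comparison lemmas give the absolutely continuous mass.\<close>

lemma clark_singular_mass: "emeasure (singular_part (clark_measure \<Phi> \<tau>)) UNIV = sing_mass \<tau>"
proof -
  define \<mu> where "\<mu> = clark_measure \<Phi> \<tau>"
  have clark: "is_clark_measure \<Phi> \<tau> \<mu>" unfolding \<mu>_def by (rule is_clark_measure_clark_measure)
  interpret prob_space \<mu> using clark by (simp add: is_clark_measure_def)
  interpret finite_real_measure \<mu> by standard (use clark in \<open>simp add: is_clark_measure_def\<close>)
  obtain N where N: "N \<in> null_sets lborel" "absolutely_continuous lborel (density \<mu> (indicator (- N)))"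
    and dec: "lebesgue_decomposition \<mu> (density \<mu> (indicator (- N))) (density \<mu> (indicator N))"
    by (rule lebesgue_decomposition_exists)
  have Nb [measurable]: "N \<in> sets borel" using N(1) by auto
  have ct: "cauchy_transform z = 1 / (Complex \<tau> (- 0) - \<Phi> z)" if "Im z > 0" for z
    using clark that by (simp add: is_clark_measure_def cauchy_transform_def complex_of_real_def)
  have lim: "AE x in lborel. (\<lambda>n. \<integral>\<^sup>+t. ennreal (poisson (Complex x (shift_seq n)) t) \<partial>\<mu>) \<longlonglongrightarrow> ennreal (poisson (\<phi> x) \<tau>)"
    using phi_boundary phi_ne[of \<tau>]
  proof eventually_elim
    case (elim x)
    have "(\<integral>\<^sup>+t. ennreal (poisson (Complex x (shift_seq n)) t) \<partial>\<mu>) = ennreal (poisson (\<Phi> (Complex x (shift_seq n))) \<tau>)" for n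
      using Im_resolvent_poisson[of \<tau> 0 "\<Phi> (Complex x (shift_seq n))"]
      by (simp add: cauchy_transform_Im_integral ct)
    moreover have "(\<lambda>n. poisson (\<Phi> (Complex x (shift_seq n))) \<tau>) \<longlonglongrightarrow> poisson (\<phi> x) \<tau>"
      unfolding poisson_def using elim
      by (intro tendsto_intros has_boundary_value_imp_LIMSEQ) auto
    ultimately show ?case by (simp add: tendsto_ennrealI)
  qed
  have "ac_mass \<tau> = emeasure \<mu> (- N)"
    unfolding ac_mass_def
  proof (rule antisym)
    show "(\<integral>\<^sup>+x. ennreal (poisson (\<phi> x) \<tau>) \<partial>lborel) \<le> emeasure \<mu> (- N)"
    proof (rule ac_part_mass_ge[OF _ lim _ N(1)])
      have "(\<integral>\<^sup>+x. ennreal (poisson (\<phi> x) \<tau>) \<partial>lborel) \<le> 1"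
        using ac_mass_le_1[of \<tau>] by (simp add: ac_mass_def)
      also have "1 < (\<infinity> :: ennreal)" by simp
      finally show "(\<integral>\<^sup>+x. ennreal (poisson (\<phi> x) \<tau>) \<partial>lborel) < \<infinity>" .
    qed measurable
    show "emeasure \<mu> (- N) \<le> (\<integral>\<^sup>+x. ennreal (poisson (\<phi> x) \<tau>) \<partial>lborel)"
      by (rule ac_part_mass_le[OF _ lim Nb N(2)]) measurable
  qed
  moreover have "emeasure \<mu> N + emeasure \<mu> (- N) = 1"
  proof -
    have "emeasure \<mu> N + emeasure \<mu> (- N) = emeasure \<mu> (N \<union> - N)"
      by (rule plus_emeasure) (auto simp: sets_borel)
    then show ?thesis using emeasure_space_1 by (simp add: space_UNIV)
  qed
  ultimately have "ac_mass \<tau> + emeasure \<mu> N = 1" by (simp add: add.commute)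
  also have "1 = ac_mass \<tau> + sing_mass \<tau>" by (rule ac_mass_add_sing_mass[symmetric])
  finally have "emeasure \<mu> N = sing_mass \<tau>"
    using ac_mass_le_1[of \<tau>] by (subst (asm) ennreal_add_left_cancel) (auto simp: top_unique)
  moreover have "emeasure (singular_part \<mu>) UNIV = emeasure \<mu> N"
    unfolding singular_part_eq[OF dec] by (subst emeasure_density) (auto simp: sets_borel)
  ultimately show ?thesis by (simp add: \<mu>_def)
qed

theorem constants_all_eq: "const_A \<Phi> = const_B \<Phi> \<and> const_B \<Phi> = const_C \<Phi> \<and> const_C \<Phi> = const_D \<Phi>"
  unfolding const_D_def clark_singular_mass constants_eq by simp

end

section \<open>From the integral representation to the abstract hypotheses\<close>

text \<open>Writing the kernel as \<open>z + (1 + z^2) / (t - z)\<close> reduces holomorphy to that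
  of a Cauchy transform. Its imaginary part is \<open>Im z * (1 + t^2) / |t - z|^2\<close>, hence
  non-negative. Divided by \<open>iy\<close> it is bounded by 1 for \<open>y \<ge> 1\<close> and
  tends to 0, so only the term \<open>z\<close> counts at infinity.\<close>

lemma nevanlinna_representation:
  fixes \<alpha> :: real and \<rho> :: "real measure" and \<Phi> :: "complex \<Rightarrow> complex"
  assumes "finite_measure \<rho>" and "sets \<rho> = sets borel"
    and rep: "\<And>z. z \<in> upper_half_plane \<Longrightarrow>
      \<Phi> z = complex_of_real \<alpha> + z
        + (LINT t|\<rho>. (1 + complex_of_real t * z) / (complex_of_real t - z))"
  shows "nevanlinna \<Phi>"
proof -
  interpret finite_measure \<rho> by fact
  interpret finite_real_measure \<rho> by standard fact
  have ker: "(1 + complex_of_real t * z) / (complex_of_real t - z) = z + (1 + z\<^sup>2) * (1 / (complex_of_real t - z))"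
    if "Im z > 0" for t z
  proof -
    have "complex_of_real t - z \<noteq> 0" using that by (auto simp: complex_eq_iff)
    then show ?thesis by (simp add: divide_simps) (simp add: algebra_simps power2_eq_square)
  qed
  have int: "integrable \<rho> (\<lambda>t. (1 + complex_of_real t * z) / (complex_of_real t - z))" if "Im z > 0" for z
    unfolding ker[OF that] using cauchy_kernel_integrable[OF that] by (intro Bochner_Integration.integrable_add integrable_mult_right) auto
  show ?thesis
  proof
    have eq: "\<Phi> z = complex_of_real \<alpha> + z + (measure \<rho> UNIV *\<^sub>R z + (1 + z\<^sup>2) * cauchy_transform z)" if z: "Im z > 0" for z
    proof -
      have "(LINT t|\<rho>. (1 + complex_of_real t * z) / (complex_of_real t - z))
          = (LINT t|\<rho>. z) + (LINT t|\<rho>. (1 + z\<^sup>2) * (1 / (complex_of_real t - z)))"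
        unfolding ker[OF z] using cauchy_kernel_integrable[OF z] by (intro Bochner_Integration.integral_add integrable_mult_right) auto
      also have "\<dots> = measure \<rho> UNIV *\<^sub>R z + (1 + z\<^sup>2) * cauchy_transform z"
        unfolding cauchy_transform_def by (subst Bochner_Integration.integral_mult_right_zero) (simp add: space_UNIV)
      finally show ?thesis using rep[of z] z by simp
    qed
    have "(\<lambda>z. complex_of_real \<alpha> + z + (measure \<rho> UNIV *\<^sub>R z + (1 + z\<^sup>2) * cauchy_transform z)) holomorphic_on upper_half_plane"
      unfolding scaleR_conv_of_real by (intro holomorphic_intros holomorphic_cauchy_transform)
    then show "\<Phi> holomorphic_on upper_half_plane"
      by (rule holomorphic_transform) (simp add: eq)
  next
    fix z assume z: "Im z > 0"
    have "Im ((1 + complex_of_real t * z) / (complex_of_real t - z)) \<ge> 0" for t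
    proof -
      have "Im ((1 + complex_of_real t * z) / (complex_of_real t - z)) = Im z * (1 + t\<^sup>2) / (cmod (complex_of_real t - z))\<^sup>2"
        unfolding Im_divide cmod_power2 by (simp add: power2_eq_square algebra_simps)
      then show ?thesis using z by simp
    qed
    then have "0 \<le> (LINT t|\<rho>. Im ((1 + complex_of_real t * z) / (complex_of_real t - z)))"
      by (intro integral_nonneg_AE AE_I2)
    then have "0 \<le> Im (LINT t|\<rho>. (1 + complex_of_real t * z) / (complex_of_real t - z))"
      unfolding integral_Im[OF int[OF z]] .
    then show "Im z \<le> Im (\<Phi> z)" using rep[of z] z by simp
  next
    define k where "k y t = (1 + complex_of_real t * Complex 0 y) / (complex_of_real t - Complex 0 y) / Complex 0 y" for y t
    have k_bound: "cmod (k y t) \<le> (1 + \<bar>t\<bar> * y) / y\<^sup>2" if y: "y > 0" for y t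
    proof -
      have "y \<le> \<bar>Im (complex_of_real t - Complex 0 y)\<bar>" by simp
      also have "\<dots> \<le> cmod (complex_of_real t - Complex 0 y)" by (rule abs_Im_le_cmod)
      finally have d: "y \<le> cmod (complex_of_real t - Complex 0 y)" .
      have n: "cmod (Complex 0 y) = y" using y by (simp add: cmod_def)
      have "cmod (1 + complex_of_real t * Complex 0 y) \<le> 1 + \<bar>t\<bar> * y"
        using norm_triangle_ineq[of 1 "complex_of_real t * Complex 0 y"] by (simp add: norm_mult n)
      then have "cmod (1 + complex_of_real t * Complex 0 y) / (cmod (complex_of_real t - Complex 0 y) * y) \<le> (1 + \<bar>t\<bar> * y) / (y * y)"
        using d y by (intro frac_le mult_right_mono) auto
      then show ?thesis unfolding k_def norm_divide n power2_eq_square by (simp only: divide_divide_eq_left)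
    qed
    have k_bound1: "cmod (k y t) \<le> 1" if y: "y \<ge> 1" for y t
    proof -
      \<comment> \<open>Exactly the gap between \<open>1 + t^2 y^2\<close> and
        \<open>(t^2 + y^2) y^2\<close>, the squared numerator and denominator of
        \<open>k y t\<close>.\<close>
      have "1 \<le> y ^ 4" using y by (rule one_le_power)
      then have "1 + (t * y)\<^sup>2 \<le> (t\<^sup>2 + y\<^sup>2) * y\<^sup>2"
        by (simp add: power2_eq_square algebra_simps power4_eq_xxxx)
      then have "(cmod (1 + complex_of_real t * Complex 0 y))\<^sup>2 \<le> (cmod (complex_of_real t - Complex 0 y) * cmod (Complex 0 y))\<^sup>2"
        unfolding power_mult_distrib cmod_power2 by (simp add: power_mult_distrib)
      then have le: "cmod (1 + complex_of_real t * Complex 0 y) \<le> cmod (complex_of_real t - Complex 0 y) * cmod (Complex 0 y)"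
        by (rule power2_le_imp_le) simp
      have "cmod (complex_of_real t - Complex 0 y) * cmod (Complex 0 y) > 0" using y by (auto simp: complex_eq_iff)
      with le show ?thesis by (simp add: k_def norm_divide norm_mult del: divide_le_eq_1)
    qed
    have "((\<lambda>y. LINT t|\<rho>. k y t) \<longlongrightarrow> (LINT t|\<rho>. 0)) at_top"
    proof (rule integral_dominated_convergence_at_top[where w = "\<lambda>_. 1"])
      show "AE t in \<rho>. ((\<lambda>y. k y t) \<longlongrightarrow> 0) at_top"
      proof (rule AE_I2, rule Lim_null_comparison)
        fix t
        show "\<forall>\<^sub>F y in at_top. norm (k y t) \<le> (1 + \<bar>t\<bar> * y) / y\<^sup>2"
          using eventually_gt_at_top[of 0] by eventually_elim (rule k_bound)
        show "((\<lambda>y. (1 + \<bar>t\<bar> * y) / y\<^sup>2) \<longlongrightarrow> 0) at_top" by real_asymp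
      qed
      show "\<forall>\<^sub>F y in at_top. AE t in \<rho>. norm (k y t) \<le> 1"
        using eventually_ge_at_top[of 1] by eventually_elim (simp add: k_bound1)
      show "k y \<in> borel_measurable \<rho>" for y unfolding k_def by measurable
    qed auto
    then have lim: "((\<lambda>y. LINT t|\<rho>. k y t) \<longlongrightarrow> 0) at_top" by simp
    have lim2: "((\<lambda>y. complex_of_real (\<alpha> / y) * (- \<i>)) \<longlongrightarrow> complex_of_real 0 * (- \<i>)) at_top"
      by (intro tendsto_mult tendsto_const tendsto_of_real) real_asymp
    have "((\<lambda>y. complex_of_real (\<alpha> / y) * (- \<i>) + 1 + (LINT t|\<rho>. k y t)) \<longlongrightarrow> complex_of_real 0 * (- \<i>) + 1 + 0) at_top"
      by (intro tendsto_add lim lim2 tendsto_const)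
    then have "((\<lambda>y. complex_of_real (\<alpha> / y) * (- \<i>) + 1 + (LINT t|\<rho>. k y t)) \<longlongrightarrow> 1) at_top" by simp
    then show "((\<lambda>y. \<Phi> (Complex 0 y) / Complex 0 y) \<longlongrightarrow> 1) at_top"
    proof (rule Lim_transform_eventually)
      show "\<forall>\<^sub>F y in at_top. complex_of_real (\<alpha> / y) * (- \<i>) + 1 + (LINT t|\<rho>. k y t) = \<Phi> (Complex 0 y) / Complex 0 y"
        using eventually_gt_at_top[of 0]
      proof eventually_elim
        case (elim y)
        have ne: "Complex 0 y \<noteq> 0" using elim by (simp add: complex_eq_iff)
        have "complex_of_real (\<alpha> / y) * (- \<i>) = complex_of_real \<alpha> / Complex 0 y"
          using elim by (simp add: complex_eq_iff Re_divide Im_divide power2_eq_square)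
        moreover have "(LINT t|\<rho>. k y t) = (LINT t|\<rho>. (1 + complex_of_real t * Complex 0 y) / (complex_of_real t - Complex 0 y)) / Complex 0 y"
          unfolding k_def by (rule Bochner_Integration.integral_divide_zero)
        ultimately show ?case using rep[of "Complex 0 y"] elim ne by (simp add: add_divide_distrib)
      qed
    qed
  qed
qed

theorem theorem3p1:
  fixes \<alpha> :: real and \<rho> :: "real measure" and \<Phi> :: "complex \<Rightarrow> complex"
  assumes "finite_measure \<rho>" and "sets \<rho> = sets borel"
    and "\<And>z. z \<in> upper_half_plane \<Longrightarrow>
      \<Phi> z = complex_of_real \<alpha> + z
        + (LINT t|\<rho>. (1 + complex_of_real t * z) / (complex_of_real t - z))"
  shows "const_A \<Phi> = const_B \<Phi> \<and> const_B \<Phi> = const_C \<Phi> \<and> const_C \<Phi> = const_D \<Phi>"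
proof -
  interpret nevanlinna \<Phi> by (rule nevanlinna_representation[OF assms])
  show ?thesis by (rule constants_all_eq)
qed

end
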